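(* Let $\mathbf{K}$ be a field of characteristic $0$ and let $A^\bullet$ be a cosimplicial differential graded commutative algebra over $\mathbf{K}$. Then the cochain complex $\mathrm{Tot}(A^\bullet)$ associated to $A^\bullet$ (or rather, the shifted complex $\mathrm{Tot}(A^\bullet)[1]$) has a canonical $C_\infty$-structure. If $A^\bullet$ is unital, then $\mathrm{Tot}(A^\bullet)[1]$ is unital.
   Context: Conventions: $|a|$ is the degree of a homogeneous element $a$; multilinear maps are composed and tensored using the Koszul sign rule; $V[1]^k=V^{k+1}$. $A_\infty$-algebra: a cochain complex $A$ over $\mathbf{K}$ with multilinear maps $m_n^A:A^{\otimes n}\to A$, $n\ge1$, of degree $1$, such that $m_1^A$ is the differential $d$ and, for all $n\ge1$, $\sum_{k=1}^{n}\sum_{j=0}^{n-k} m_{n-k+1}^{A}\circ(1_A^{\otimes j}\otimes m_{k}^{A}\otimes 1_A^{\otimes n-j-k})=0$. (In this grading convention a differential graded algebra $C$ corresponds to an $A_\infty$-structure on $C[1]$, which is why the structure in the claim lives on the shifted complex.) Identity: an identity for an $A_\infty$-algebra $A$ is an element $e_A\in A$ of degree $-1$ with $m_1^A(e_A)=0$, $m_2^A(e_A,a)=(-1)^{|a|+1}m_2^A(a,e_A)=a$ for all $a$, and $m_n^A(a_1,\dots,e_A,\dots,a_n)=0$ for $n>2$, with $e_A$ in any position. An $A_\infty$-algebra (in particular, one whose structure is $C_\infty$) is unital if it has an identity. $C_\infty$-structure: let $TA=\bigoplus_{n\ge1}A^{\otimes n}$, with the graded commutative shuffle product, in which the product of the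 words $a_1\cdots a_p$ and $a_{p+1}\cdots a_{p+q}$ is the sum of all $(p,q)$-shuffles of the two words, each with the Koszul sign obtained by moving graded letters past each other. A $C_\infty$-structure on $A$ is an $A_\infty$-structure such that, for each $n>1$, $m_n^A$ vanishes on all shuffle products of two elements of $TA$ (that is, on the part of the span of such products lying in $A^{\otimes n}$). $\mathrm{Tot}$: let $N_n$ be the normalized simplicial cochain complex over $\mathbf{K}$ of the standard $n$-simplex $\Delta^n$; these form a simplicial cochain complex $N_\bullet$. The normalization of $A^\bullet$ is the end in cochain complexes $\mathrm{Tot}(A^\bullet)=\int_{[n]\in\Delta}N_n\otimes A^n$, i.e. the complex of families $(x_n)_{n\ge0}$, $x_n\in N_n\otimes A^n$, such that $(\theta^*\otimes1)x_n=(1\otimes\theta_* )x_m$ for every $\theta:[m]\to[n]$ in the simplex category $\Delta$. For example, if $X_\bullet$ is a simplicial set and $A^n$ is the algebra of functions from $X_n$ to $\mathbf{K}$, then $\mathrm{Tot}(A^\bullet)$ is the complex of normalized simplicial cochains on $X_\bullet$. Unital: a cosimplicial differential graded commutative algebra $A^\bullet$ is unital if each component algebra $A^n$ is unital and the identities are preserved by the cosimplicial maps. *)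

theory Defs
  imports Complex_Main "HOL-Library.Function_Algebras"
begin

section \<open>Graded vector spaces\<close>

text \<open>
  A graded vector space is a family of subspaces \<open>C k\<close>, indexed by the degree \<open>k :: int\<close>, of one
  ambient vector space. The subspaces need not be independent: degrees are always passed
  explicitly, so this is a family of spaces and not an internal direct sum. Operations
  are only meaningful on these subspaces; their values elsewhere are irrelevant.
\<close>

definition koszul :: "int \<Rightarrow> 'v::ab_group_add \<Rightarrow> 'v" where
  "koszul k x = (if even k then x else - x)"

definition linear_on_into ::
  "('k \<Rightarrow> 'v \<Rightarrow> 'v::ab_group_add) \<Rightarrow> ('k \<Rightarrow> 'w \<Rightarrow> 'w::ab_group_add)
    \<Rightarrow> 'v set \<Rightarrow> 'w set \<Rightarrow> ('v \<Rightarrow> 'w) \<Rightarrow> bool" where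
  "linear_on_into s t V W f \<longleftrightarrow>
    (\<forall>x\<in>V. f x \<in> W) \<and>
    (\<forall>x\<in>V. \<forall>y\<in>V. f (x + y) = f x + f y) \<and>
    (\<forall>c. \<forall>x\<in>V. f (s c x) = t c (f x))"

locale cochain_complex = vector_space scale
  for scale :: "'k::field \<Rightarrow> 'v::ab_group_add \<Rightarrow> 'v" +
  fixes C :: "int \<Rightarrow> 'v set" and d :: "int \<Rightarrow> 'v \<Rightarrow> 'v"
  assumes subspace_part: "subspace (C k)"
    and d_linear: "linear_on_into scale scale (C k) (C (k + 1)) (d k)"
    and d_squared: "x \<in> C k \<Longrightarrow> d (k + 1) (d k x) = 0"

definition shift :: "(int \<Rightarrow> 'b) \<Rightarrow> int \<Rightarrow> 'b" where
  "shift C k = C (k + 1)"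


section \<open>\<open>A\<^sub>\<infinity>\<close>- and \<open>C\<^sub>\<infinity>\<close>-algebras\<close>

text \<open>
  A letter is a homogeneous element paired with its degree. A word of length \<open>n\<close> stands for a
  pure tensor in the \<open>n\<close>-fold tensor power, and a single function \<open>m\<close> on words comprises
  all the operations \<open>m\<^sub>n\<close>.
\<close>

type_synonym 'v word = "(int \<times> 'v) list"

definition words :: "(int \<Rightarrow> 'v set) \<Rightarrow> 'v word set" where
  "words V = {w. \<forall>(k, x) \<in> set w. x \<in> V k}"

definition wdeg :: "'v word \<Rightarrow> int" where
  "wdeg w = sum_list (map fst w)"

text \<open>The Koszul sign in \<open>A_infinity_relation\<close> comes from moving the degree \<open>1\<close> map \<open>m\<^sub>k\<close> past the
  first \<open>j\<close> letters.\<close>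

locale A_infinity_algebra = cochain_complex scale V d
  for scale :: "'k::field \<Rightarrow> 'v::ab_group_add \<Rightarrow> 'v" and V d +
  fixes m :: "'v word \<Rightarrow> 'v"
  assumes m_multilinear: "u \<in> words V \<Longrightarrow> v \<in> words V \<Longrightarrow>
      linear_on_into scale scale (V k) (V (wdeg u + k + wdeg v + 1)) (\<lambda>x. m (u @ (k, x) # v))"
    and m_1: "x \<in> V k \<Longrightarrow> m [(k, x)] = d k x"
    and A_infinity_relation: "w \<in> words V \<Longrightarrow> length w = n \<Longrightarrow> n \<ge> 1 \<Longrightarrow>
      (\<Sum>k = 1..n. \<Sum>j = 0..n - k.
        koszul (wdeg (take j w))
          (m (take j w
              @ [(wdeg (take k (drop j w)) + 1, m (take k (drop j w)))]
              @ drop (j + k) w))) = 0"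

text \<open>The list of all shuffles of two words, with multiplicity; each comes with the exponent of its
  Koszul sign.\<close>

fun signed_shuffles :: "'v word \<Rightarrow> 'v word \<Rightarrow> (int \<times> 'v word) list" where
  "signed_shuffles [] v = [(0, v)]"
| "signed_shuffles u [] = [(0, u)]"
| "signed_shuffles (a # u) (b # v) =
    map (\<lambda>(e, w). (e, a # w)) (signed_shuffles u (b # v)) @
    map (\<lambda>(e, w). (e + fst b * wdeg (a # u), b # w)) (signed_shuffles (a # u) v)"

lemma set_signed_shuffles: "snd ` set (signed_shuffles u v) = shuffles u v"
proof (induction u v rule: signed_shuffles.induct)
  case (3 a u b v)
  have "snd ` set (signed_shuffles (a # u) (b # v)) =
      (#) a ` (snd ` set (signed_shuffles u (b # v))) \<union>
      (#) b ` (snd ` set (signed_shuffles (a # u) v))"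
    by (simp add: image_Un image_image case_prod_beta)
  then show ?case using 3 by simp
qed simp_all

lemma length_signed_shuffles:
  "length (signed_shuffles u v) = (length u + length v) choose length u"
  by (induction u v rule: signed_shuffles.induct) simp_all

locale C_infinity_algebra = A_infinity_algebra +
  assumes m_shuffle: "u \<in> words V \<Longrightarrow> v \<in> words V \<Longrightarrow> u \<noteq> [] \<Longrightarrow> v \<noteq> [] \<Longrightarrow>
      (\<Sum>(e, w) \<leftarrow> signed_shuffles u v. koszul e (m w)) = 0"

definition is_identity :: "(int \<Rightarrow> 'v::ab_group_add set) \<Rightarrow> ('v word \<Rightarrow> 'v) \<Rightarrow> 'v \<Rightarrow> bool" where
  "is_identity V m e \<longleftrightarrow>
    e \<in> V (- 1) \<and>
    m [(- 1, e)] = 0 \<and>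
    (\<forall>k. \<forall>a \<in> V k. m [(- 1, e), (k, a)] = a \<and> koszul (k + 1) (m [(k, a), (- 1, e)]) = a) \<and>
    (\<forall>u \<in> words V. \<forall>v \<in> words V. length u + 1 + length v > 2 \<longrightarrow> m (u @ (- 1, e) # v) = 0)"

definition unital_A_infinity :: "(int \<Rightarrow> 'v::ab_group_add set) \<Rightarrow> ('v word \<Rightarrow> 'v) \<Rightarrow> bool" where
  "unital_A_infinity V m \<longleftrightarrow> (\<exists>e. is_identity V m e)"

text \<open>A degree \<open>0\<close> map \<open>f\<close> that commutes with all the operations.\<close>

definition preserves_operations ::
  "(int \<Rightarrow> 'v set) \<Rightarrow> ('v word \<Rightarrow> 'v) \<Rightarrow> ('w word \<Rightarrow> 'w) \<Rightarrow> (int \<Rightarrow> 'v \<Rightarrow> 'w) \<Rightarrow> bool" where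
  "preserves_operations V m m' f \<longleftrightarrow>
    (\<forall>w \<in> words V. w \<noteq> [] \<longrightarrow>
      f (wdeg w + 1) (m w) = m' (map (\<lambda>(k, x). (k, f k x)) w))"


section \<open>Cosimplicial differential graded commutative algebras\<close>

record 'a dg_alg =
  part :: "int \<Rightarrow> 'a set"
  diff :: "int \<Rightarrow> 'a \<Rightarrow> 'a"
  mult :: "int \<Rightarrow> int \<Rightarrow> 'a \<Rightarrow> 'a \<Rightarrow> 'a"

locale dg_comm_algebra =
  cochain_complex scale "part R" "diff R"
  for scale :: "'k::field \<Rightarrow> 'a::ab_group_add \<Rightarrow> 'a" and R :: "'a dg_alg" +
  assumes mult_linear_left: "b \<in> part R q \<Longrightarrow>
      linear_on_into scale scale (part R p) (part R (p + q)) (\<lambda>a. mult R p q a b)"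
    and mult_linear_right: "a \<in> part R p \<Longrightarrow>
      linear_on_into scale scale (part R q) (part R (p + q)) (\<lambda>b. mult R p q a b)"
    and mult_assoc: "a \<in> part R p \<Longrightarrow> b \<in> part R q \<Longrightarrow> c \<in> part R r \<Longrightarrow>
      mult R (p + q) r (mult R p q a b) c = mult R p (q + r) a (mult R q r b c)"
    and mult_graded_comm: "a \<in> part R p \<Longrightarrow> b \<in> part R q \<Longrightarrow>
      mult R p q a b = koszul (p * q) (mult R q p b a)"
    and leibniz: "a \<in> part R p \<Longrightarrow> b \<in> part R q \<Longrightarrow>
      diff R (p + q) (mult R p q a b) =
        mult R (p + 1) q (diff R p a) b + koszul p (mult R p (q + 1) a (diff R q b))"

definition is_one :: "'a dg_alg \<Rightarrow> 'a \<Rightarrow> bool" where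
  "is_one R e \<longleftrightarrow> e \<in> part R 0 \<and>
    (\<forall>p. \<forall>a \<in> part R p. mult R 0 p e a = a \<and> mult R p 0 a e = a)"

definition dg_alg_hom ::
  "('k \<Rightarrow> 'a \<Rightarrow> 'a::ab_group_add) \<Rightarrow> 'a dg_alg \<Rightarrow> 'a dg_alg \<Rightarrow> (int \<Rightarrow> 'a \<Rightarrow> 'a) \<Rightarrow> bool" where
  "dg_alg_hom scale R S f \<longleftrightarrow>
    (\<forall>p. linear_on_into scale scale (part R p) (part S p) (f p)) \<and>
    (\<forall>p. \<forall>a \<in> part R p. f (p + 1) (diff R p a) = diff S p (f p a)) \<and>
    (\<forall>p q. \<forall>a \<in> part R p. \<forall>b \<in> part R q.
      f (p + q) (mult R p q a b) = mult S p q (f p a) (f q b))"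

text \<open>
  A morphism \<open>\<theta> : [m] \<rightarrow> [n]\<close> of the simplex category is represented by the list
  \<open>[\<theta> 0, \<dots>, \<theta> m]\<close>. Such a list is also an \<open>m\<close>-simplex of the standard simplex \<open>\<Delta>\<^sup>n\<close>, and it is
  nondegenerate when its entries are distinct.
\<close>

definition Delta :: "nat \<Rightarrow> nat \<Rightarrow> nat list set" where
  "Delta m n = {\<theta>. length \<theta> = m + 1 \<and> sorted \<theta> \<and> set \<theta> \<subseteq> {..n}}"

definition comp_Delta :: "nat list \<Rightarrow> nat list \<Rightarrow> nat list" where
  "comp_Delta \<theta> \<sigma> = map (\<lambda>i. \<theta> ! i) \<sigma>"

record 'a cosimplicial_dg_alg =
  obj :: "nat \<Rightarrow> 'a dg_alg"
  act :: "nat \<Rightarrow> nat \<Rightarrow> nat list \<Rightarrow> int \<Rightarrow> 'a \<Rightarrow> 'a"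

locale cosimplicial_dg_comm_algebra =
  fixes scale :: "'k::field \<Rightarrow> 'a::ab_group_add \<Rightarrow> 'a" and A :: "'a cosimplicial_dg_alg"
  assumes obj_algebra: "dg_comm_algebra scale (obj A n)"
    and act_hom: "\<theta> \<in> Delta m n \<Longrightarrow> dg_alg_hom scale (obj A m) (obj A n) (act A m n \<theta>)"
    and act_id: "a \<in> part (obj A n) p \<Longrightarrow> act A n n [0..<n + 1] p a = a"
    and act_comp: "\<theta> \<in> Delta m n \<Longrightarrow> \<sigma> \<in> Delta l m \<Longrightarrow> a \<in> part (obj A l) p \<Longrightarrow>
      act A l n (comp_Delta \<theta> \<sigma>) p a = act A m n \<theta> p (act A l m \<sigma> p a)"

definition unital_cosimplicial :: "'a cosimplicial_dg_alg \<Rightarrow> bool" where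
  "unital_cosimplicial A \<longleftrightarrow>
    (\<exists>e. (\<forall>n. is_one (obj A n) (e n)) \<and>
         (\<forall>m n. \<forall>\<theta> \<in> Delta m n. act A m n \<theta> 0 (e m) = e n))"

definition cosimplicial_hom ::
  "('k \<Rightarrow> 'a \<Rightarrow> 'a::ab_group_add) \<Rightarrow> 'a cosimplicial_dg_alg \<Rightarrow> 'a cosimplicial_dg_alg
    \<Rightarrow> (nat \<Rightarrow> int \<Rightarrow> 'a \<Rightarrow> 'a) \<Rightarrow> bool" where
  "cosimplicial_hom scale A B f \<longleftrightarrow>
    (\<forall>n. dg_alg_hom scale (obj A n) (obj B n) (f n)) \<and>
    (\<forall>m n. \<forall>\<theta> \<in> Delta m n. \<forall>p. \<forall>a \<in> part (obj A m) p.
      f n p (act A m n \<theta> p a) = act B m n \<theta> p (f m p a))"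


section \<open>Normalized cochains on the standard simplices\<close>

definition nondegenerate :: "nat \<Rightarrow> nat list set" where
  "nondegenerate n = {\<sigma>. (\<exists>p. \<sigma> \<in> Delta p n) \<and> distinct \<sigma>}"

definition simplex_dim :: "nat list \<Rightarrow> int" where
  "simplex_dim \<sigma> = int (length \<sigma>) - 1"

text \<open>The degree \<open>p\<close> part of \<open>N\<^sub>n\<close>: functions on the \<open>p\<close>-simplices of \<open>\<Delta>\<^sup>n\<close> that vanish on the degenerate
  ones, extended by zero to all lists.\<close>

definition N :: "nat \<Rightarrow> int \<Rightarrow> (nat list \<Rightarrow> 'k::zero) set" where
  "N n p = {f. \<forall>\<sigma>. f \<sigma> \<noteq> 0 \<longrightarrow> \<sigma> \<in> nondegenerate n \<and> simplex_dim \<sigma> = p}"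

text \<open>The coboundary of \<open>N\<^sub>n\<close> and the pullback \<open>N\<^sub>n \<rightarrow> N\<^sub>m\<close> along \<open>\<theta> : [m] \<rightarrow> [n]\<close>. Both are stated for cochains
  with coefficients in any abelian group, so that they also give the maps \<open>\<delta> \<otimes> 1\<close> and
  \<open>\<theta>\<^sup>* \<otimes> 1\<close> below.\<close>

definition coboundary :: "nat \<Rightarrow> (nat list \<Rightarrow> 'b::ab_group_add) \<Rightarrow> nat list \<Rightarrow> 'b" where
  "coboundary n f \<sigma> =
    (if \<sigma> \<in> nondegenerate n
     then \<Sum>i < length \<sigma>. koszul (int i) (f (take i \<sigma> @ drop (i + 1) \<sigma>)) else 0)"

definition pullback :: "nat \<Rightarrow> nat list \<Rightarrow> (nat list \<Rightarrow> 'b::zero) \<Rightarrow> nat list \<Rightarrow> 'b" where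
  "pullback m \<theta> f \<sigma> = (if \<sigma> \<in> nondegenerate m then f (comp_Delta \<theta> \<sigma>) else 0)"

definition pointwise :: "('k \<Rightarrow> 'a \<Rightarrow> 'a) \<Rightarrow> 'k \<Rightarrow> ('i \<Rightarrow> 'a) \<Rightarrow> 'i \<Rightarrow> 'a" where
  "pointwise scale c x i = scale c (x i)"

text \<open>
  Since \<open>N\<^sub>n\<close> is finite-dimensional, \<open>N\<^sub>n \<otimes> C\<close> is modelled by the normalized cochains on \<open>\<Delta>\<^sup>n\<close> with
  values in \<open>C\<close>, the pure tensor \<open>f \<otimes> a\<close> being the cochain \<open>\<lambda>\<sigma>. f \<sigma> \<cdot> a\<close>. The lemma
  \<open>N_tensor_universal\<close> shows that this is the tensor product of graded vector spaces;
  \<open>N_tensor_diff_pure\<close>, \<open>pullback_pure\<close> and \<open>coeff_map_pure\<close> identify the maps on it.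
\<close>

definition N_tensor :: "nat \<Rightarrow> (int \<Rightarrow> 'a::zero set) \<Rightarrow> int \<Rightarrow> (nat list \<Rightarrow> 'a) set" where
  "N_tensor n C k =
    {x. \<forall>\<sigma>. if \<sigma> \<in> nondegenerate n then x \<sigma> \<in> C (k - simplex_dim \<sigma>) else x \<sigma> = 0}"

definition pure_tensor :: "('k \<Rightarrow> 'a \<Rightarrow> 'a) \<Rightarrow> (nat list \<Rightarrow> 'k) \<Rightarrow> 'a \<Rightarrow> nat list \<Rightarrow> 'a" where
  "pure_tensor scale f a \<sigma> = scale (f \<sigma>) a"

definition N_tensor_diff ::
  "nat \<Rightarrow> (int \<Rightarrow> 'a \<Rightarrow> 'a::ab_group_add) \<Rightarrow> int \<Rightarrow> (nat list \<Rightarrow> 'a) \<Rightarrow> nat list \<Rightarrow> 'a" where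
  "N_tensor_diff n d k x \<sigma> =
    (if \<sigma> \<in> nondegenerate n
     then coboundary n x \<sigma> + koszul (simplex_dim \<sigma>) (d (k - simplex_dim \<sigma>) (x \<sigma>)) else 0)"

text \<open>The map \<open>1 \<otimes> g\<close> on elements of total degree \<open>k\<close>, for a degree \<open>0\<close> map \<open>g\<close>.\<close>

definition coeff_map ::
  "nat \<Rightarrow> (int \<Rightarrow> 'a \<Rightarrow> 'b::zero) \<Rightarrow> int \<Rightarrow> (nat list \<Rightarrow> 'a) \<Rightarrow> nat list \<Rightarrow> 'b" where
  "coeff_map n g k x \<sigma> = (if \<sigma> \<in> nondegenerate n then g (k - simplex_dim \<sigma>) (x \<sigma>) else 0)"

lemma finite_nondegenerate: "finite (nondegenerate n)"
proof -
  have "nondegenerate n \<subseteq> {\<sigma>. set \<sigma> \<subseteq> {..n} \<and> length \<sigma> \<le> n + 1}"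
  proof
    fix \<sigma> assume "\<sigma> \<in> nondegenerate n"
    then have *: "set \<sigma> \<subseteq> {..n}" "distinct \<sigma>"
      by (auto simp: nondegenerate_def Delta_def)
    have "card (set \<sigma>) \<le> card {..n}" by (rule card_mono) (use * in auto)
    then show "\<sigma> \<in> {\<sigma>. set \<sigma> \<subseteq> {..n} \<and> length \<sigma> \<le> n + 1}"
      using * by (simp add: distinct_card)
  qed
  then show ?thesis by (rule finite_subset) (rule finite_lists_length_le, simp)
qed

lemma linear_on_into_sum:
  assumes "module s" "module t" "module.subspace s V" "linear_on_into s t V W f"
    and "finite I" "\<And>i. i \<in> I \<Longrightarrow> x i \<in> V"
  shows "(\<Sum>i\<in>I. x i) \<in> V \<and> f (\<Sum>i\<in>I. x i) = (\<Sum>i\<in>I. f (x i))"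
  using assms(5,6)
proof (induction I rule: finite_induct)
  case empty
  have z: "0 \<in> V" using assms(1,3) by (simp add: module.subspace_0)
  have "f (s 0 0) = t 0 (f 0)" using assms(4) z by (simp add: linear_on_into_def)
  then show ?case
    using z module.scale_zero_left[OF assms(1)] module.scale_zero_left[OF assms(2)] by simp
next
  case (insert i I)
  then show ?case
    using assms(4) module.subspace_add[OF assms(1,3)] by (simp add: linear_on_into_def)
qed

lemma linear_on_into_zero:
  assumes "module s" "module t" "module.subspace s V" "linear_on_into s t V W f"
  shows "f 0 = 0"
  using linear_on_into_sum[OF assms, of "{}" "\<lambda>_. 0"] by simp

lemma pure_tensor_in:
  assumes "module scale" "\<And>k. module.subspace scale (C k)" "f \<in> N n p" "a \<in> C (k - p)"
  shows "pure_tensor scale f a \<in> N_tensor n C k"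
proof -
  have "scale (f \<sigma>) a \<in> C (k - simplex_dim \<sigma>)" for \<sigma>
  proof (cases "f \<sigma> = 0")
    case True
    then show ?thesis
      using module.scale_zero_left[OF assms(1)] module.subspace_0[OF assms(1,2)] by simp
  next
    case False
    then have "simplex_dim \<sigma> = p" using assms(3) by (auto simp: N_def)
    then show ?thesis using module.subspace_scale[OF assms(1,2)] assms(4) by simp
  qed
  moreover have "scale (f \<sigma>) a = 0" if "\<sigma> \<notin> nondegenerate n" for \<sigma>
  proof -
    have "f \<sigma> = 0" using that assms(3) by (auto simp: N_def)
    then show ?thesis using module.scale_zero_left[OF assms(1)] by simp
  qed
  ultimately show ?thesis by (auto simp: N_tensor_def pure_tensor_def)
qed

lemma module_pointwise: "module scale \<Longrightarrow> module (pointwise scale)"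
  unfolding module_def pointwise_def by (auto simp: fun_eq_iff)

lemma module_field: "module ((*) :: 'k \<Rightarrow> 'k \<Rightarrow> 'k::field)"
  by unfold_locales (auto simp: algebra_simps)

lemma subspace_N: "module.subspace (pointwise (*)) (N n p :: (nat list \<Rightarrow> 'k::field) set)"
  unfolding module.subspace_def[OF module_pointwise[OF module_field]]
proof (intro conjI ballI allI)
  fix f g :: "nat list \<Rightarrow> 'k" assume fg: "f \<in> N n p" "g \<in> N n p"
  show "f + g \<in> N n p" unfolding N_def
  proof (intro CollectI allI impI)
    fix \<sigma> assume "(f + g) \<sigma> \<noteq> 0"
    then have "f \<sigma> \<noteq> 0 \<or> g \<sigma> \<noteq> 0" by auto
    then show "\<sigma> \<in> nondegenerate n \<and> simplex_dim \<sigma> = p" using fg by (auto simp: N_def)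
  qed
qed (auto simp: N_def pointwise_def)

lemma subspace_N_tensor:
  assumes "module scale" "\<And>k. module.subspace scale (C k)"
  shows "module.subspace (pointwise scale) (N_tensor n C k)"
  unfolding module.subspace_def[OF module_pointwise[OF assms(1)]]
  using module.subspace_0[OF assms] module.subspace_add[OF assms] module.subspace_scale[OF assms]
    module.scale_zero_right[OF assms(1)]
  by (auto simp: N_tensor_def pointwise_def)

lemma N_tensor_universal:
  fixes scale :: "'k::field \<Rightarrow> 'a::ab_group_add \<Rightarrow> 'a" and t :: "'k \<Rightarrow> 'w::ab_group_add \<Rightarrow> 'w"
  assumes scale: "module scale" and C: "\<And>k. module.subspace scale (C k)" and t: "module t"
    and B_left: "\<And>p a. a \<in> C (k - p) \<Longrightarrow>
      linear_on_into (pointwise (*)) t (N n p) UNIV (\<lambda>f. B p f a)"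
    and B_right: "\<And>p f. f \<in> N n p \<Longrightarrow> linear_on_into scale t (C (k - p)) UNIV (\<lambda>a. B p f a)"
  shows "\<exists>F. linear_on_into (pointwise scale) t (N_tensor n C k) UNIV F \<and>
      (\<forall>p. \<forall>f \<in> N n p. \<forall>a \<in> C (k - p). F (pure_tensor scale f a) = B p f a) \<and>
      (\<forall>G. linear_on_into (pointwise scale) t (N_tensor n C k) UNIV G \<and>
        (\<forall>p. \<forall>f \<in> N n p. \<forall>a \<in> C (k - p). G (pure_tensor scale f a) = B p f a) \<longrightarrow>
        (\<forall>x \<in> N_tensor n C k. G x = F x))"
    (is "\<exists>F. ?lin F \<and> ?ext F \<and> _")
proof -
  define e :: "nat list \<Rightarrow> nat list \<Rightarrow> 'k" where "e \<sigma> \<tau> = (if \<tau> = \<sigma> then 1 else 0)" for \<sigma> \<tau>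
  have e_N: "e \<sigma> \<in> N n (simplex_dim \<sigma>)" if "\<sigma> \<in> nondegenerate n" for \<sigma>
    using that by (auto simp: N_def e_def)
  define F where "F x = (\<Sum>\<sigma>\<in>nondegenerate n. B (simplex_dim \<sigma>) (e \<sigma>) (x \<sigma>))" for x
  have lin: "?lin F"
    unfolding linear_on_into_def
  proof (intro conjI ballI allI)
    fix x y assume xy: "x \<in> N_tensor n C k" "y \<in> N_tensor n C k"
    have "B (simplex_dim \<sigma>) (e \<sigma>) (x \<sigma> + y \<sigma>)
        = B (simplex_dim \<sigma>) (e \<sigma>) (x \<sigma>) + B (simplex_dim \<sigma>) (e \<sigma>) (y \<sigma>)"
      if s: "\<sigma> \<in> nondegenerate n" for \<sigma>
    proof -
      have "x \<sigma> \<in> C (k - simplex_dim \<sigma>)" "y \<sigma> \<in> C (k - simplex_dim \<sigma>)"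
        using xy s by (auto simp: N_tensor_def split: if_splits)
      then show ?thesis using B_right[OF e_N[OF s]] by (auto simp: linear_on_into_def)
    qed
    then show "F (x + y) = F x + F y" by (simp add: F_def sum.distrib)
  next
    fix c x assume x: "x \<in> N_tensor n C k"
    have "B (simplex_dim \<sigma>) (e \<sigma>) (scale c (x \<sigma>)) = t c (B (simplex_dim \<sigma>) (e \<sigma>) (x \<sigma>))"
      if s: "\<sigma> \<in> nondegenerate n" for \<sigma>
    proof -
      have "x \<sigma> \<in> C (k - simplex_dim \<sigma>)"
        using x s by (auto simp: N_tensor_def split: if_splits)
      then show ?thesis using B_right[OF e_N[OF s]] by (auto simp: linear_on_into_def)
    qed
    then show "F (pointwise scale c x) = t c (F x)"
      by (simp add: F_def pointwise_def module.scale_sum_right[OF t])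
  qed auto
  have ext: "?ext F"
  proof (intro allI ballI)
    fix p a and f :: "nat list \<Rightarrow> 'k" assume f: "f \<in> N n p" and a: "a \<in> C (k - p)"
    let ?D = "{\<sigma> \<in> nondegenerate n. simplex_dim \<sigma> = p}"
    have fin: "finite ?D" using finite_nondegenerate by simp
    have f_sum: "f = (\<Sum>\<sigma>\<in>?D. pointwise (*) (f \<sigma>) (e \<sigma>))"
    proof
      fix \<tau>
      have sum_app: "(\<Sum>\<sigma>\<in>S. h \<sigma>) \<tau> = (\<Sum>\<sigma>\<in>S. h \<sigma> \<tau>)"
        for S and h :: "nat list \<Rightarrow> nat list \<Rightarrow> 'k"
        by (induction S rule: infinite_finite_induct) auto
      have "(\<Sum>\<sigma>\<in>?D. pointwise (*) (f \<sigma>) (e \<sigma>) \<tau>) = (\<Sum>\<sigma>\<in>?D. if \<tau> = \<sigma> then f \<sigma> else 0)"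
        by (rule sum.cong) (auto simp: pointwise_def e_def)
      also have "\<dots> = (if \<tau> \<in> ?D then f \<tau> else 0)" using fin by (simp add: sum.delta)
      also have "\<dots> = f \<tau>" using f by (auto simp: N_def)
      finally show "f \<tau> = (\<Sum>\<sigma>\<in>?D. pointwise (*) (f \<sigma>) (e \<sigma>)) \<tau>" by (simp only: sum_app)
    qed
    have "F (pure_tensor scale f a)
        = (\<Sum>\<sigma>\<in>nondegenerate n. B (simplex_dim \<sigma>) (e \<sigma>) (scale (f \<sigma>) a))"
      by (simp add: F_def pure_tensor_def)
    also have "\<dots> = (\<Sum>\<sigma>\<in>?D. B (simplex_dim \<sigma>) (e \<sigma>) (scale (f \<sigma>) a))"
    proof (rule sum.mono_neutral_right[OF finite_nondegenerate])
      show "\<forall>\<sigma>\<in>nondegenerate n - ?D. B (simplex_dim \<sigma>) (e \<sigma>) (scale (f \<sigma>) a) = 0"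
      proof
        fix \<sigma> assume s: "\<sigma> \<in> nondegenerate n - ?D"
        then have "f \<sigma> = 0" using f by (auto simp: N_def)
        then show "B (simplex_dim \<sigma>) (e \<sigma>) (scale (f \<sigma>) a) = 0"
          using linear_on_into_zero[OF scale t C B_right[OF e_N]] s
            module.scale_zero_left[OF scale] by auto
      qed
    qed auto
    also have "\<dots> = (\<Sum>\<sigma>\<in>?D. B p (pointwise (*) (f \<sigma>) (e \<sigma>)) a)"
    proof (rule sum.cong[OF refl])
      fix \<sigma> assume s: "\<sigma> \<in> ?D"
      then have "e \<sigma> \<in> N n p" using e_N by auto
      then show "B (simplex_dim \<sigma>) (e \<sigma>) (scale (f \<sigma>) a) = B p (pointwise (*) (f \<sigma>) (e \<sigma>)) a"
        using s a B_right[of "e \<sigma>" p] B_left[OF a] by (auto simp: linear_on_into_def)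
    qed
    also have "\<dots> = B p f a"
    proof -
      have "pointwise (*) (f \<sigma>) (e \<sigma>) \<in> N n p" if "\<sigma> \<in> ?D" for \<sigma>
        using that by (auto simp: N_def pointwise_def e_def)
      then show ?thesis
        using linear_on_into_sum[OF module_pointwise[OF module_field] t subspace_N B_left[OF a] fin,
            of "\<lambda>\<sigma>. pointwise (*) (f \<sigma>) (e \<sigma>)"] f_sum by simp
    qed
    finally show "F (pure_tensor scale f a) = B p f a" .
  qed
  have "G x = F x" if FG: "?lin G" "?ext G" and x: "x \<in> N_tensor n C k" for G x
  proof -
    have mem: "x \<sigma> \<in> C (k - simplex_dim \<sigma>)" if "\<sigma> \<in> nondegenerate n" for \<sigma>
      using x that by (auto simp: N_tensor_def split: if_splits)
    have pure_N: "pure_tensor scale (e \<sigma>) (x \<sigma>) \<in> N_tensor n C k" if "\<sigma> \<in> nondegenerate n" for \<sigma>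
      using pure_tensor_in[where C = C, OF scale C e_N mem] that by blast
    have x_sum: "x = (\<Sum>\<sigma>\<in>nondegenerate n. pure_tensor scale (e \<sigma>) (x \<sigma>))"
    proof
      fix \<tau>
      have sum_app: "(\<Sum>\<sigma>\<in>S. h \<sigma>) \<tau> = (\<Sum>\<sigma>\<in>S. h \<sigma> \<tau>)"
        for S and h :: "nat list \<Rightarrow> nat list \<Rightarrow> 'a"
        by (induction S rule: infinite_finite_induct) auto
      have "(\<Sum>\<sigma>\<in>nondegenerate n. pure_tensor scale (e \<sigma>) (x \<sigma>) \<tau>)
          = (\<Sum>\<sigma>\<in>nondegenerate n. if \<tau> = \<sigma> then x \<sigma> else 0)"
        by (rule sum.cong)
          (auto simp: pure_tensor_def e_def module.scale_zero_left[OF scale] module.scale_one[OF scale])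
      also have "\<dots> = (if \<tau> \<in> nondegenerate n then x \<tau> else 0)"
        using finite_nondegenerate by (simp add: sum.delta)
      also have "\<dots> = x \<tau>" using x by (auto simp: N_tensor_def)
      finally show "x \<tau> = (\<Sum>\<sigma>\<in>nondegenerate n. pure_tensor scale (e \<sigma>) (x \<sigma>)) \<tau>"
        by (simp only: sum_app)
    qed
    have H: "H x = (\<Sum>\<sigma>\<in>nondegenerate n. B (simplex_dim \<sigma>) (e \<sigma>) (x \<sigma>))"
      if "?lin H" "?ext H" for H
    proof -
      have "H (\<Sum>\<sigma>\<in>nondegenerate n. pure_tensor scale (e \<sigma>) (x \<sigma>))
          = (\<Sum>\<sigma>\<in>nondegenerate n. H (pure_tensor scale (e \<sigma>) (x \<sigma>)))"
        using linear_on_into_sum[OF module_pointwise[OF scale] t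
            subspace_N_tensor[where C = C and n = n and k = k, OF scale C]
            that(1) finite_nondegenerate[of n], where x = "\<lambda>\<sigma>. pure_tensor scale (e \<sigma>) (x \<sigma>)"]
          pure_N by blast
      then have "H x = (\<Sum>\<sigma>\<in>nondegenerate n. H (pure_tensor scale (e \<sigma>) (x \<sigma>)))"
        by (simp only: x_sum[symmetric])
      also have "\<dots> = (\<Sum>\<sigma>\<in>nondegenerate n. B (simplex_dim \<sigma>) (e \<sigma>) (x \<sigma>))"
        using that(2) e_N mem by (intro sum.cong) auto
      finally show ?thesis .
    qed
    show ?thesis using H[OF FG(1,2)] H[OF lin ext] by simp
  qed
  with lin ext show ?thesis by blast
qed

lemma N_tensor_diff_pure:
  assumes "cochain_complex scale C d" "f \<in> N n p" "a \<in> C (k - p)"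
  shows "N_tensor_diff n d k (pure_tensor scale f a) =
    pure_tensor scale (coboundary n f) a + koszul p (pure_tensor scale f (d (k - p) a))"
proof
  fix \<sigma>
  interpret cochain_complex scale C d by fact
  have koszul_scale: "koszul i (scale c a) = scale (koszul i c) a" for i c
    by (simp add: koszul_def)
  have d_scale: "d (k - simplex_dim \<sigma>) (scale (f \<sigma>) a) = scale (f \<sigma>) (d (k - p) a)"
  proof (cases "f \<sigma> = 0")
    case True
    then show ?thesis
      using linear_on_into_zero[OF module_axioms module_axioms subspace_part d_linear] by simp
  next
    case False
    then have "simplex_dim \<sigma> = p" using assms(2) by (auto simp: N_def)
    then show ?thesis using d_linear[of "k - p"] assms(3) by (simp add: linear_on_into_def)
  qed
  have sign: "koszul (simplex_dim \<sigma>) (scale (f \<sigma>) b) = koszul p (scale (f \<sigma>) b)" for b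
    using assms(2) by (cases "f \<sigma> = 0") (auto simp: N_def koszul_def)
  have zero: "f \<sigma> = 0" if "\<sigma> \<notin> nondegenerate n" using that assms(2) by (auto simp: N_def)
  have koszul_app: "koszul i g \<sigma> = koszul i (g \<sigma>)" for i and g :: "nat list \<Rightarrow> _"
    by (simp add: koszul_def)
  show "N_tensor_diff n d k (pure_tensor scale f a) \<sigma> =
    (pure_tensor scale (coboundary n f) a + koszul p (pure_tensor scale f (d (k - p) a))) \<sigma>"
    using zero
    by (auto simp: N_tensor_diff_def pure_tensor_def coboundary_def koszul_scale d_scale sign
        koszul_app scale_sum_left) (simp add: koszul_def)
qed

lemma pullback_pure:
  assumes "module scale"
  shows "pullback m \<theta> (pure_tensor scale f a) = pure_tensor scale (pullback m \<theta> f) a"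
  using module.scale_zero_left[OF assms] by (auto simp: pullback_def pure_tensor_def)

lemma coeff_map_pure:
  assumes "module scale" "f \<in> N n p" "a \<in> C (k - p)"
    and "\<And>q. linear_on_into scale scale (C q) (D q) (g q)" "\<And>q. module.subspace scale (C q)"
  shows "coeff_map n g k (pure_tensor scale f a) = pure_tensor scale f (g (k - p) a)"
proof
  fix \<sigma>
  show "coeff_map n g k (pure_tensor scale f a) \<sigma> = pure_tensor scale f (g (k - p) a) \<sigma>"
  proof (cases "f \<sigma> = 0")
    case True
    then show ?thesis
      using linear_on_into_zero[OF assms(1,1,5,4)] module.scale_zero_left[OF assms(1)]
      by (simp add: coeff_map_def pure_tensor_def)
  next
    case False
    then have "simplex_dim \<sigma> = p" "\<sigma> \<in> nondegenerate n" using assms(2) by (auto simp: N_def)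
    then show ?thesis using assms(3,4)
      by (simp add: coeff_map_def pure_tensor_def linear_on_into_def)
  qed
qed


section \<open>The normalization of a cosimplicial algebra\<close>

definition Tot ::
  "'a::ab_group_add cosimplicial_dg_alg \<Rightarrow> int \<Rightarrow> (nat \<Rightarrow> nat list \<Rightarrow> 'a) set" where
  "Tot A k = {x.
    (\<forall>n. x n \<in> N_tensor n (part (obj A n)) k) \<and>
    (\<forall>m n. \<forall>\<theta> \<in> Delta m n. pullback m \<theta> (x n) = coeff_map m (act A m n \<theta>) k (x m))}"

definition Tot_diff ::
  "'a::ab_group_add cosimplicial_dg_alg \<Rightarrow> int \<Rightarrow> (nat \<Rightarrow> nat list \<Rightarrow> 'a)
    \<Rightarrow> nat \<Rightarrow> nat list \<Rightarrow> 'a" where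
  "Tot_diff A k x n = N_tensor_diff n (diff (obj A n)) k (x n)"

definition Tot_scale ::
  "('k \<Rightarrow> 'a \<Rightarrow> 'a) \<Rightarrow> 'k \<Rightarrow> (nat \<Rightarrow> nat list \<Rightarrow> 'a) \<Rightarrow> nat \<Rightarrow> nat list \<Rightarrow> 'a" where
  "Tot_scale scale = pointwise (pointwise scale)"

definition Tot_map ::
  "(nat \<Rightarrow> int \<Rightarrow> 'a \<Rightarrow> 'a::ab_group_add) \<Rightarrow> int \<Rightarrow> (nat \<Rightarrow> nat list \<Rightarrow> 'a)
    \<Rightarrow> nat \<Rightarrow> nat list \<Rightarrow> 'a" where
  "Tot_map f k x n = coeff_map n (f n) k (x n)"

end

theory Submission
  imports Defs "HOL-Computational_Algebra.Formal_Power_Series"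
begin

text \<open>
  The proof follows Cheng and Getzler. Whitney forms embed the cochains \<open>N\<^sub>n\<close> into the graded
  commutative algebra of polynomial differential forms on \<open>\<Delta>\<^sup>n\<close>. A left inverse takes the value of a form
  on a simplex by applying the Poincare homotopies that contract to its vertices, one after the
  other, and evaluating at the last vertex; the same homotopies, weighted by Whitney forms, give
  Dupont's homotopy. All this is natural in \<open>\<Delta>\<close>. Homotopy transfer along this contraction yields
  operations on \<open>N\<^sub>n\<close>: sums over planar binary trees satisfy the recursion
  \<open>p w = h (\<Sum>\<plusminus> p u \<cdot> p v)\<close> over the splittings \<open>w = u v\<close>, and \<open>p\<close> vanishes on shuffles because
  the terms of \<open>\<Sum>\<plusminus> p u \<cdot> p v\<close> cancel in pairs by graded commutativity. Coefficients in a commutative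
  algebra are multiplied along, and the operations on \<open>Tot\<close> are the componentwise ones, which stay in
  \<open>Tot\<close> by naturality.
\<close>

section \<open>Polynomial differential forms\<close>

text \<open>The cup product of cochains is associative but graded commutative only up to homotopy,
  so the vanishing on shuffles has to be imported from a strictly commutative model. The end that
  defines \<open>Tot\<close> asks for strict compatibility with every map of the simplex category,
  degeneracies included; a contraction natural up to homotopy would not do. Coning from a vertex is
  strictly natural because an affine map that respects vertices carries rays to rays.

  Characteristic 0 enters through division by the weights of forms, by \<open>n + 1\<close> for the
  barycentre, and by 2.

  The side conditions on the homotopy (it squares to zero, and vanishes before and after the passage
  to cochains) are secured by a formal correction. The argument for the identity depends on them.

  Coefficients are kept out of the transfer: the operations on scalar cochains are universal, and a
  commutative algebra only multiplies its own elements alongside. Signs are checked on pure tensors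
  and carried over to all words by additivity.\<close>

datatype 'k fterm = Cst 'k | Var nat | Dvar nat | Plus "'k fterm" "'k fterm" | Times "'k fterm" "'k fterm"

text \<open>These relations present the free graded commutative algebra on even generators
  \<open>Var i\<close> and odd generators \<open>Dvar i\<close>, with central constants. No relation
  ties the coordinates together, and there are infinitely many of them, so one type serves the
  simplices of all dimensions.\<close>

inductive fequiv :: "'k::field fterm \<Rightarrow> 'k fterm \<Rightarrow> bool" where
  fequiv_refl: "fequiv a a"
| fequiv_sym: "fequiv a b \<Longrightarrow> fequiv b a"
| fequiv_trans: "fequiv a b \<Longrightarrow> fequiv b c \<Longrightarrow> fequiv a c"
| fequiv_plus_cong: "fequiv a a' \<Longrightarrow> fequiv b b' \<Longrightarrow> fequiv (Plus a b) (Plus a' b')"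
| fequiv_times_cong: "fequiv a a' \<Longrightarrow> fequiv b b' \<Longrightarrow> fequiv (Times a b) (Times a' b')"
| fequiv_plus_assoc: "fequiv (Plus (Plus a b) c) (Plus a (Plus b c))"
| fequiv_plus_comm: "fequiv (Plus a b) (Plus b a)"
| fequiv_plus_zero: "fequiv (Plus (Cst 0) a) a"
| fequiv_plus_neg: "fequiv (Plus (Times (Cst (- 1)) a) a) (Cst 0)"
| fequiv_times_assoc: "fequiv (Times (Times a b) c) (Times a (Times b c))"
| fequiv_times_one: "fequiv (Times (Cst 1) a) a"
| fequiv_one_times: "fequiv (Times a (Cst 1)) a"
| fequiv_distrib_left: "fequiv (Times a (Plus b c)) (Plus (Times a b) (Times a c))"
| fequiv_distrib_right: "fequiv (Times (Plus a b) c) (Plus (Times a c) (Times b c))"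
| fequiv_cst_plus: "fequiv (Plus (Cst r) (Cst s)) (Cst (r + s))"
| fequiv_cst_times: "fequiv (Times (Cst r) (Cst s)) (Cst (r * s))"
| fequiv_cst_var: "fequiv (Times (Cst r) (Var i)) (Times (Var i) (Cst r))"
| fequiv_cst_dvar: "fequiv (Times (Cst r) (Dvar i)) (Times (Dvar i) (Cst r))"
| fequiv_var_var: "fequiv (Times (Var i) (Var j)) (Times (Var j) (Var i))"
| fequiv_var_dvar: "fequiv (Times (Var i) (Dvar j)) (Times (Dvar j) (Var i))"
| fequiv_dvar_dvar: "fequiv (Times (Dvar i) (Dvar j)) (Times (Cst (- 1)) (Times (Dvar j) (Dvar i)))"

quotient_type (overloaded) 'k form = "'k::field fterm" / fequiv
  by (rule equivpI) (auto intro!: reflpI sympI transpI intro: fequiv_refl fequiv_sym fequiv_trans)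

instantiation form :: (field) ring_1
begin

lift_definition zero_form :: "'a form" is "Cst 0" .
lift_definition one_form :: "'a form" is "Cst 1" .
lift_definition plus_form :: "'a form \<Rightarrow> 'a form \<Rightarrow> 'a form" is Plus by (rule fequiv_plus_cong)
lift_definition times_form :: "'a form \<Rightarrow> 'a form \<Rightarrow> 'a form" is Times by (rule fequiv_times_cong)
lift_definition uminus_form :: "'a form \<Rightarrow> 'a form" is "Times (Cst (- 1))"
  by (rule fequiv_times_cong[OF fequiv_refl])
definition minus_form :: "'a form \<Rightarrow> 'a form \<Rightarrow> 'a form" where "minus_form a b = a + - b"

text \<open>Setting all generators to zero respects every relation, so the quotient does not
  collapse.\<close>

lemma zero_neq_one_form_aux: "fequiv s t \<Longrightarrow>
    rec_fterm id (\<lambda>_. 0) (\<lambda>_. 0) (\<lambda>_ _ a b. a + b) (\<lambda>_ _ a b. a * b) s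
  = rec_fterm id (\<lambda>_. 0) (\<lambda>_. 0) (\<lambda>_ _ a b. a + b) (\<lambda>_ _ a b. a * b) (t :: 'a fterm)"
  by (induction rule: fequiv.induct) (auto simp: algebra_simps)

instance
proof
  fix a b c :: "'a form"
  show "a + b + c = a + (b + c)" by transfer (rule fequiv_plus_assoc)
  show "a + b = b + a" by transfer (rule fequiv_plus_comm)
  show "0 + a = a" by transfer (rule fequiv_plus_zero)
  show "- a + a = 0" by transfer (rule fequiv_plus_neg)
  show "a - b = a + - b" by (rule minus_form_def)
  show "a * b * c = a * (b * c)" by transfer (rule fequiv_times_assoc)
  show "1 * a = a" by transfer (rule fequiv_times_one)
  show "a * 1 = a" by transfer (rule fequiv_one_times)
  show "(a + b) * c = a * c + b * c" by transfer (rule fequiv_distrib_right)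
  show "a * (b + c) = a * b + a * c" by transfer (rule fequiv_distrib_left)
  show "(0 :: 'a form) \<noteq> 1" by transfer (use zero_neq_one_form_aux in fastforce)
qed

end

lift_definition cst :: "'k::field \<Rightarrow> 'k form" is Cst .
lift_definition var :: "nat \<Rightarrow> 'k::field form" is Var .
lift_definition dvar :: "nat \<Rightarrow> 'k::field form" is Dvar .

lemma cst_0 [simp]: "cst 0 = 0" by transfer (rule fequiv_refl)
lemma cst_1 [simp]: "cst 1 = 1" by transfer (rule fequiv_refl)
lemma cst_add: "cst (r + s) = cst r + cst s" by transfer (rule fequiv_sym[OF fequiv_cst_plus])
lemma cst_mult: "cst (r * s) = cst r * cst s" by transfer (rule fequiv_sym[OF fequiv_cst_times])
lemma cst_minus: "cst (- r) = - cst r"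
  by (metis add.right_inverse add_eq_0_iff cst_0 cst_add)

lemma var_comm: "var i * var j = var j * var i" by transfer (rule fequiv_var_var)
lemma var_dvar_comm: "var i * dvar j = dvar j * var i" by transfer (rule fequiv_var_dvar)
lemma cst_var_comm: "cst r * var j = var j * cst r" by transfer (rule fequiv_cst_var)
lemma cst_dvar_comm: "cst r * dvar j = dvar j * cst r" by transfer (rule fequiv_cst_dvar)
lemma dvar_anticomm: "dvar i * dvar j = - (dvar j * dvar i)"
  by transfer (rule fequiv_dvar_dvar)

lemma form_induct [case_names cst var dvar plus times]:
  assumes "\<And>r. P (cst r)" "\<And>i. P (var i)" "\<And>i. P (dvar i)"
    and "\<And>a b. P a \<Longrightarrow> P b \<Longrightarrow> P (a + b)" "\<And>a b. P a \<Longrightarrow> P b \<Longrightarrow> P (a * b)"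
  shows "P a"
proof (induction a rule: form.abs_induct)
  case (1 s)
  then show ?case
    by (induction s)
      (use assms in \<open>auto simp: cst.abs_eq[symmetric] var.abs_eq[symmetric] dvar.abs_eq[symmetric]
        plus_form.abs_eq[symmetric] times_form.abs_eq[symmetric]\<close>)
qed

lemma cst_central: "cst r * a = a * cst r"
proof (induction a rule: form_induct)
  case (cst s) then show ?case by (metis cst_mult mult.commute)
next
  case (times a b) then show ?case by (metis mult.assoc)
qed (simp_all add: cst_var_comm cst_dvar_comm algebra_simps)

lemma cst_left_commute: "a * (cst r * b) = cst r * (a * b)"
  by (metis cst_central mult.assoc)

subsection \<open>The universal property\<close>

primrec eval_term :: "('k \<Rightarrow> 'b::ring_1) \<Rightarrow> (nat \<Rightarrow> 'b) \<Rightarrow> (nat \<Rightarrow> 'b) \<Rightarrow> 'k fterm \<Rightarrow> 'b" where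
  "eval_term c x y (Cst r) = c r"
| "eval_term c x y (Var i) = x i"
| "eval_term c x y (Dvar i) = y i"
| "eval_term c x y (Plus a b) = eval_term c x y a + eval_term c x y b"
| "eval_term c x y (Times a b) = eval_term c x y a * eval_term c x y b"

text \<open>The relations among generators read in an arbitrary target ring: the condition for a
  homomorphism out of \<open>form\<close> to exist.\<close>

definition admissible :: "('k::field \<Rightarrow> 'b::ring_1) \<Rightarrow> (nat \<Rightarrow> 'b) \<Rightarrow> (nat \<Rightarrow> 'b) \<Rightarrow> bool" where
  "admissible c x y \<longleftrightarrow> c 1 = 1 \<and> (\<forall>r s. c (r + s) = c r + c s) \<and> (\<forall>r s. c (r * s) = c r * c s) \<and>
    (\<forall>r i. c r * x i = x i * c r) \<and> (\<forall>r i. c r * y i = y i * c r) \<and>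
    (\<forall>i j. x i * x j = x j * x i) \<and> (\<forall>i j. x i * y j = y j * x i) \<and>
    (\<forall>i j. y i * y j = - (y j * y i))"

definition form_hom ::
  "('k::field \<Rightarrow> 'b::ring_1) \<Rightarrow> (nat \<Rightarrow> 'b) \<Rightarrow> (nat \<Rightarrow> 'b) \<Rightarrow> 'k form \<Rightarrow> 'b" where
  "form_hom c x y a = eval_term c x y (rep_form a)"

lemma eval_term_cong:
  assumes "admissible c x y" "fequiv s t"
  shows "eval_term c x y s = eval_term c x y t"
proof -
  have c0: "c 0 = 0" using assms(1) unfolding admissible_def by (metis add_cancel_right_left)
  then have "c (- 1) = - 1" using assms(1) unfolding admissible_def
    by (metis add.right_inverse add_eq_0_iff)
  moreover have "c 1 = 1" using assms(1) by (simp only: admissible_def)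
  ultimately have c: "c (- 1) = - 1" "c 0 = 0" "c 1 = 1" using c0 by blast+
  have a: "c (r + s) = c r + c s" "c (r * s) = c r * c s" "c r * x i = x i * c r"
    "c r * y i = y i * c r" "x i * x j = x j * x i" "x i * y j = y j * x i"
    "y i * y j = - (y j * y i)" for r s i j
    using assms(1) unfolding admissible_def by blast+
  from assms(2) show ?thesis
  proof (induction rule: fequiv.induct)
    case (fequiv_dvar_dvar i j) show ?case using a(7)[of i j] c by simp
  qed (simp_all add: a(1-6) c ring_distribs add.assoc mult.assoc add.commute)
qed

context
  fixes c :: "'k::field \<Rightarrow> 'b::ring_1" and x y
  assumes adm: "admissible c x y"
begin

lemma form_hom_abs: "form_hom c x y (abs_form s) = eval_term c x y s"
  unfolding form_hom_def
  by (rule eval_term_cong[OF adm]) (metis Quotient3_form rep_abs_rsp_left fequiv_refl)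

lemma form_hom_cst: "form_hom c x y (cst r) = c r"
  and form_hom_var: "form_hom c x y (var i) = x i"
  and form_hom_dvar: "form_hom c x y (dvar i) = y i"
  by (simp_all add: cst.abs_eq var.abs_eq dvar.abs_eq form_hom_abs)

lemma form_hom_add: "form_hom c x y (a + b) = form_hom c x y a + form_hom c x y b"
  by (induction a rule: form.abs_induct, induction b rule: form.abs_induct)
    (simp add: plus_form.abs_eq form_hom_abs)

lemma form_hom_mult: "form_hom c x y (a * b) = form_hom c x y a * form_hom c x y b"
  by (induction a rule: form.abs_induct, induction b rule: form.abs_induct)
    (simp add: times_form.abs_eq form_hom_abs)

lemmas form_hom = form_hom_cst form_hom_var form_hom_dvar form_hom_add form_hom_mult

end

subsection \<open>The parity involution and twisted derivations\<close>

text \<open>The grading involution. It carries the sign of the Leibniz rule, so derivations can be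
  defined on inhomogeneous forms, with no degree to be known.\<close>

definition par :: "'k::field form \<Rightarrow> 'k form" where
  "par = form_hom cst var (\<lambda>i. - dvar i)"

lemma admissible_par: "admissible cst var (\<lambda>i. - dvar i)"
  by (auto simp: admissible_def cst_add cst_mult cst_var_comm cst_dvar_comm var_dvar_comm intro: var_comm dvar_anticomm)

lemma par [simp]: "par (cst r) = cst r" "par (var i) = var i" "par (dvar i) = - dvar i"
  "par (a + b) = par a + par b" "par (a * b) = par a * par b"
  by (simp_all add: par_def form_hom[OF admissible_par])

lemma par_0 [simp]: "par 0 = 0" and par_1 [simp]: "par 1 = 1"
  by (metis cst_0 par(1), metis cst_1 par(1))

lemma par_uminus [simp]: "par (- a) = - par a"
  by (metis add.right_inverse add_eq_0_iff par(4) par_0)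

lemma par_diff [simp]: "par (a - b) = par a - par b"
  by (metis par(4) par_uminus uminus_add_conv_diff add.commute)

lemma par_par [simp]: "par (par a) = a"
  by (induction a rule: form_induct) auto

text \<open>A map \<open>D\<close> with \<open>D (a b) = D a b + par a D b\<close> is the same as a ring homomorphism
  \<open>a \<mapsto> (a, D a)\<close> into the following ring, whose multiplication is twisted by \<open>par\<close>.\<close>

declare [[typedef_overloaded]]

datatype 'k twisted = Twisted (body: "'k form") (soul: "'k form")

instantiation twisted :: (field) ring_1
begin

definition "0 = Twisted 0 0"
definition "1 = Twisted 1 0"
definition "a + b = Twisted (body a + body b) (soul a + soul b)"
definition "a - b = Twisted (body a - body b) (soul a - soul b)"
definition "- a = Twisted (- body a) (- soul a)"
definition "a * b = Twisted (body a * body b) (soul a * body b + par (body a) * soul b)"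

instance
  by standard (simp_all add: zero_twisted_def one_twisted_def plus_twisted_def minus_twisted_def
      uminus_twisted_def times_twisted_def ring_distribs add.assoc mult.assoc add.commute
      add.left_commute)

end

lemma plus_twisted: "body (a + b) = body a + body b" "soul (a + b) = soul a + soul b"
  and times_twisted: "body (a * b) = body a * body b"
    "soul (a * b) = soul a * body b + par (body a) * soul b"
  by (simp_all add: plus_twisted_def times_twisted_def)

definition twisted_deriv :: "(nat \<Rightarrow> 'k::field form) \<Rightarrow> (nat \<Rightarrow> 'k form) \<Rightarrow> 'k form \<Rightarrow> 'k form" where
  "twisted_deriv y z a = soul (form_hom (\<lambda>r. Twisted (cst r) 0) (\<lambda>i. Twisted (var i) (y i))
     (\<lambda>i. Twisted (dvar i) (z i)) a)"

definition derivation_data :: "(nat \<Rightarrow> 'k::field form) \<Rightarrow> (nat \<Rightarrow> 'k form) \<Rightarrow> bool" where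
  "derivation_data y z \<longleftrightarrow> admissible (\<lambda>r. Twisted (cst r) 0) (\<lambda>i. Twisted (var i) (y i))
     (\<lambda>i. Twisted (dvar i) (z i))"

lemma twisted_deriv:
  assumes "derivation_data y z"
  shows "twisted_deriv y z (cst r) = 0" "twisted_deriv y z (var i) = y i"
    "twisted_deriv y z (dvar i) = z i"
    "twisted_deriv y z (a + b) = twisted_deriv y z a + twisted_deriv y z b"
    "twisted_deriv y z (a * b) = twisted_deriv y z a * b + par a * twisted_deriv y z b"
proof -
  note h = form_hom[OF assms[unfolded derivation_data_def]]
  let ?h = "form_hom (\<lambda>r. Twisted (cst r) 0) (\<lambda>i. Twisted (var i) (y i)) (\<lambda>i. Twisted (dvar i) (z i))"
  \<comment> \<open>The first coordinate of the lift is the identity; hence the multiplication of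
    the twisted ring becomes a Leibniz rule for \<open>a\<close> itself.\<close>
  have b: "body (?h a) = a" for a
    by (induction a rule: form_induct) (simp_all add: h plus_twisted times_twisted)
  show "twisted_deriv y z (cst r) = 0" "twisted_deriv y z (var i) = y i"
    "twisted_deriv y z (dvar i) = z i"
    "twisted_deriv y z (a + b) = twisted_deriv y z a + twisted_deriv y z b"
    "twisted_deriv y z (a * b) = twisted_deriv y z a * b + par a * twisted_deriv y z b"
    by (simp_all add: twisted_deriv_def h plus_twisted times_twisted b)
qed

section \<open>Exterior derivative, and contraction with the Euler field of a vertex\<close>

definition ext_d :: "'k::field form \<Rightarrow> 'k form" where
  "ext_d = twisted_deriv dvar (\<lambda>_. 0)"

definition vtx :: "nat \<Rightarrow> nat \<Rightarrow> 'k::field" where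
  "vtx i j = (if i = j then 1 else 0)"

text \<open>Contraction with the Euler field \<open>x - v\<close> of vertex \<open>i\<close>, where
  \<open>v\<close> is the unit point with index \<open>i\<close>. The flow of this field is the
  scaling about that vertex.\<close>

definition contr :: "nat \<Rightarrow> 'k::field form \<Rightarrow> 'k form" where
  "contr i = twisted_deriv (\<lambda>_. 0) (\<lambda>j. var j - cst (vtx i j))"

text \<open>Constants have soul 0 and are central, so only products of two generators remain to be
  compared.\<close>

lemma derivation_dataI:
  assumes xx: "\<And>i j. y i * var j + var i * y j = y j * var i + var j * y i"
    and xy: "\<And>i j. y i * dvar j + var i * z j = z j * var i + - dvar j * y i"
    and yy: "\<And>i j. z i * dvar j + - dvar i * z j = - (z j * dvar i + - dvar j * z i)"
  shows "derivation_data y z"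
proof -
  have 1: "Twisted (cst r) 0 * Twisted a b = Twisted a b * Twisted (cst r) 0" for r and a b :: "'a form"
    using cst_central[of r a] cst_central[of r b] by (simp add: times_twisted_def)
  have 2: "Twisted (var i) (y i) * Twisted (var j) (y j) =
      Twisted (var j) (y j) * Twisted (var i) (y i)" for i j
    using xx[of i j] var_comm[of i j] by (simp add: times_twisted_def)
  have 3: "Twisted (var i) (y i) * Twisted (dvar j) (z j) =
      Twisted (dvar j) (z j) * Twisted (var i) (y i)" for i j
    using xy[of i j] var_dvar_comm[of i j] by (simp add: times_twisted_def)
  have 4: "Twisted (dvar i) (z i) * Twisted (dvar j) (z j) =
      - (Twisted (dvar j) (z j) * Twisted (dvar i) (z i))" for i j
    using yy[of i j] dvar_anticomm[of i j] by (simp add: times_twisted_def uminus_twisted_def)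
  show ?thesis
    unfolding derivation_data_def admissible_def
    by (intro conjI allI 1 2 3 4)
      (simp_all add: one_twisted_def plus_twisted_def times_twisted_def cst_add cst_mult)
qed

lemma derivation_data_d: "derivation_data dvar (\<lambda>_. 0)"
proof (rule derivation_dataI)
  show "dvar i * var j + var i * dvar j = dvar j * var i + var j * dvar i" for i j
    by (metis add.commute var_dvar_comm)
  show "dvar i * dvar j + var i * 0 = 0 * var i + - dvar j * dvar i" for i j
    using dvar_anticomm[of i j] by simp
qed simp

lemma var_minus_cst_comm:
  "(var l - cst r) * var k = var k * (var l - cst r)"
  "(var l - cst r) * dvar k = dvar k * (var l - cst r)"
  by (simp_all add: left_diff_distrib right_diff_distrib cst_central var_comm[of l k] var_dvar_comm)

lemma derivation_data_contr:
  "derivation_data (\<lambda>_. 0) (\<lambda>j. var j - cst (vtx i j))"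
proof (rule derivation_dataI)
  fix k j
  show "0 * dvar j + var k * (var j - cst (vtx i j)) =
      (var j - cst (vtx i j)) * var k + - dvar j * 0"
    by (simp add: var_minus_cst_comm)
  show "(var k - cst (vtx i k)) * dvar j + - dvar k * (var j - cst (vtx i j)) =
      - ((var j - cst (vtx i j)) * dvar k + - dvar j * (var k - cst (vtx i k)))"
    by (simp add: var_minus_cst_comm)
qed simp

lemma ext_d [simp]: "ext_d (cst r) = 0" "ext_d (var i) = dvar i" "ext_d (dvar i) = 0"
  "ext_d (a + b) = ext_d a + ext_d b" "ext_d (a * b) = ext_d a * b + par a * ext_d b"
  unfolding ext_d_def by (simp_all add: twisted_deriv[OF derivation_data_d])

lemma contr [simp]: "contr i (cst r) = 0" "contr i (var j) = 0"
  "contr i (dvar j) = var j - cst (vtx i j)"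
  "contr i (a + b) = contr i a + contr i b" "contr i (a * b) = contr i a * b + par a * contr i b"
  unfolding contr_def by (simp_all add: twisted_deriv[OF derivation_data_contr])

lemma ext_d_0 [simp]: "ext_d 0 = 0" and contr_0 [simp]: "contr i 0 = 0"
  by (metis cst_0 ext_d(1), metis cst_0 contr(1))

lemma ext_d_minus [simp]: "ext_d (- a) = - ext_d a" "ext_d (a - b) = ext_d a - ext_d b"
  by (metis add.right_inverse add_eq_0_iff ext_d(4) ext_d_0) 
    (metis add.commute diff_add_cancel add_diff_cancel_right' ext_d(4))

lemma contr_minus [simp]: "contr i (- a) = - contr i a" "contr i (a - b) = contr i a - contr i b"
  by (metis add.right_inverse add_eq_0_iff contr(4) contr_0) 
    (metis add.commute diff_add_cancel add_diff_cancel_right' contr(4))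

lemma ext_d_sum: "ext_d (sum F I) = (\<Sum>i\<in>I. ext_d (F i))"
  and contr_sum: "contr j (sum F I) = (\<Sum>i\<in>I. contr j (F i))"
  by (induction I rule: infinite_finite_induct) simp_all

lemma ext_d_par [simp]: "ext_d (par a) = - par (ext_d a)"
  by (induction a rule: form_induct) simp_all

lemma contr_par [simp]: "contr i (par a) = - par (contr i a)"
  by (induction a rule: form_induct) simp_all

lemma ext_d_ext_d [simp]: "ext_d (ext_d a) = 0"
  by (induction a rule: form_induct) simp_all

lemma contr_contr [simp]: "contr i (contr i a) = 0"
  by (induction a rule: form_induct) simp_all

lemma ext_d_cst_mult [simp]: "ext_d (cst r * a) = cst r * ext_d a"
  and contr_cst_mult [simp]: "contr i (cst r * a) = cst r * contr i a"
  by simp_all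

text \<open>Cartan's formula for the Lie derivative along the Euler field. Its two odd factors make
  it an even derivation, so \<open>lie_mult\<close> has no sign.\<close>

definition lie :: "nat \<Rightarrow> 'k::field form \<Rightarrow> 'k form" where
  "lie i a = ext_d (contr i a) + contr i (ext_d a)"

lemma lie_add: "lie i (a + b) = lie i a + lie i b"
  and lie_mult: "lie i (a * b) = lie i a * b + a * lie i b"
  by (simp_all add: lie_def algebra_simps)

lemma lie_sum: "lie j (sum F I) = (\<Sum>i\<in>I. lie j (F i))"
  by (simp add: lie_def ext_d_sum contr_sum sum.distrib)

subsection \<open>Evaluation and weights at a vertex\<close>

definition ev :: "nat \<Rightarrow> 'k::field form \<Rightarrow> 'k" where
  "ev i = form_hom (\<lambda>r. r) (vtx i) (\<lambda>_. 0)"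

lemma ev [simp]: "ev i (cst r) = r" "ev i (var j) = vtx i j" "ev i (dvar j) = 0"
  "ev i (a + b) = ev i a + ev i b" "ev i (a * b) = ev i a * ev i b"
proof -
  have "admissible (\<lambda>r. r) (vtx i) (\<lambda>_. 0)" by (auto simp: admissible_def mult.commute)
  note h = form_hom[OF this]
  show "ev i (cst r) = r" "ev i (var j) = vtx i j" "ev i (dvar j) = 0"
    "ev i (a + b) = ev i a + ev i b" "ev i (a * b) = ev i a * ev i b"
    by (simp_all add: ev_def h)
qed

lemma ev_0 [simp]: "ev i 0 = 0" and ev_1 [simp]: "ev i 1 = 1"
  by (metis cst_0 ev(1), metis cst_1 ev(1))

lemma ev_minus [simp]: "ev i (- a) = - ev i a" "ev i (a - b) = ev i a - ev i b"
  by (metis add.right_inverse add_eq_0_iff ev(4) ev_0) 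
    (metis add.commute diff_add_cancel add_diff_cancel_right' ev(4))

lemma ev_sum: "ev j (sum F I) = (\<Sum>i\<in>I. ev j (F i))"
  by (induction I rule: infinite_finite_induct) simp_all

lemma ev_par [simp]: "ev i (par a) = ev i a"
  by (induction a rule: form_induct) simp_all

lemma ev_ext_d [simp]: "ev i (ext_d a) = 0"
  by (induction a rule: form_induct) simp_all

lemma ev_contr [simp]: "ev i (contr i a) = 0"
  by (induction a rule: form_induct) simp_all

section \<open>Weights under scaling about a vertex, and integration along rays\<close>

definition linear_fps :: "'b::zero \<Rightarrow> 'b \<Rightarrow> 'b fps" where
  "linear_fps a b = Abs_fps (\<lambda>w. if w = 0 then a else if w = 1 then b else 0)"

text \<open>The Cauchy product is symmetric under reversal of its index, so a commutation rule for
  coefficients passes to series. The factor \<open>s\<close> is 1 or, for two differentials,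
  \<open>- 1\<close>.\<close>

lemma fps_mult_sign_commute:
  fixes f g :: "'b::ring_1 fps"
  assumes "\<And>i j. fps_nth f i * fps_nth g j = s * (fps_nth g j * fps_nth f i)"
  shows "f * g = fps_const s * (g * f)"
proof (rule fps_ext)
  fix n
  have "fps_nth (f * g) n = (\<Sum>i=0..n. s * (fps_nth g (n - i) * fps_nth f i))"
    by (simp add: fps_mult_nth assms)
  also have "\<dots> = (\<Sum>i=0..n. s * (fps_nth g i * fps_nth f (n - i)))"
    by (rule sum.reindex_bij_witness[of _ "\<lambda>i. n - i" "\<lambda>i. n - i"]) auto
  finally show "fps_nth (f * g) n = fps_nth (fps_const s * (g * f)) n"
    by (simp only: fps_mult_left_const_nth fps_mult_nth[of g f] sum_distrib_left)
qed

lemma linear_fps_sign_commute: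
  fixes a b c d :: "'b::ring_1"
  assumes "a * c = s * (c * a)" "a * d = s * (d * a)" "b * c = s * (c * b)" "b * d = s * (d * b)"
  shows "linear_fps a b * linear_fps c d = fps_const s * (linear_fps c d * linear_fps a b)"
  by (rule fps_mult_sign_commute) (simp add: linear_fps_def assms)

lemma linear_fps_commute:
  fixes a b c d :: "'b::ring_1"
  assumes "a * c = c * a" "a * d = d * a" "b * c = c * b" "b * d = d * b"
  shows "linear_fps a b * linear_fps c d = linear_fps c d * linear_fps a b"
  using linear_fps_sign_commute[of a c 1 d b] assms by simp

text \<open>The rescaled generators obey the relations of the original ones because the series
  variable is central.\<close>

lemma admissible_linear_fps:
  "admissible (\<lambda>r. fps_const (cst r)) (\<lambda>j. linear_fps (cst (vtx i j)) (var j - cst (vtx i j)))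
     (\<lambda>j. linear_fps 0 (dvar j))"
proof -
  have y: "(var j - cst r) * (var k - cst s) = (var k - cst s) * (var j - cst r)"
    for j k and r s :: 'a
    by (simp only: right_diff_distrib[of "var j - cst r"] left_diff_distrib[of "var k" "cst s"]
      var_minus_cst_comm(1) cst_central[of s])
  show ?thesis
    unfolding admissible_def
  proof (intro conjI allI)
    fix r :: 'a and k l
    let ?x = "\<lambda>j. linear_fps (cst (vtx i j)) (var j - cst (vtx i j)) :: 'a form fps"
    let ?y = "\<lambda>j. linear_fps 0 (dvar j) :: 'a form fps"
    show "fps_const (cst r) * ?x k = ?x k * fps_const (cst r)"
      "fps_const (cst r) * ?y k = ?y k * fps_const (cst r)"
      by (rule fps_ext, simp only: fps_mult_left_const_nth fps_mult_right_const_nth cst_central[of r])+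
    show "?x k * ?x l = ?x l * ?x k"
      by (rule linear_fps_commute; (rule cst_central y | rule cst_central[symmetric]))
    show "?x k * ?y l = ?y l * ?x k"
      by (rule linear_fps_commute) (simp_all only: mult_zero_left mult_zero_right cst_dvar_comm var_minus_cst_comm)
    have "?y k * ?y l = fps_const (- 1) * (?y l * ?y k)"
      using dvar_anticomm[of k l, where 'a='a] by (intro linear_fps_sign_commute) simp_all
    also have "fps_const (- 1 :: 'a form) = - 1" by (metis fps_const_neg fps_const_1_eq_1)
    finally show "?y k * ?y l = - (?y l * ?y k)" by simp
  qed (simp_all add: cst_add cst_mult)
qed

text \<open>Each coordinate \<open>x\<close> is replaced by \<open>v + t (x - v)\<close> and each
  differential by \<open>t dx\<close>; the coefficient of \<open>t ^ w\<close> is the part of weight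
  \<open>w\<close>. Power series supply a central parameter \<open>t\<close> over a ring that is not
  commutative.\<close>

definition wpart :: "nat \<Rightarrow> nat \<Rightarrow> 'k::field form \<Rightarrow> 'k form" where
  "wpart i w a = fps_nth (form_hom (\<lambda>r. fps_const (cst r))
     (\<lambda>j. linear_fps (cst (vtx i j)) (var j - cst (vtx i j))) (\<lambda>j. linear_fps 0 (dvar j)) a) w"

lemma wpart_cst: "wpart i w (cst r) = (if w = 0 then cst r else 0)"
  and wpart_var: "wpart i w (var j) =
    (if w = 0 then cst (vtx i j) else if w = 1 then var j - cst (vtx i j) else 0)"
  and wpart_dvar: "wpart i w (dvar j) = (if w = 1 then dvar j else 0)"
  and wpart_add: "wpart i w (a + b) = wpart i w a + wpart i w b"
  and wpart_mult: "wpart i w (a * b) = (\<Sum>v=0..w. wpart i v a * wpart i (w - v) b)"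
  unfolding wpart_def form_hom[OF admissible_linear_fps]
  by (simp_all add: fps_mult_nth linear_fps_def)


lemma wpart_0 [simp]: "wpart i w 0 = 0"
  using wpart_cst[of i w 0] by (cases "w = 0") simp_all

lemma wpart_minus [simp]: "wpart i w (- a) = - wpart i w a" "wpart i w (a - b) = wpart i w a - wpart i w b"
  by (metis add.right_inverse add_eq_0_iff wpart_add wpart_0) 
    (metis add.commute diff_add_cancel add_diff_cancel_right' wpart_add)

lemma par_sum: "par (sum F I) = (\<Sum>i\<in>I. par (F i))"
  by (induction I rule: infinite_finite_induct) simp_all

lemma wpart_par: "wpart i w (par a) = par (wpart i w a)"
  by (induction a arbitrary: w rule: form_induct)
    (simp_all add: wpart_cst wpart_var wpart_dvar wpart_add wpart_mult wpart_minus par_sum)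

text \<open>At \<open>t = 0\<close> the scaling collapses everything onto the vertex.\<close>

lemma wpart_0_weight: "wpart i 0 a = cst (ev i a)"
  by (induction a rule: form_induct)
    (simp_all add: wpart_cst wpart_var wpart_dvar wpart_add wpart_mult cst_add cst_mult)

lemma wpart_ext_d: "wpart i w (ext_d a) = ext_d (wpart i w a)"
  by (induction a arbitrary: w rule: form_induct)
    (simp_all add: wpart_cst wpart_var wpart_dvar wpart_add wpart_mult wpart_par ext_d_sum sum.distrib)

lemma wpart_contr: "wpart i w (contr i a) = contr i (wpart i w a)"
  by (induction a arbitrary: w rule: form_induct)
    (simp_all add: wpart_cst wpart_var wpart_dvar wpart_add wpart_mult wpart_minus wpart_par contr_sum
      sum.distrib)

text \<open>Euler's identity: the Lie derivative generates the scaling. In a product the weights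
  \<open>v\<close> and \<open>w - v\<close> of the factors add up to \<open>w\<close>.\<close>

lemma lie_wpart: "lie i (wpart i w a) = of_nat w * wpart i w a"
proof (induction a arbitrary: w rule: form_induct)
  case (times a b)
  have "lie i (wpart i w (a * b)) =
      (\<Sum>v=0..w. of_nat v * wpart i v a * wpart i (w - v) b + wpart i v a * (of_nat (w - v) * wpart i (w - v) b))"
    by (simp add: wpart_mult lie_sum lie_mult times)
  also have "\<dots> = (\<Sum>v=0..w. of_nat w * (wpart i v a * wpart i (w - v) b))"
  proof (rule sum.cong[OF refl])
    fix v assume "v \<in> {0..w}"
    then have "(of_nat w :: 'a form) = of_nat v + of_nat (w - v)" by (simp flip: of_nat_add)
    moreover have "wpart i v a * (of_nat (w - v) * wpart i (w - v) b) =
        of_nat (w - v) * (wpart i v a * wpart i (w - v) b)"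
      by (metis mult.assoc mult_of_nat_commute)
    ultimately show "of_nat v * wpart i v a * wpart i (w - v) b +
        wpart i v a * (of_nat (w - v) * wpart i (w - v) b) = of_nat w * (wpart i v a * wpart i (w - v) b)"
      by (simp add: distrib_right mult.assoc)
  qed
  finally show ?case by (simp add: wpart_mult sum_distrib_left)
next
  case (plus a b)
  then show ?case by (simp add: wpart_add lie_add distrib_left)
qed (simp_all add: wpart_cst wpart_var wpart_dvar lie_def)

text \<open>Forms are polynomial, so only finitely many weights occur, and \<open>t = 1\<close>
  gives back the form.\<close>

lemma wpart_finite:
  "\<exists>W. (\<forall>w>W. wpart i w a = 0) \<and> (\<Sum>w\<le>W. wpart i w a) = a"
proof (induction a rule: form_induct)
  case (cst r)
  show ?case by (rule exI[of _ 0]) (simp add: wpart_cst)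
next
  case (var j)
  show ?case by (rule exI[of _ 1]) (simp add: wpart_var)
next
  case (dvar j)
  show ?case by (rule exI[of _ 1]) (simp add: wpart_dvar)
next
  case (plus a b)
  then obtain V W where V: "\<And>w. w > V \<Longrightarrow> wpart i w a = 0" "(\<Sum>w\<le>V. wpart i w a) = a"
    and W: "\<And>w. w > W \<Longrightarrow> wpart i w b = 0" "(\<Sum>w\<le>W. wpart i w b) = b" by blast
  have "(\<Sum>w\<le>max V W. wpart i w a) = (\<Sum>w\<le>V. wpart i w a)"
    by (rule sum.mono_neutral_right) (use V in auto)
  moreover have "(\<Sum>w\<le>max V W. wpart i w b) = (\<Sum>w\<le>W. wpart i w b)"
    by (rule sum.mono_neutral_right) (use W in auto)
  ultimately show ?case using V W
    by (intro exI[of _ "max V W"]) (simp add: wpart_add sum.distrib)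
next
  case (times a b)
  then obtain V W where V: "\<And>w. w > V \<Longrightarrow> wpart i w a = 0" "(\<Sum>w\<le>V. wpart i w a) = a"
    and W: "\<And>w. w > W \<Longrightarrow> wpart i w b = 0" "(\<Sum>w\<le>W. wpart i w b) = b" by blast
  have "wpart i w (a * b) = 0" if "w > V + W" for w
    unfolding wpart_mult using that V(1) W(1)
    by (intro sum.neutral ballI) (metis add_le_mono le_add_diff_inverse atLeastAtMost_iff not_le mult_zero_left mult_zero_right)
  moreover have "(\<Sum>w\<le>V + W. wpart i w (a * b)) = a * b"
  proof -
    let ?f = "\<lambda>(v, w). wpart i v a * wpart i w b"
    have "(\<Sum>w\<le>V + W. wpart i w (a * b)) = (\<Sum>w\<le>V + W. \<Sum>v\<le>w. ?f (v, w - v))"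
      by (simp add: wpart_mult atMost_atLeast0)
    also have "\<dots> = sum ?f {(v, w). v + w \<le> V + W}"
      using sum.triangle_reindex_eq[of "\<lambda>v w. ?f (v, w)" "V + W"] by simp
    \<comment> \<open>Outside the rectangle one of the two factors exceeds its bound on weights and
      is 0.\<close>
    also have "\<dots> = sum ?f ({..V} \<times> {..W})"
    proof (rule sum.mono_neutral_right)
      have "{(v, w). v + w \<le> V + W} \<subseteq> {..V + W} \<times> {..V + W}" by auto
      then show "finite {(v, w). v + w \<le> V + W}" by (rule finite_subset) simp
    qed (use V W in \<open>auto intro: leI\<close>)
    also have "\<dots> = (\<Sum>w\<le>V. wpart i w a) * (\<Sum>w\<le>W. wpart i w b)"
      by (simp add: sum_product sum.cartesian_product)
    finally show ?thesis using V W by simp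
  qed
  ultimately show ?case by blast
qed

text \<open>The integral of the rescaled form against \<open>dt / t\<close> over the unit interval,
  with weight 0 left out. Summing over the weights that occur avoids the choice of a bound.\<close>

definition integ :: "nat \<Rightarrow> 'k::field form \<Rightarrow> 'k form" where
  "integ i a = (\<Sum>w | wpart i w a \<noteq> 0 \<and> w > 0. cst (1 / of_nat w) * wpart i w a)"

lemma integ_eq:
  assumes "\<And>w. w > W \<Longrightarrow> wpart i w a = 0"
  shows "integ i a = (\<Sum>w=1..W. cst (1 / of_nat w) * wpart i w a)"
  unfolding integ_def
proof (rule sum.mono_neutral_left)
  show "{w. wpart i w a \<noteq> 0 \<and> 0 < w} \<subseteq> {1..W}"
    using assms by (auto simp: Suc_le_eq) (meson not_le)
qed auto

lemma wpart_cst_mult: "wpart i w (cst r * a) = cst r * wpart i w a"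
proof -
  have "wpart i w (cst r * a) = (\<Sum>v=0..w. if v = 0 then cst r * wpart i w a else 0)"
    unfolding wpart_mult by (rule sum.cong) (auto simp: wpart_cst)
  then show ?thesis by simp
qed

lemma integ_add: "integ i (a + b) = integ i a + integ i b"
proof -
  obtain V W where V: "\<And>w. w > V \<Longrightarrow> wpart i w a = 0" and W: "\<And>w. w > W \<Longrightarrow> wpart i w b = 0"
    using wpart_finite by metis
  show ?thesis
    using V W by (subst (1 2 3) integ_eq[of "max V W"])
      (auto simp: wpart_add distrib_left sum.distrib)
qed

lemma integ_cst_mult: "integ i (cst r * a) = cst r * integ i a"
proof -
  obtain V where V: "\<And>w. w > V \<Longrightarrow> wpart i w a = 0" using wpart_finite by metis
  show ?thesis
    using V by (subst (1 2) integ_eq[of V])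
      (auto simp: wpart_cst_mult sum_distrib_left cst_left_commute[of _ r])
qed

lemma integ_cst [simp]: "integ i (cst r) = 0"
  by (subst integ_eq[of 0]) (auto simp: wpart_cst)

lemma integ_ext_d: "integ i (ext_d a) = ext_d (integ i a)"
  and integ_contr: "integ i (contr i a) = contr i (integ i a)"
proof -
  obtain V where V: "\<And>w. w > V \<Longrightarrow> wpart i w a = 0" using wpart_finite by metis
  show "integ i (ext_d a) = ext_d (integ i a)" "integ i (contr i a) = contr i (integ i a)"
    using V by (subst (1 2) integ_eq[of V];
      auto simp: wpart_ext_d wpart_contr ext_d_sum contr_sum)+
qed

text \<open>Division by \<open>w\<close> undoes the factor \<open>w\<close> of the Lie derivative in
  every positive weight. What is missing is weight 0, the value at the vertex.\<close>

lemma lie_integ: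
  fixes a :: "'k::field_char_0 form"
  shows "lie i (integ i a) = a - cst (ev i a)"
proof -
  obtain V where V: "\<And>w. w > V \<Longrightarrow> wpart i w a = 0" and s: "(\<Sum>w\<le>V. wpart i w a) = a"
    using wpart_finite by metis
  have of_nat: "of_nat w = cst (of_nat w :: 'k)" for w
    by (induction w) (simp_all add: cst_add)
  have "lie i (cst (1 / of_nat w) * wpart i w a) = wpart i w a" if "w \<in> {1..V}" for w
  proof -
    have "lie i (cst (1 / of_nat w) * wpart i w a) = cst (1 / of_nat w) * (of_nat w * wpart i w a)"
      by (simp add: lie_def flip: lie_wpart distrib_left)
    also have "\<dots> = cst (1 / of_nat w * of_nat w) * wpart i w a"
      by (simp only: of_nat cst_mult mult.assoc)
    finally show ?thesis using that by simp
  qed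
  then have "lie i (integ i a) = (\<Sum>w=1..V. wpart i w a)"
    using integ_eq[of V i a] V by (simp add: lie_sum)
  also have "\<dots> = a - wpart i 0 a"
    using s by (simp add: atMost_atLeast0 sum.atLeast_Suc_atMost algebra_simps)
  finally show ?thesis by (simp add: wpart_0_weight)
qed

subsection \<open>The Poincare homotopies\<close>

definition cone :: "nat \<Rightarrow> 'k::field form \<Rightarrow> 'k form" where
  "cone i a = contr i (integ i a)"

lemma cone_add: "cone i (a + b) = cone i a + cone i b"
  and cone_cst_mult: "cone i (cst r * a) = cst r * cone i a"
  and cone_cst [simp]: "cone i (cst r) = 0"
  and cone_cone [simp]: "cone i (cone i a) = 0"
  and ev_cone [simp]: "ev i (cone i a) = 0"
  by (simp_all add: cone_def integ_add integ_cst_mult integ_contr)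

lemma cone_0 [simp]: "cone i 0 = 0"
  using cone_cst[of i 0] by simp

lemma cone_minus [simp]: "cone i (- a) = - cone i a" "cone i (a - b) = cone i a - cone i b"
  by (metis add.right_inverse add_eq_0_iff cone_add cone_0) 
    (metis add.commute diff_add_cancel add_diff_cancel_right' cone_add)

lemma cone_sum: "cone j (sum F I) = (\<Sum>i\<in>I. cone j (F i))"
  by (induction I rule: infinite_finite_induct) (simp_all add: cone_add)

text \<open>Integration along rays commutes with \<open>ext_d\<close> and \<open>contr\<close>, so
  Cartan's formula turns \<open>lie_integ\<close> into the Poincare lemma for the cone with apex
  \<open>i\<close>.\<close>

lemma ext_d_cone:
  fixes a :: "'k::field_char_0 form"
  shows "ext_d (cone i a) = a - cst (ev i a) - cone i (ext_d a)"
  using lie_integ[of i a] by (simp add: lie_def cone_def integ_ext_d algebra_simps)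

subsection \<open>The grading\<close>

text \<open>Degree as a predicate suffices for signs and for vanishing in wrong degrees; no form is
  ever decomposed into its homogeneous parts.\<close>

inductive homog :: "int \<Rightarrow> 'k::field form \<Rightarrow> bool" where
  homog_0: "homog q 0"
| homog_cst: "homog 0 (cst r)"
| homog_var: "homog 0 (var i)"
| homog_dvar: "homog 1 (dvar i)"
| homog_add: "homog q a \<Longrightarrow> homog q b \<Longrightarrow> homog q (a + b)"
| homog_mult: "homog p a \<Longrightarrow> homog q b \<Longrightarrow> homog (p + q) (a * b)"

lemma homog_cst_mult: "homog q a \<Longrightarrow> homog q (cst r * a)"
  using homog_mult[OF homog_cst] by force

lemma homog_uminus: "homog q a \<Longrightarrow> homog q (- a)"
  using homog_cst_mult[of q a "- 1"] by (simp add: cst_minus)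

lemma homog_diff: "homog q a \<Longrightarrow> homog q b \<Longrightarrow> homog q (a - b)"
  by (metis homog_add homog_uminus uminus_add_conv_diff add.commute)

lemma homog_1: "homog 0 1"
  using homog_cst[of 1] by simp

lemma homog_sum: "(\<And>i. i \<in> I \<Longrightarrow> homog q (F i)) \<Longrightarrow> homog q (sum F I)"
  by (induction I rule: infinite_finite_induct) (auto intro: homog_0 homog_add)

lemma homog_koszul: "homog q a \<Longrightarrow> homog q (koszul k a)"
  by (simp add: koszul_def homog_uminus)

lemma homog_negative: "homog q a \<Longrightarrow> q < 0 \<Longrightarrow> a = 0"
proof (induction rule: homog.induct)
  case (homog_mult p a q b)
  then show ?case by (cases "p < 0") auto
qed auto

lemma homog_par: "homog q a \<Longrightarrow> par a = koszul q a"
  by (induction rule: homog.induct) (auto simp: koszul_def)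

lemma homog_ext_d: "homog q a \<Longrightarrow> homog (q + 1) (ext_d a)"
proof (induction rule: homog.induct)
  case (homog_mult p a q b)
  have "homog (p + 1 + q) (ext_d a * b)" "homog (p + (q + 1)) (koszul p a * ext_d b)"
    using homog_mult by (auto intro: homog.homog_mult homog_koszul)
  then show ?case
    using homog_par[OF homog_mult.hyps(1)] by (auto simp: ac_simps intro: homog.homog_add)
qed (auto intro: homog.intros)

lemma homog_contr: "homog q a \<Longrightarrow> homog (q - 1) (contr i a)"
proof (induction rule: homog.induct)
  case (homog_mult p a q b)
  have "homog (p - 1 + q) (contr i a * b)" "homog (p + (q - 1)) (koszul p a * contr i b)"
    using homog_mult by (auto intro: homog.homog_mult homog_koszul)
  then show ?case
    using homog_par[OF homog_mult.hyps(1)]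
    by (auto simp: algebra_simps intro: homog.homog_add)
next
  case (homog_dvar j)
  show ?case by (auto intro: homog_diff homog.intros)
qed (auto intro: homog.intros)

lemma homog_wpart: "homog q a \<Longrightarrow> homog q (wpart i w a)"
  by (induction arbitrary: w rule: homog.induct)
    (auto simp: wpart_cst wpart_var wpart_dvar wpart_add wpart_mult
      intro: homog.intros homog_diff homog_sum)

lemma homog_cone: "homog q a \<Longrightarrow> homog (q - 1) (cone i a)"
  unfolding cone_def integ_def
  by (intro homog_contr homog_sum homog_cst_mult homog_wpart)

lemma homog_ev: "homog q a \<Longrightarrow> q \<noteq> 0 \<Longrightarrow> ev i a = 0"
proof (induction rule: homog.induct)
  case (homog_mult p a q b)
  then show ?case by (cases "p = 0") auto
qed auto

lemma koszul_mult_left: "koszul p a * b = koszul p (a * b :: 'b::ring)"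
  and koszul_mult_right: "a * koszul p b = koszul p (a * b :: 'b::ring)"
  by (simp_all add: koszul_def)

lemma koszul_koszul: "koszul p (koszul q a) = koszul (p + q) a"
  by (simp add: koszul_def)

lemma homog_commute:
  assumes "homog p a" "homog q b"
  shows "a * b = koszul (p * q) (b * a)"
  using assms
proof (induction arbitrary: q b rule: homog.induct)
  case (homog_cst r)
  show ?case by (simp add: koszul_def cst_central)
next
  case (homog_var i)
  from homog_var have "var i * b = b * var i"
  proof (induction rule: homog.induct)
    case (homog_mult p a q b)
    then show ?case by (metis mult.assoc)
  qed (simp_all add: cst_var_comm var_comm[of i] var_dvar_comm ring_distribs)
  then show ?case by (simp add: koszul_def)
next
  case (homog_dvar i)
  from homog_dvar have "dvar i * b = koszul q (b * dvar i)"
  proof (induction rule: homog.induct)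
    case (homog_mult p a q b)
    have "dvar i * (a * b) = koszul p (a * (dvar i * b))"
      using homog_mult by (metis koszul_mult_left mult.assoc)
    also have "\<dots> = koszul (p + q) (a * b * dvar i)"
      using homog_mult by (simp add: koszul_mult_right koszul_koszul mult.assoc)
    finally show ?case .
  next
    case (homog_dvar j)
    show ?case using dvar_anticomm[of i j] by (simp add: koszul_def)
  qed (simp_all add: koszul_def cst_dvar_comm var_dvar_comm ring_distribs)
  then show ?case by simp
next
  case (homog_add p a a')
  then show ?case by (simp add: distrib_left distrib_right koszul_def)
next
  case (homog_mult p a p' a')
  have "a * a' * b = koszul (p' * q) (a * b * a')"
    using homog_mult by (metis koszul_mult_right mult.assoc)
  also have "a * b * a' = koszul (p * q) (b * a * a')"
    using homog_mult by (metis koszul_mult_left)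
  finally show ?case by (simp add: koszul_koszul mult.assoc distrib_right add.commute)
qed (simp add: koszul_def)

subsection \<open>Substitutions\<close>

text \<open>Pullback of forms along the polynomial map with components \<open>b i\<close>.\<close>

definition subst :: "(nat \<Rightarrow> 'k::field form) \<Rightarrow> 'k form \<Rightarrow> 'k form" where
  "subst b = form_hom cst b (\<lambda>i. ext_d (b i))"

context
  fixes b :: "nat \<Rightarrow> 'k::field form"
  assumes b: "\<And>i. homog 0 (b i)"
begin

lemma admissible_subst: "admissible cst b (\<lambda>i. ext_d (b i))"
proof -
  have d: "homog 1 (ext_d (b i))" for i using homog_ext_d[OF b] by simp
  show ?thesis
    unfolding admissible_def
  proof (intro conjI allI)
    fix i j
    show "b i * b j = b j * b i" "b i * ext_d (b j) = ext_d (b j) * b i"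
      "ext_d (b i) * ext_d (b j) = - (ext_d (b j) * ext_d (b i))"
      using homog_commute[OF b[of i] b[of j]] homog_commute[OF b[of i] d[of j]]
        homog_commute[OF d[of i] d[of j]]
      by (simp_all add: koszul_def)
  qed (rule cst_central | simp add: cst_add cst_mult)+
qed

lemma subst: "subst b (cst r) = cst r" "subst b (var i) = b i" "subst b (dvar i) = ext_d (b i)"
  "subst b (x + y) = subst b x + subst b y" "subst b (x * y) = subst b x * subst b y"
  unfolding subst_def by (simp_all only: form_hom[OF admissible_subst])

lemma subst_0: "subst b 0 = 0" and subst_1: "subst b 1 = 1"
  by (metis cst_0 subst(1), metis cst_1 subst(1))

lemma subst_minus: "subst b (- x) = - subst b x" "subst b (x - y) = subst b x - subst b y"
  by (metis add.right_inverse add_eq_0_iff subst(4) subst_0) 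
    (metis add.commute diff_add_cancel add_diff_cancel_right' subst(4))

lemma subst_sum: "subst b (sum F I) = (\<Sum>i\<in>I. subst b (F i))"
  by (induction I rule: infinite_finite_induct) (simp_all add: subst subst_0)

lemma subst_par: "subst b (par x) = par (subst b x)"
proof (induction x rule: form_induct)
  case (var i)
  show ?case using homog_par[OF b] by (simp add: subst koszul_def)
next
  case (dvar i)
  show ?case using homog_par[OF homog_ext_d[OF b[of i]]] by (simp add: subst subst_minus koszul_def)
qed (simp_all add: subst)

lemma subst_ext_d: "subst b (ext_d x) = ext_d (subst b x)"
  by (induction x rule: form_induct) (simp_all add: subst subst_0 subst_par)

context
  fixes i j
  assumes contr_b: "\<And>k. contr j (ext_d (b k)) = b k - cst (vtx i k)"
    and wpart_b: "\<And>k w. wpart j w (b k) =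
      (if w = 0 then cst (vtx i k) else if w = 1 then b k - cst (vtx i k) else 0)"
begin

lemma contr_b_0: "contr j (b k) = 0"
  using homog_negative[OF homog_contr[OF b]] by simp

text \<open>The two assumptions of the context say that the map is affine and takes vertex
  \<open>j\<close> to vertex \<open>i\<close>. It therefore intertwines the scalings about these
  vertices and whatever is built from them.\<close>

lemma subst_contr: "subst b (contr i x) = contr j (subst b x)"
  by (induction x rule: form_induct)
    (simp_all add: subst subst_0 subst_par subst_minus contr_b contr_b_0)

lemma subst_wpart: "subst b (wpart i w x) = wpart j w (subst b x)"
proof (induction x arbitrary: w rule: form_induct)
  case (dvar k)
  show ?case by (simp add: subst subst_0 wpart_dvar wpart_b wpart_ext_d)
qed (simp_all add: subst subst_0 subst_minus wpart_cst wpart_var wpart_add wpart_mult subst_sum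
    wpart_b)

lemma subst_cone: "subst b (cone i x) = cone j (subst b x)"
proof -
  obtain W where W: "\<And>w. w > W \<Longrightarrow> wpart i w x = 0" using wpart_finite by metis
  then have "wpart j w (subst b x) = 0" if "w > W" for w
    using that by (simp add: subst_0 flip: subst_wpart)
  then show ?thesis
    using integ_eq[of W i x, OF W] integ_eq[of W j "subst b x"]
    by (simp add: cone_def subst_contr subst_sum subst subst_wpart)
qed

lemma ev_subst: "ev j (subst b x) = ev i x"
proof -
  have "cst (ev j (subst b x)) = subst b (cst (ev i x))"
    by (metis wpart_0_weight subst_wpart)
  then have "ev j (cst (ev j (subst b x))) = ev j (cst (ev i x))" by (simp add: subst)
  then show ?thesis by simp
qed

end

end

subsection \<open>Barycentric coordinates and Whitney forms\<close>

text \<open>The \<open>n\<close>-simplex sits in the affine space with coordinates \<open>var j\<close>, its vertices being the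
  first unit points. These coordinates need not sum to \<open>1\<close>, so the defect is shared out evenly.\<close>

definition bary :: "nat \<Rightarrow> nat \<Rightarrow> 'k::field_char_0 form" where
  "bary n j = var j + cst (1 / of_nat (n + 1)) * (1 - (\<Sum>l\<le>n. var l))"

lemma form_of_nat: "of_nat w = cst (of_nat w)"
  by (induction w) (simp_all add: cst_add)

lemma sum_bary: "(\<Sum>j\<le>n. bary n j) = 1"
proof -
  have "(\<Sum>j\<le>n. bary n j) = (\<Sum>j\<le>n. var j) +
      of_nat (n + 1) * (cst (1 / of_nat (n + 1)) * (1 - (\<Sum>l\<le>n. var l :: 'a form)))"
    by (simp add: bary_def sum.distrib)
  also have "of_nat (n + 1) * (cst (1 / of_nat (n + 1)) * (1 - (\<Sum>l\<le>n. var l :: 'a form))) =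
      cst (of_nat (n + 1) * (1 / of_nat (n + 1))) * (1 - (\<Sum>l\<le>n. var l))"
    by (simp only: form_of_nat cst_mult mult.assoc)
  also have "of_nat (n + 1) * (1 / of_nat (n + 1)) = (1 :: 'a)"
    by (metis nonzero_mult_div_cancel_left of_nat_eq_0_iff add_is_0 one_neq_zero times_divide_eq_right mult.right_neutral)
  finally show ?thesis by simp
qed

lemma homog_bary: "homog 0 (bary n j)"
  unfolding bary_def
  by (intro homog_add homog_var homog_cst_mult homog_diff homog_1 homog_sum)

lemma homog_d_bary: "homog 1 (ext_d (bary n j))"
  using homog_ext_d[OF homog_bary] by simp

lemma sum_vtx: "i \<le> n \<Longrightarrow> (\<Sum>l\<le>n. vtx i l) = 1"
  by (simp add: vtx_def)

lemma sum_cst: "(\<Sum>i\<in>I. cst (F i)) = cst (sum F I)"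
  by (induction I rule: infinite_finite_induct) (simp_all add: cst_add)

lemma ext_d_1 [simp]: "ext_d 1 = 0"
  by (metis cst_1 ext_d(1))

text \<open>The correction term of \<open>bary\<close> vanishes at vertex \<open>i\<close>, since
  the first \<open>n + 1\<close> coordinates of that unit point sum to 1. This is where
  \<open>i \<le> n\<close> enters.\<close>

lemma contr_d_bary:
  assumes "i \<le> n"
  shows "contr i (ext_d (bary n j)) = bary n j - cst (vtx i j)"
proof -
  have "contr i (ext_d (1 - (\<Sum>l\<le>n. var l) :: 'a form)) = - (\<Sum>l\<le>n. var l - cst (vtx i l))"
    by (simp add: ext_d_sum contr_sum)
  also have "\<dots> = 1 - (\<Sum>l\<le>n. var l)"
    by (simp add: sum_subtractf sum_cst sum_vtx[OF assms])
  finally show ?thesis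
    unfolding bary_def ext_d(2,4) contr(3,4) ext_d_cst_mult contr_cst_mult by simp
qed

lemma wpart_sum: "wpart i w (sum F I) = (\<Sum>k\<in>I. wpart i w (F k))"
  by (induction I rule: infinite_finite_induct) (simp_all add: wpart_add)

lemma wpart_bary:
  assumes "i \<le> n"
  shows "wpart i w (bary n j) =
    (if w = 0 then cst (vtx i j) else if w = 1 then bary n j - cst (vtx i j) else 0)"
proof -
  have 1: "wpart i w (1 :: 'a form) = (if w = 0 then 1 else 0)"
    using wpart_cst[of i w "1 :: 'a"] by (cases "w = 0") simp_all
  have "wpart i w (1 - (\<Sum>l\<le>n. var l) :: 'a form) = (if w = 1 then 1 - (\<Sum>l\<le>n. var l) else 0)"
    using sum_vtx[OF assms, where 'a='a]
    by (simp add: 1 wpart_sum wpart_var sum_subtractf sum_cst)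
  then show ?thesis by (simp add: bary_def wpart_add wpart_cst_mult wpart_var)
qed

lemma ev_bary: "i \<le> n \<Longrightarrow> ev i (bary n j) = vtx i j"
  by (simp add: bary_def ev_sum sum_vtx)

lemma sum_d_bary: "(\<Sum>j\<le>n. ext_d (bary n j)) = 0"
  by (metis sum_bary ext_d_sum ext_d_1)

lemma bary_central: "bary n j * (a :: 'k::field_char_0 form) = a * bary n j"
proof (induction a rule: form_induct)
  case (times a b)
  then show ?case by (metis mult.assoc)
next
  case (cst r)
  show ?case by (metis cst_central)
next
  case (var i)
  show ?case using homog_commute[OF homog_bary homog_var] by (simp add: koszul_def)
next
  case (dvar i)
  show ?case using homog_commute[OF homog_bary homog_dvar] by (simp add: koszul_def)
qed (simp add: ring_distribs)

lemma d_bary_anticommute: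
  "ext_d (bary n i) * ext_d (bary n j) = - (ext_d (bary n j) * ext_d (bary n i))"
  using homog_commute[OF homog_d_bary homog_d_bary] by (simp add: koszul_def)

lemma form_self_neg:
  fixes a :: "'k::field_char_0 form"
  assumes "a = - a"
  shows "a = 0"
proof -
  have "cst 2 * a = a + a" using cst_add[of "1 :: 'k" 1] by (simp add: mult_2)
  also have "\<dots> = 0" using assms by (metis add.right_inverse)
  finally have "cst (1 / 2) * (cst 2 * a) = 0" by simp
  then show ?thesis by (simp flip: mult.assoc cst_mult)
qed

section \<open>Whitney forms\<close>

primrec dprod :: "nat \<Rightarrow> nat list \<Rightarrow> 'k::field_char_0 form" where
  "dprod n [] = 1"
| "dprod n (i # \<sigma>) = ext_d (bary n i) * dprod n \<sigma>"

text \<open>The contraction of \<open>dprod\<close> that turns the differential of each barycentric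
  coordinate into that coordinate. Being an odd derivation, it has this recursion and is 0 on the
  empty product.\<close>

primrec alt :: "nat \<Rightarrow> nat list \<Rightarrow> 'k::field_char_0 form" where
  "alt n [] = 0"
| "alt n (i # \<sigma>) = bary n i * dprod n \<sigma> - ext_d (bary n i) * alt n \<sigma>"

text \<open>The factorial of the dimension gives the form the value 1 on its own simplex.\<close>

definition whitney :: "nat \<Rightarrow> nat list \<Rightarrow> 'k::field_char_0 form" where
  "whitney n \<sigma> = cst (fact (length \<sigma> - 1)) * alt n \<sigma>"

lemma homog_dprod: "homog (int (length \<sigma>)) (dprod n \<sigma>)"
proof (induction \<sigma>)
  case (Cons i \<sigma>)
  then show ?case using homog_mult[OF homog_d_bary Cons] by simp
qed (simp add: homog_1)

lemma homog_alt: "homog (int (length \<sigma>) - 1) (alt n \<sigma>)"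
proof (induction \<sigma>)
  case (Cons i \<sigma>)
  have "homog (int (length \<sigma>)) (bary n i * dprod n \<sigma> :: 'a form)"
    using homog_mult[OF homog_bary homog_dprod] by simp
  moreover have "homog (int (length \<sigma>)) (ext_d (bary n i) * alt n \<sigma> :: 'a form)"
    using homog_mult[OF homog_d_bary[of n i] Cons] by simp
  ultimately show ?case by (simp add: homog_diff)
qed (simp add: homog_0)

lemma homog_whitney: "homog (int (length \<sigma>) - 1) (whitney n \<sigma>)"
  by (simp add: whitney_def homog_cst_mult homog_alt)

lemma par_bary [simp]: "par (bary n i) = bary n i"
  using homog_par[OF homog_bary] by (simp add: koszul_def)

lemma par_d_bary [simp]: "par (ext_d (bary n i)) = - ext_d (bary n i)"
  using homog_par[OF homog_d_bary] by (simp add: koszul_def)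

lemma ext_d_dprod: "ext_d (dprod n \<sigma>) = 0"
  by (induction \<sigma>) simp_all

text \<open>Each of the \<open>length \<sigma>\<close> factors contributes one copy of the full
  product, when its undifferentiated coordinate is differentiated.\<close>

lemma ext_d_alt: "ext_d (alt n \<sigma>) = of_nat (length \<sigma>) * dprod n \<sigma>"
proof (induction \<sigma>)
  case (Cons i \<sigma>)
  have "ext_d (alt n (i # \<sigma>) :: 'a form) =
      dprod n (i # \<sigma>) + ext_d (bary n i) * (of_nat (length \<sigma>) * dprod n \<sigma>)"
    by (simp add: ext_d_dprod Cons)
  also have "ext_d (bary n i) * (of_nat (length \<sigma>) * dprod n \<sigma>) = of_nat (length \<sigma>) * dprod n (i # \<sigma>)"
    by (subst mult.assoc[symmetric], subst mult_of_nat_commute[symmetric]) (simp only: mult.assoc dprod.simps)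
  finally show ?case by (simp add: distrib_right)
qed simp

text \<open>The barycentric coordinates sum to 1 and their differentials to 0.\<close>

lemma sum_alt_Cons: "(\<Sum>i\<le>n. alt n (i # \<sigma>)) = dprod n \<sigma>"
  by (simp add: sum_subtractf sum_bary sum_d_bary flip: sum_distrib_right)

lemma sum_whitney_single: "(\<Sum>i\<le>n. whitney n [i]) = 1"
  by (simp add: whitney_def sum_bary)

text \<open>The length completes the factorial to that of the next dimension, and
  \<open>sum_alt_Cons\<close> distributes the product of differentials over all possible new
  vertices.\<close>

lemma ext_d_whitney:
  assumes "\<sigma> \<noteq> []"
  shows "ext_d (whitney n \<sigma>) = (\<Sum>i\<le>n. whitney n (i # \<sigma>))"
proof -
  have "(fact (length \<sigma>) :: 'a) = fact (length \<sigma> - 1) * of_nat (length \<sigma>)"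
    using assms by (metis fact_reduce length_greater_0_conv mult.commute)
  then have "ext_d (whitney n \<sigma> :: 'a form) = cst (fact (length \<sigma>)) * dprod n \<sigma>"
    by (simp only: whitney_def ext_d_cst_mult ext_d_alt form_of_nat cst_mult mult.assoc)
  also have "\<dots> = (\<Sum>i\<le>n. whitney n (i # \<sigma>))"
    by (simp add: whitney_def sum_alt_Cons del: alt.simps flip: sum_distrib_left)
  finally show ?thesis .
qed

lemma dprod_swap: "dprod n (i # j # \<sigma>) = - dprod n (j # i # \<sigma>)"
  by (simp add: d_bary_anticommute[of n i j] flip: mult.assoc)

lemma alt_swap: "alt n (i # j # \<sigma>) = - alt n (j # i # \<sigma>)"
proof -
  have "bary n a * (ext_d (bary n b) * dprod n \<sigma>) =
      (ext_d (bary n b) * (bary n a * dprod n \<sigma>) :: 'a form)" for a b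
    by (subst mult.assoc[symmetric], subst bary_central) (simp only: mult.assoc)
  moreover have "ext_d (bary n i) * (ext_d (bary n j) * alt n \<sigma>) =
      (- (ext_d (bary n j) * (ext_d (bary n i) * alt n \<sigma>)) :: 'a form)"
    by (subst mult.assoc[symmetric], subst d_bary_anticommute) (simp only: mult.assoc mult_minus_left)
  ultimately show ?thesis by (simp add: right_diff_distrib)
qed

lemma alt_repeat: "alt n (i # i # \<sigma>) = 0"
  by (rule form_self_neg) (rule alt_swap)

lemma dprod_move:
  "j < length \<sigma> \<Longrightarrow> dprod n (\<sigma> ! j # take j \<sigma> @ drop (Suc j) \<sigma>) = koszul (int j) (dprod n \<sigma>)"
proof (induction \<sigma> arbitrary: j)
  case (Cons i \<sigma>)
  show ?case
  proof (cases j)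
    case 0
    then show ?thesis by (simp add: koszul_def)
  next
    case (Suc k)
    then have "dprod n ((i # \<sigma>) ! j # take j (i # \<sigma>) @ drop (Suc j) (i # \<sigma>)) =
        - (ext_d (bary n i) * dprod n (\<sigma> ! k # take k \<sigma> @ drop (Suc k) \<sigma>) :: 'a form)"
      using dprod_swap[of n "\<sigma> ! k" i "take k \<sigma> @ drop (Suc k) \<sigma>"] by simp
    also have "\<dots> = - (ext_d (bary n i) * koszul (int k) (dprod n \<sigma>))"
      using Cons.IH[of k] Cons.prems Suc by (simp del: dprod.simps)
    finally show ?thesis using Suc by (simp add: koszul_def)
  qed
qed simp

lemma alt_move:
  "j < length \<sigma> \<Longrightarrow> alt n (\<sigma> ! j # take j \<sigma> @ drop (Suc j) \<sigma>) = koszul (int j) (alt n \<sigma>)"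
proof (induction \<sigma> arbitrary: j)
  case (Cons i \<sigma>)
  show ?case
  proof (cases j)
    case 0
    then show ?thesis by (simp add: koszul_def)
  next
    case (Suc k)
    let ?\<rho> = "\<sigma> ! k # take k \<sigma> @ drop (Suc k) \<sigma>"
    from Suc have "alt n ((i # \<sigma>) ! j # take j (i # \<sigma>) @ drop (Suc j) (i # \<sigma>)) = - (alt n (i # ?\<rho>) :: 'a form)"
      using alt_swap[of n "\<sigma> ! k" i "take k \<sigma> @ drop (Suc k) \<sigma>"] by simp
    also have "\<dots> = - (bary n i * dprod n ?\<rho> - ext_d (bary n i) * alt n ?\<rho>)"
      by (simp only: alt.simps)
    also have "\<dots> = - (bary n i * koszul (int k) (dprod n \<sigma>) - ext_d (bary n i) * koszul (int k) (alt n \<sigma>))"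
      using Cons.IH[of k] Cons.prems Suc dprod_move[of k \<sigma> n, where 'a='a] by (simp only: length_Cons Suc_less_eq)
    finally show ?thesis using Suc by (simp add: koszul_def)
  qed
qed simp

lemma whitney_move:
  assumes "j < length \<sigma>"
  shows "whitney n (\<sigma> ! j # take j \<sigma> @ drop (Suc j) \<sigma>) = koszul (int j) (whitney n \<sigma>)"
  using assms by (simp add: whitney_def alt_move koszul_mult_right del: alt.simps)

text \<open>Alternation brings the other occurrence of \<open>i\<close> to the front of \<sigma>; a
  word beginning with two equal letters is its own negative.\<close>

lemma whitney_Cons_mem:
  assumes "i \<in> set \<sigma>"
  shows "whitney n (i # \<sigma>) = 0"
proof -
  obtain j where j: "j < length \<sigma>" "i = \<sigma> ! j" using assms by (metis in_set_conv_nth)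
  let ?\<rho> = "take j \<sigma> @ drop (Suc j) \<sigma>"
  have kk: "koszul (int j) (koszul (int j) a) = a" for a :: "'a form" by (simp add: koszul_def)
  have d: "dprod n \<sigma> = (koszul (int j) (dprod n (i # ?\<rho>)) :: 'a form)"
    and a: "alt n \<sigma> = (koszul (int j) (alt n (i # ?\<rho>)) :: 'a form)"
    by (simp_all only: j(2) dprod_move[OF j(1)] alt_move[OF j(1)] kk)
  have "(alt n (i # \<sigma>) :: 'a form) = koszul (int j) (alt n (i # i # ?\<rho>))"
    unfolding alt.simps(2)[of n i \<sigma>] alt.simps(2)[of n i "i # ?\<rho>"] d a by (simp add: koszul_def del: alt.simps dprod.simps)
  then show ?thesis by (simp add: whitney_def alt_repeat koszul_def del: alt.simps)
qed

section \<open>The contraction onto normalized cochains\<close>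

lemma nondegenerate_iff:
  "\<sigma> \<in> nondegenerate n \<longleftrightarrow> \<sigma> \<noteq> [] \<and> sorted_wrt (<) \<sigma> \<and> set \<sigma> \<subseteq> {..n}"
proof
  assume "\<sigma> \<in> nondegenerate n"
  then show "\<sigma> \<noteq> [] \<and> sorted_wrt (<) \<sigma> \<and> set \<sigma> \<subseteq> {..n}"
    by (auto simp: nondegenerate_def Delta_def strict_sorted_iff)
next
  assume *: "\<sigma> \<noteq> [] \<and> sorted_wrt (<) \<sigma> \<and> set \<sigma> \<subseteq> {..n}"
  then have "\<sigma> \<in> Delta (length \<sigma> - 1) n" by (auto simp: Delta_def strict_sorted_iff)
  with * show "\<sigma> \<in> nondegenerate n" by (auto simp: nondegenerate_def strict_sorted_iff)
qed

section \<open>Faces of simplices\<close>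

abbreviation omit :: "nat \<Rightarrow> 'b list \<Rightarrow> 'b list" where
  "omit j \<tau> \<equiv> take j \<tau> @ drop (Suc j) \<tau>"

lemma omit_nondegenerate:
  assumes "\<tau> \<in> nondegenerate n" "omit j \<tau> \<noteq> []"
  shows "omit j \<tau> \<in> nondegenerate n"
proof (cases "j < length \<tau>")
  case True
  have "\<tau> = take j \<tau> @ \<tau> ! j # drop (Suc j) \<tau>" using True by (rule id_take_nth_drop)
  moreover have "sorted_wrt (<) \<tau>" using assms(1) by (simp add: nondegenerate_iff)
  ultimately have "sorted_wrt (<) (take j \<tau> @ \<tau> ! j # drop (Suc j) \<tau>)" by simp
  then have "sorted_wrt (<) (omit j \<tau>)" by (auto simp: sorted_wrt_append)
  then show ?thesis
    using assms by (auto simp: nondegenerate_iff dest: in_set_takeD in_set_dropD)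
qed (use assms in simp)

definition insert_sorted :: "nat \<Rightarrow> nat list \<Rightarrow> nat list" where
  "insert_sorted i \<sigma> = filter (\<lambda>x. x < i) \<sigma> @ i # filter (\<lambda>x. i < x) \<sigma>"

lemma filter_split:
  "sorted_wrt (<) \<sigma> \<Longrightarrow> i \<notin> set \<sigma> \<Longrightarrow> filter (\<lambda>x. x < i) \<sigma> @ filter (\<lambda>x. i < x) \<sigma> = (\<sigma> :: nat list)"
proof (induction \<sigma>)
  case (Cons a \<sigma>)
  show ?case
  proof (cases "a < i")
    case False
    then have "filter (\<lambda>x. x < i) \<sigma> = []" "filter (\<lambda>x. i < x) \<sigma> = \<sigma>" 
      using Cons.prems by (fastforce simp: filter_empty_conv filter_id_conv)+
    then show ?thesis using False Cons.prems by auto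
  qed (use Cons in auto)
qed simp

lemma insert_sorted_omit:
  assumes "sorted_wrt (<) \<tau>" "j < length \<tau>"
  shows "insert_sorted (\<tau> ! j) (omit j \<tau>) = \<tau>" "filter (\<lambda>x. x < \<tau> ! j) (omit j \<tau>) = take j \<tau>"
proof -
  have \<tau>: "\<tau> = take j \<tau> @ \<tau> ! j # drop (Suc j) \<tau>" using assms(2) by (rule id_take_nth_drop)
  then have s: "sorted_wrt (<) (take j \<tau> @ \<tau> ! j # drop (Suc j) \<tau>)" using assms(1) by simp
  have f: "filter (\<lambda>x. x < \<tau> ! j) (take j \<tau>) = take j \<tau>" "filter (\<lambda>x. \<tau> ! j < x) (take j \<tau>) = []"
    "filter (\<lambda>x. x < \<tau> ! j) (drop (Suc j) \<tau>) = []"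
    "filter (\<lambda>x. \<tau> ! j < x) (drop (Suc j) \<tau>) = drop (Suc j) \<tau>"
    using s by (fastforce simp: sorted_wrt_append filter_empty_conv filter_id_conv)+
  then show "filter (\<lambda>x. x < \<tau> ! j) (omit j \<tau>) = take j \<tau>" by simp
  show "insert_sorted (\<tau> ! j) (omit j \<tau>) = \<tau>"
    unfolding insert_sorted_def filter_append f using \<tau> by simp
qed

text \<open>A simplex with a vertex to omit is the same as a face with a vertex outside it. Omitting
  the only vertex of a 0-simplex leaves \<open>[]\<close>, which therefore joins the faces.\<close>

lemma sum_faces:
  fixes F :: "nat \<Rightarrow> nat list \<Rightarrow> 'b::comm_monoid_add"
  shows "(\<Sum>\<tau>\<in>nondegenerate n. \<Sum>j<length \<tau>. F (\<tau> ! j) (omit j \<tau>)) =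
    (\<Sum>\<sigma>\<in>insert [] (nondegenerate n). \<Sum>i\<in>{..n} - set \<sigma>. F i \<sigma>)"
proof -
  have "(\<Sum>\<tau>\<in>nondegenerate n. \<Sum>j<length \<tau>. F (\<tau> ! j) (omit j \<tau>)) =
      (\<Sum>(\<tau>, j)\<in>Sigma (nondegenerate n) (\<lambda>\<tau>. {..<length \<tau>}). F (\<tau> ! j) (omit j \<tau>))"
    by (rule sum.Sigma) (auto simp: finite_nondegenerate)
  also have "\<dots> = (\<Sum>(\<sigma>, i)\<in>Sigma (insert [] (nondegenerate n)) (\<lambda>\<sigma>. {..n} - set \<sigma>). F i \<sigma>)"
  \<comment> \<open>The position of the omitted vertex is recovered as the number of smaller
    vertices of the face.\<close>
  proof (rule sum.reindex_bij_witness[of _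
        "\<lambda>(\<sigma>, i). (insert_sorted i \<sigma>, length (filter (\<lambda>x. x < i) \<sigma>))" "\<lambda>(\<tau>, j). (omit j \<tau>, \<tau> ! j)"])
    fix p assume p: "p \<in> Sigma (nondegenerate n) (\<lambda>\<tau>. {..<length \<tau>})"
    obtain \<tau> j where pj: "p = (\<tau>, j)" by (cases p)
    with p have \<tau>: "sorted_wrt (<) \<tau>" "set \<tau> \<subseteq> {..n}" "\<tau> \<in> nondegenerate n" and j: "j < length \<tau>"
      by (auto simp: nondegenerate_iff)
    show "(case case p of (\<tau>, j) \<Rightarrow> (omit j \<tau>, \<tau> ! j) of
        (\<sigma>, i) \<Rightarrow> (insert_sorted i \<sigma>, length (filter (\<lambda>x. x < i) \<sigma>))) = p"
      using insert_sorted_omit[OF \<tau>(1) j] j by (simp add: pj del: filter_append)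
    have "\<tau> ! j \<notin> set (omit j \<tau>)"
      using \<tau>(1) j id_take_nth_drop[OF j] by (metis strict_sorted_iff distinct_append distinct.simps(2)
        disjoint_insert(2) list.simps(15) set_append UnE)
    moreover have "omit j \<tau> \<in> insert [] (nondegenerate n)" "\<tau> ! j \<le> n"
      using omit_nondegenerate[OF \<tau>(3)] \<tau>(2) nth_mem[OF j] by blast+
    ultimately show "(case p of (\<tau>, j) \<Rightarrow> (omit j \<tau>, \<tau> ! j))
        \<in> Sigma (insert [] (nondegenerate n)) (\<lambda>\<sigma>. {..n} - set \<sigma>)"
      unfolding pj by simp
  next
    fix p assume p: "p \<in> Sigma (insert [] (nondegenerate n)) (\<lambda>\<sigma>. {..n} - set \<sigma>)"
    obtain \<sigma> i where pi: "p = (\<sigma>, i)" by (cases p)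
    with p have \<sigma>: "sorted_wrt (<) \<sigma>" "set \<sigma> \<subseteq> {..n}" and i: "i \<le> n" "i \<notin> set \<sigma>"
      by (auto simp: nondegenerate_iff)
    have "omit (length (filter (\<lambda>x. x < i) \<sigma>)) (insert_sorted i \<sigma>) = \<sigma>"
      using filter_split[OF \<sigma>(1) i(2)] by (simp add: insert_sorted_def)
    then show "(case case p of (\<sigma>, i) \<Rightarrow> (insert_sorted i \<sigma>, length (filter (\<lambda>x. x < i) \<sigma>)) of
        (\<tau>, j) \<Rightarrow> (omit j \<tau>, \<tau> ! j)) = p"
      by (simp add: pi) (simp add: insert_sorted_def nth_append)
    have "sorted_wrt (<) (insert_sorted i \<sigma>)"
      using \<sigma>(1) by (auto simp: insert_sorted_def sorted_wrt_append sorted_wrt_filter)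
    then show "(case p of (\<sigma>, i) \<Rightarrow> (insert_sorted i \<sigma>, length (filter (\<lambda>x. x < i) \<sigma>)))
        \<in> Sigma (nondegenerate n) (\<lambda>\<tau>. {..<length \<tau>})"
      using \<sigma>(2) i by (auto simp: pi nondegenerate_iff) (auto simp: insert_sorted_def)
  qed auto
  also have "\<dots> = (\<Sum>\<sigma>\<in>insert [] (nondegenerate n). \<Sum>i\<in>{..n} - set \<sigma>. F i \<sigma>)"
    by (rule sum.Sigma[symmetric]) (auto simp: finite_nondegenerate)
  finally show ?thesis .
qed

section \<open>The Whitney map, integration over simplices, and Dupont's homotopy\<close>

definition to_forms :: "nat \<Rightarrow> (nat list \<Rightarrow> 'k) \<Rightarrow> 'k::field_char_0 form" where
  "to_forms n x = (\<Sum>\<sigma>\<in>nondegenerate n. cst (x \<sigma>) * whitney n \<sigma>)"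

lemma Nil_notin_nondegenerate [simp]: "[] \<notin> nondegenerate n"
  by (simp add: nondegenerate_iff)

lemma sum_whitney_Cons:
  assumes "\<sigma> \<in> nondegenerate n"
  shows "(\<Sum>i\<in>{..n} - set \<sigma>. whitney n (i # \<sigma>)) = ext_d (whitney n \<sigma>)"
proof -
  have "(\<Sum>i\<in>{..n} - set \<sigma>. whitney n (i # \<sigma>)) = (\<Sum>i\<le>n. whitney n (i # \<sigma>) :: 'a form)"
    by (rule sum.mono_neutral_left) (auto intro: whitney_Cons_mem)
  then show ?thesis using assms ext_d_whitney[of \<sigma> n, where 'a='a] by (auto simp: nondegenerate_iff)
qed

lemma cst_koszul: "cst (koszul j r) = koszul j (cst r)"
  by (simp add: koszul_def cst_minus)

text \<open>Moving the omitted vertex to the front of the Whitney form absorbs the sign of the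
  coboundary. Regrouped by faces, the sum gives each face the derivative of its Whitney form. On
  vertices \<open>coboundary\<close> evaluates at \<open>[]\<close>, whence the hypothesis.\<close>

lemma to_forms_coboundary:
  assumes "x [] = 0"
  shows "to_forms n (coboundary n x) = ext_d (to_forms n x)"
proof -
  have "to_forms n (coboundary n x) = (\<Sum>\<tau>\<in>nondegenerate n. \<Sum>j<length \<tau>.
      cst (x (omit j \<tau>)) * whitney n (\<tau> ! j # omit j \<tau>))"
    unfolding to_forms_def
  proof (rule sum.cong[OF refl])
    fix \<tau> assume \<tau>: "\<tau> \<in> nondegenerate n"
    have "cst (coboundary n x \<tau>) * whitney n \<tau> =
        (\<Sum>j<length \<tau>. cst (koszul (int j) (x (omit j \<tau>))) * whitney n \<tau>)"
      using \<tau> by (simp add: coboundary_def flip: sum_cst sum_distrib_right)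
    also have "\<dots> = (\<Sum>j<length \<tau>. cst (x (omit j \<tau>)) * whitney n (\<tau> ! j # omit j \<tau>))"
      by (rule sum.cong[OF refl]) (simp add: whitney_move cst_koszul koszul_mult_left koszul_mult_right)
    finally show "cst (coboundary n x \<tau>) * whitney n \<tau> =
        (\<Sum>j<length \<tau>. cst (x (omit j \<tau>)) * whitney n (\<tau> ! j # omit j \<tau>))" .
  qed
  also have "\<dots> = (\<Sum>\<sigma>\<in>insert [] (nondegenerate n). \<Sum>i\<in>{..n} - set \<sigma>. cst (x \<sigma>) * whitney n (i # \<sigma>))"
    by (rule sum_faces)
  also have "\<dots> = (\<Sum>\<sigma>\<in>nondegenerate n. \<Sum>i\<in>{..n} - set \<sigma>. cst (x \<sigma>) * whitney n (i # \<sigma>))"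
    using assms by (simp add: finite_nondegenerate)
  also have "\<dots> = (\<Sum>\<sigma>\<in>nondegenerate n. cst (x \<sigma>) * ext_d (whitney n \<sigma>))"
    by (rule sum.cong[OF refl]) (simp add: sum_whitney_Cons flip: sum_distrib_left)
  finally show ?thesis by (simp add: to_forms_def ext_d_sum)
qed

primrec cones :: "nat list \<Rightarrow> 'k::field form \<Rightarrow> 'k form" where
  "cones [] a = a"
| "cones (i # \<sigma>) a = cones \<sigma> (cone i a)"

lemma cones_append: "cones (\<sigma> @ \<rho>) a = cones \<rho> (cones \<sigma> a)"
  by (induction \<sigma> arbitrary: a) auto

lemma cones_0 [simp]: "cones \<sigma> 0 = 0"
  by (induction \<sigma>) auto

lemma cones_add: "cones \<sigma> (a + b) = cones \<sigma> a + cones \<sigma> b"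
  by (induction \<sigma> arbitrary: a b) (auto simp: cone_add)

lemma cones_cst_mult: "cones \<sigma> (cst r * a) = cst r * cones \<sigma> a"
  by (induction \<sigma> arbitrary: a) (auto simp: cone_cst_mult)

lemma homog_cones: "homog q a \<Longrightarrow> homog (q - int (length \<sigma>)) (cones \<sigma> a)"
proof (induction \<sigma> arbitrary: a q)
  case (Cons i \<sigma>)
  from Cons.IH[OF homog_cone[OF Cons.prems, of i]] show ?case by (simp add: algebra_simps)
qed simp

text \<open>A homotopy telescope: each commutator of \<open>ext_d\<close> with one \<open>cone\<close> omits that factor, up to a
  constant, and constants survive only in the last position.\<close>

lemma ext_d_cones:
  fixes a :: "'k::field_char_0 form"
  shows "ext_d (cones \<sigma> a) = koszul (int (length \<sigma>)) (cones \<sigma> (ext_d a)) +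
    (\<Sum>j<length \<sigma>. koszul (int (length \<sigma>) - 1 - int j) (cones (omit j \<sigma>) a)) -
    (if \<sigma> = [] then 0 else cst (ev (last \<sigma>) (cones (butlast \<sigma>) a)))"
proof (induction \<sigma> rule: rev_induct)
  case Nil
  show ?case by (simp add: koszul_def)
next
  case (snoc i \<sigma>)
  let ?K = "length \<sigma>"
  have "cone i (ext_d (cones \<sigma> a)) = koszul (int ?K) (cones (\<sigma> @ [i]) (ext_d a)) +
      (\<Sum>j<?K. koszul (int ?K - 1 - int j) (cones (omit j (\<sigma> @ [i])) a))"
  proof -
    have k: "cone i (koszul k b) = koszul k (cone i b)" for k b by (simp add: koszul_def)
    have "cone i (ext_d (cones \<sigma> a)) = koszul (int ?K) (cone i (cones \<sigma> (ext_d a))) +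
      (\<Sum>j<?K. koszul (int ?K - 1 - int j) (cone i (cones (omit j \<sigma>) a)))"
      by (subst snoc) (simp add: cone_add cone_sum k)
    then show ?thesis by (simp add: cones_append)
  qed
  moreover have "ext_d (cones (\<sigma> @ [i]) a) =
      cones \<sigma> a - cst (ev i (cones \<sigma> a)) - cone i (ext_d (cones \<sigma> a))"
    by (simp add: cones_append ext_d_cone)
  moreover have "(\<Sum>j<length (\<sigma> @ [i]). koszul (int (length (\<sigma> @ [i])) - 1 - int j) (cones (omit j (\<sigma> @ [i])) a)) =
      cones \<sigma> a - (\<Sum>j<?K. koszul (int ?K - 1 - int j) (cones (omit j (\<sigma> @ [i])) a))"
  proof -
    have "koszul (int ?K - int j) b = - koszul (int ?K - 1 - int j) b" for j and b :: "'k form"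
      by (simp add: koszul_def)
    then show ?thesis by (simp add: sum_negf) (simp add: koszul_def)
  qed
  ultimately show ?case by (simp add: koszul_def)
qed

text \<open>The integral over the simplex: each cone integrates along the rays from one vertex to
  the opposite face, until a single vertex is left.\<close>

definition from_forms :: "nat \<Rightarrow> 'k::field_char_0 form \<Rightarrow> nat list \<Rightarrow> 'k" where
  "from_forms n a \<tau> = (if \<tau> \<in> nondegenerate n then ev (last \<tau>) (cones (butlast \<tau>) a) else 0)"

text \<open>Here every vertex contributes a homotopy, whereas in \<open>from_forms\<close> the last
  one is replaced by evaluation. The two are linked by the constant term of
  \<open>ext_d_cones\<close>.\<close>

definition dupont :: "nat \<Rightarrow> 'k::field_char_0 form \<Rightarrow> 'k form" where
  "dupont n a = (\<Sum>\<sigma>\<in>nondegenerate n. koszul (int (length \<sigma>)) (whitney n \<sigma> * cones \<sigma> a))"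

lemma ev_koszul: "ev i (koszul k a) = koszul k (ev i a)"
  by (simp add: koszul_def)

text \<open>Stokes' theorem. Evaluation kills exact forms, so the telescope over all vertices but
  the last becomes a relation between values on faces; its constant term belongs to the face
  opposite the last vertex.\<close>

lemma from_forms_ext_d: "from_forms n (ext_d a) = coboundary n (from_forms n a)"
proof
  fix \<tau>
  show "from_forms n (ext_d a) \<tau> = coboundary n (from_forms n a) \<tau>"
  proof (cases "\<tau> \<in> nondegenerate n")
    case True
    then have "\<tau> \<noteq> []" by auto
    then obtain \<sigma> l where \<tau>: "\<tau> = \<sigma> @ [l]" by (metis append_butlast_last_id)
    let ?K = "length \<sigma>"
    have "0 = ev l (ext_d (cones \<sigma> a))" by simp
    also have "\<dots> = koszul (int ?K) (ev l (cones \<sigma> (ext_d a))) +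
        (\<Sum>j<?K. koszul (int ?K - 1 - int j) (ev l (cones (omit j \<sigma>) a))) -
        (if \<sigma> = [] then 0 else ev (last \<sigma>) (cones (butlast \<sigma>) a))"
      by (subst ext_d_cones) (simp add: ev_sum ev_koszul)
    finally have "koszul (int ?K) (ev l (cones \<sigma> (ext_d a))) =
        (if \<sigma> = [] then 0 else ev (last \<sigma>) (cones (butlast \<sigma>) a)) -
        (\<Sum>j<?K. koszul (int ?K - 1 - int j) (ev l (cones (omit j \<sigma>) a)))"
      by (simp add: algebra_simps)
    then have "koszul (int ?K) (koszul (int ?K) (ev l (cones \<sigma> (ext_d a)))) =
        koszul (int ?K) (if \<sigma> = [] then 0 else ev (last \<sigma>) (cones (butlast \<sigma>) a)) -
        koszul (int ?K) (\<Sum>j<?K. koszul (int ?K - 1 - int j) (ev l (cones (omit j \<sigma>) a)))"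
      by (simp add: koszul_def)
    moreover have "koszul (int ?K) (\<Sum>j<?K. koszul (int ?K - 1 - int j) (ev l (cones (omit j \<sigma>) a))) =
        - (\<Sum>j<?K. koszul (int j) (ev l (cones (omit j \<sigma>) a)))"
    proof -
      have "koszul (int ?K) (koszul (int ?K - 1 - int j) b) = - koszul (int j) b" for j and b :: 'a
        by (simp add: koszul_def)
      moreover have "koszul (int ?K) (sum F {..<?K}) = (\<Sum>j<?K. koszul (int ?K) (F j))" for F :: "nat \<Rightarrow> 'a"
        by (simp add: koszul_def sum_negf)
      ultimately show ?thesis by (simp add: sum_negf)
    qed
    ultimately have "ev l (cones \<sigma> (ext_d a)) =
        koszul (int ?K) (if \<sigma> = [] then 0 else ev (last \<sigma>) (cones (butlast \<sigma>) a)) +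
        (\<Sum>j<?K. koszul (int j) (ev l (cones (omit j \<sigma>) a)))"
      by (simp add: koszul_koszul) (simp add: koszul_def)
    moreover have "from_forms n a (omit j \<tau>) = ev l (cones (omit j \<sigma>) a)" if "j < ?K" for j
      using omit_nondegenerate[OF True, of j] that
      by (simp add: \<tau> from_forms_def butlast_append)
    \<comment> \<open>This is the face opposite the last vertex. For a 0-simplex it is
      \<open>[]\<close>, where \<open>from_forms\<close> has the default value 0.\<close>
    moreover have "from_forms n a \<sigma> = (if \<sigma> = [] then 0 else ev (last \<sigma>) (cones (butlast \<sigma>) a))"
      using omit_nondegenerate[OF True, of ?K] by (auto simp: \<tau> from_forms_def)
    ultimately have "ev l (cones \<sigma> (ext_d a)) =
        (\<Sum>j<Suc ?K. koszul (int j) (from_forms n a (omit j \<tau>)))"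
      by (simp add: \<tau>)
    then show ?thesis using True by (simp add: from_forms_def coboundary_def \<tau>)
  qed (simp add: from_forms_def coboundary_def)
qed

text \<open>On a Whitney form \<open>ext_d\<close> adds a vertex, on \<open>cones\<close> it removes
  one; by \<open>sum_faces\<close> these terms cancel. The constants of the telescope assemble to
  \<open>to_forms n (from_forms n a)\<close>. Only the empty face is left over, and it contributes
  \<open>a\<close> because the Whitney forms of the vertices sum to 1.\<close>

lemma dupont_homotopy:
  fixes a :: "'k::field_char_0 form"
  shows "ext_d (dupont n a) + dupont n (ext_d a) = to_forms n (from_forms n a) - a"
proof -
  let ?w = "whitney n"
  define F where "F i \<sigma> = koszul (int (length \<sigma>)) (?w (i # \<sigma>) * cones \<sigma> a)" for i \<sigma>
  have summand: "ext_d (koszul (int (length \<sigma>)) (?w \<sigma> * cones \<sigma> a)) +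
      koszul (int (length \<sigma>)) (?w \<sigma> * cones \<sigma> (ext_d a)) =
      (\<Sum>i\<in>{..n} - set \<sigma>. F i \<sigma>) - (\<Sum>j<length \<sigma>. F (\<sigma> ! j) (omit j \<sigma>)) +
      cst (from_forms n a \<sigma>) * ?w \<sigma>"
    if \<sigma>: "\<sigma> \<in> nondegenerate n" for \<sigma>
  proof -
    let ?K = "int (length \<sigma>)"
    have par: "par (?w \<sigma>) = koszul (?K - 1) (?w \<sigma>)" by (rule homog_par[OF homog_whitney])
    have "ext_d (koszul ?K (?w \<sigma> * cones \<sigma> a)) + koszul ?K (?w \<sigma> * cones \<sigma> (ext_d a)) =
        koszul ?K (ext_d (?w \<sigma>) * cones \<sigma> a) -
        ?w \<sigma> * (ext_d (cones \<sigma> a) - koszul ?K (cones \<sigma> (ext_d a)))"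
      by (auto simp: par koszul_def right_diff_distrib)
    also have "ext_d (cones \<sigma> a) - koszul ?K (cones \<sigma> (ext_d a)) =
        (\<Sum>j<length \<sigma>. koszul (?K - 1 - int j) (cones (omit j \<sigma>) a)) - cst (from_forms n a \<sigma>)"
      using \<sigma> by (subst ext_d_cones) (auto simp: from_forms_def)
    also have "?w \<sigma> * \<dots> = (\<Sum>j<length \<sigma>. ?w \<sigma> * koszul (?K - 1 - int j) (cones (omit j \<sigma>) a)) -
        cst (from_forms n a \<sigma>) * ?w \<sigma>"
      by (simp add: right_diff_distrib sum_distrib_left cst_central[of _ "?w \<sigma>"])
    also have "(\<Sum>j<length \<sigma>. ?w \<sigma> * koszul (?K - 1 - int j) (cones (omit j \<sigma>) a)) =
        (\<Sum>j<length \<sigma>. F (\<sigma> ! j) (omit j \<sigma>))"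
    proof (rule sum.cong[OF refl])
      fix j assume "j \<in> {..<length \<sigma>}"
      then have j: "j < length \<sigma>" by simp
      then have "int (length (omit j \<sigma>)) = ?K - 1" by auto
      then have "F (\<sigma> ! j) (omit j \<sigma>) = koszul (?K - 1) (koszul (int j) (?w \<sigma>) * cones (omit j \<sigma>) a)"
        unfolding F_def whitney_move[OF j] by simp
      then show "?w \<sigma> * koszul (?K - 1 - int j) (cones (omit j \<sigma>) a) = F (\<sigma> ! j) (omit j \<sigma>)"
        by (auto simp: koszul_def)
    qed
    also have "koszul ?K (ext_d (?w \<sigma>) * cones \<sigma> a) = (\<Sum>i\<in>{..n} - set \<sigma>. F i \<sigma>)"
      unfolding F_def sum_whitney_Cons[OF \<sigma>, symmetric]
      by (simp add: koszul_def sum_distrib_right sum_negf)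
    finally show ?thesis by simp
  qed
  have "F i [] = ?w [i] * a" for i by (simp add: F_def koszul_def)
  then have "(\<Sum>i\<le>n. F i []) = a" by (simp add: sum_whitney_single flip: sum_distrib_right)
  then have faces: "(\<Sum>\<sigma>\<in>nondegenerate n. \<Sum>j<length \<sigma>. F (\<sigma> ! j) (omit j \<sigma>)) =
      a + (\<Sum>\<sigma>\<in>nondegenerate n. \<Sum>i\<in>{..n} - set \<sigma>. F i \<sigma>)"
    by (simp add: sum_faces finite_nondegenerate)
  have "ext_d (dupont n a) + dupont n (ext_d a) =
      (\<Sum>\<sigma>\<in>nondegenerate n. (\<Sum>i\<in>{..n} - set \<sigma>. F i \<sigma>) - (\<Sum>j<length \<sigma>. F (\<sigma> ! j) (omit j \<sigma>)) +
      cst (from_forms n a \<sigma>) * ?w \<sigma>)"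
    unfolding dupont_def ext_d_sum sum.distrib[symmetric] by (rule sum.cong[OF refl]) (rule summand)
  then show ?thesis
    by (simp add: sum.distrib sum_subtractf faces to_forms_def)
qed

section \<open>Linearity and degrees of the contraction\<close>

lemma from_forms_add: "from_forms n (a + b) = from_forms n a + from_forms n b"
  and from_forms_cst_mult: "from_forms n (cst r * a) = pointwise (*) r (from_forms n a)"
  by (auto simp: from_forms_def fun_eq_iff pointwise_def cones_add cones_cst_mult)

lemma from_forms_0 [simp]: "from_forms n 0 = 0"
  by (auto simp: from_forms_def fun_eq_iff)

lemma from_forms_sum: "from_forms n (sum F I) = (\<Sum>i\<in>I. from_forms n (F i))"
  by (induction I rule: infinite_finite_induct) (simp_all add: from_forms_add)

lemma sum_fun_apply: "(\<Sum>i\<in>I. F i) x = (\<Sum>i\<in>I. F i x :: 'b::comm_monoid_add)"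
  by (induction I rule: infinite_finite_induct) auto

lemma to_forms_add: "to_forms n (x + y) = to_forms n x + to_forms n y"
  and to_forms_scale: "to_forms n (pointwise (*) r x) = cst r * to_forms n x"
  by (simp_all add: to_forms_def cst_add distrib_right sum.distrib pointwise_def cst_mult
      sum_distrib_left mult.assoc)

lemma dupont_add: "dupont n (a + b) = dupont n a + dupont n b"
  by (simp add: dupont_def cones_add distrib_left koszul_def flip: sum.distrib cong: sum.cong)
    (rule sum.cong; simp)

lemma dupont_cst_mult: "dupont n (cst r * a) = cst r * dupont n a"
  by (auto simp: dupont_def cones_cst_mult sum_distrib_left cst_left_commute[of _ r] koszul_def
      intro!: sum.cong)

lemma homog_to_forms: "x \<in> N n q \<Longrightarrow> homog q (to_forms n x)"
  unfolding to_forms_def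
proof (rule homog_sum)
  fix \<sigma> assume x: "x \<in> N n q"
  show "homog q (cst (x \<sigma>) * whitney n \<sigma>)"
  proof (cases "x \<sigma> = 0")
    case False
    then have "q = int (length \<sigma>) - 1" using x by (auto simp: N_def simplex_dim_def)
    then show ?thesis by (simp add: homog_cst_mult homog_whitney)
  qed (simp add: homog_0)
qed

lemma homog_dupont: "homog q a \<Longrightarrow> homog (q - 1) (dupont n a)"
  unfolding dupont_def
proof (intro homog_sum homog_koszul)
  fix \<sigma> assume "homog q a"
  from homog_mult[OF homog_whitney[of \<sigma> n] homog_cones[OF this, of \<sigma>]]
  show "homog (q - 1) (whitney n \<sigma> * cones \<sigma> a)" by (simp add: algebra_simps)
qed

lemma from_forms_N: "homog q a \<Longrightarrow> from_forms n a \<in> N n q"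
proof -
  assume a: "homog q a"
  have "ev (last \<tau>) (cones (butlast \<tau>) a) = 0" if "simplex_dim \<tau> \<noteq> q" "\<tau> \<in> nondegenerate n" for \<tau>
  proof (rule homog_ev[OF homog_cones[OF a]])
    show "q - int (length (butlast \<tau>)) \<noteq> 0"
      using that by (cases \<tau> rule: rev_cases) (auto simp: simplex_dim_def)
  qed
  then show ?thesis by (auto simp: N_def from_forms_def split: if_splits)
qed

subsection \<open>Naturality\<close>

text \<open>The components of the simplicial map: vertex \<open>l\<close> goes to
  \<open>\<theta> ! l\<close>, so coordinate \<open>i\<close> pulls back to the sum over the fibre
  of \<open>i\<close>.\<close>

definition pull_var :: "nat \<Rightarrow> nat list \<Rightarrow> nat \<Rightarrow> 'k::field_char_0 form" where
  "pull_var m \<theta> i = (\<Sum>l\<in>{l. l \<le> m \<and> \<theta> ! l = i}. bary m l)"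

abbreviation form_pullback :: "nat \<Rightarrow> nat list \<Rightarrow> 'k::field_char_0 form \<Rightarrow> 'k form" where
  "form_pullback m \<theta> \<equiv> subst (pull_var m \<theta>)"

lemma homog_pull_var: "homog 0 (pull_var m \<theta> i)"
  by (simp add: pull_var_def homog_sum homog_bary)

lemmas form_pullback = subst[OF homog_pull_var]

lemma sum_vtx_pull: "j \<le> m \<Longrightarrow> (\<Sum>l\<in>{l. l \<le> m \<and> \<theta> ! l = k}. vtx j l) = vtx (\<theta> ! j) k"
  by (simp add: vtx_def sum.delta)

lemma contr_pull_var:
  assumes "j \<le> m"
  shows "contr j (ext_d (pull_var m \<theta> k)) = pull_var m \<theta> k - cst (vtx (\<theta> ! j) k)"
  by (simp add: pull_var_def ext_d_sum contr_sum contr_d_bary[OF assms] sum_subtractf sum_cst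
      sum_vtx_pull[OF assms])

lemma wpart_pull_var:
  assumes "j \<le> m"
  shows "wpart j w (pull_var m \<theta> k) = (if w = 0 then cst (vtx (\<theta> ! j) k)
    else if w = 1 then pull_var m \<theta> k - cst (vtx (\<theta> ! j) k) else 0)"
  by (simp add: pull_var_def wpart_sum wpart_bary[OF assms] sum_subtractf sum_cst
      sum_vtx_pull[OF assms])

text \<open>The map is affine and takes vertex \<open>j\<close> to \<open>\<theta> ! j\<close>,
  hence rays from the first to rays from the second.\<close>

lemma form_pullback_cone: "j \<le> m \<Longrightarrow> form_pullback m \<theta> (cone (\<theta> ! j) a) = cone j (form_pullback m \<theta> a)"
  by (rule subst_cone[OF homog_pull_var contr_pull_var wpart_pull_var])

lemma ev_form_pullback: "j \<le> m \<Longrightarrow> ev j (form_pullback m \<theta> a) = ev (\<theta> ! j) a"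
  by (rule ev_subst[OF homog_pull_var contr_pull_var wpart_pull_var])

lemma form_pullback_cones:
  "set J \<subseteq> {..m} \<Longrightarrow> form_pullback m \<theta> (cones (map ((!) \<theta>) J) a) = cones J (form_pullback m \<theta> a)"
  by (induction J arbitrary: a) (auto simp: form_pullback_cone)

context
  fixes m n \<theta>
  assumes \<theta>: "\<theta> \<in> Delta m n"
begin

lemma theta_le: "l \<le> m \<Longrightarrow> \<theta> ! l \<le> n"
  and theta_mono: "k \<le> l \<Longrightarrow> l \<le> m \<Longrightarrow> \<theta> ! k \<le> \<theta> ! l"
  using \<theta> by (force simp: Delta_def intro: sorted_nth_mono)+

text \<open>Each vertex of the source lies in exactly one fibre, so the pulled-back coordinates sum
  to 1 and the correction term of \<open>bary\<close> disappears.\<close>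

lemma form_pullback_bary:
  assumes "i \<le> n"
  shows "form_pullback m \<theta> (bary n i) = pull_var m \<theta> i"
proof -
  have "(\<Sum>i\<le>n. pull_var m \<theta> i) = (\<Sum>l\<le>m. bary m l :: 'a form)"
    unfolding pull_var_def using sum.group[of "{..m}" "{..n}" "(!) \<theta>" "bary m"] theta_le
    by (auto simp: image_subset_iff)
  then have "form_pullback m \<theta> (1 - (\<Sum>l\<le>n. var l)) = (0 :: 'a form)"
    by (simp add: subst_minus[OF homog_pull_var] subst_sum[OF homog_pull_var] form_pullback
        subst_1[OF homog_pull_var] sum_bary)
  then show ?thesis by (simp add: bary_def form_pullback)
qed

text \<open>Lifts need not be sorted: they index the expansion of a product of sums over fibres,
  where every letter is chosen independently.\<close>

definition lifts :: "nat list \<Rightarrow> nat list set" where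
  "lifts \<sigma> = {J. set J \<subseteq> {..m} \<and> map ((!) \<theta>) J = \<sigma>}"

lemma lifts_Nil: "lifts [] = {[]}"
  by (auto simp: lifts_def)

lemma sum_lifts_Cons:
  "(\<Sum>J\<in>lifts (i # \<sigma>). F J) = (\<Sum>l\<in>{l. l \<le> m \<and> \<theta> ! l = i}. \<Sum>J\<in>lifts \<sigma>. F (l # J))"
proof -
  have "(\<Sum>l\<in>{l. l \<le> m \<and> \<theta> ! l = i}. \<Sum>J\<in>lifts \<sigma>. F (l # J)) =
      (\<Sum>(l, J)\<in>{l. l \<le> m \<and> \<theta> ! l = i} \<times> lifts \<sigma>. F (l # J))"
    by (rule sum.cartesian_product)
  also have "\<dots> = (\<Sum>J\<in>lifts (i # \<sigma>). F J)"
    by (rule sum.reindex_bij_witness[of _ "\<lambda>J. (hd J, tl J)" "\<lambda>(l, J). l # J"])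
      (auto simp: lifts_def)
  finally show ?thesis by simp
qed

lemma form_pullback_dprod:
  "set \<sigma> \<subseteq> {..n} \<Longrightarrow> form_pullback m \<theta> (dprod n \<sigma>) = (\<Sum>J\<in>lifts \<sigma>. dprod m J)"
proof (induction \<sigma>)
  case (Cons i \<sigma>)
  then show ?case
    by (simp add: sum_lifts_Cons form_pullback subst_ext_d[OF homog_pull_var] form_pullback_bary)
      (simp add: pull_var_def ext_d_sum sum_product)
qed (simp add: lifts_Nil subst_1[OF homog_pull_var])

lemma form_pullback_alt:
  "set \<sigma> \<subseteq> {..n} \<Longrightarrow> form_pullback m \<theta> (alt n \<sigma>) = (\<Sum>J\<in>lifts \<sigma>. alt m J)"
proof (induction \<sigma>)
  case (Cons i \<sigma>)
  then show ?case
    by (simp add: sum_lifts_Cons form_pullback subst_minus[OF homog_pull_var]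
        subst_ext_d[OF homog_pull_var] form_pullback_bary form_pullback_dprod)
      (simp add: pull_var_def ext_d_sum sum_product sum_subtractf)
qed (simp add: lifts_Nil subst_0[OF homog_pull_var])

lemma form_pullback_whitney:
  assumes "set \<sigma> \<subseteq> {..n}"
  shows "form_pullback m \<theta> (whitney n \<sigma>) = (\<Sum>J\<in>lifts \<sigma>. whitney m J)"
proof -
  have "(\<Sum>J\<in>lifts \<sigma>. whitney m J) = (\<Sum>J\<in>lifts \<sigma>. cst (fact (length \<sigma> - 1)) * alt m J :: 'a form)"
    by (rule sum.cong[OF refl]) (auto simp: whitney_def lifts_def)
  then show ?thesis
    by (simp add: whitney_def form_pullback form_pullback_alt[OF assms] sum_distrib_left)
qed

lemma comp_Delta_eq: "comp_Delta \<theta> \<tau> = map ((!) \<theta>) \<tau>"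
  by (simp add: comp_Delta_def)

lemma comp_Delta_sorted:
  assumes "\<tau> \<in> nondegenerate m"
  shows "sorted (comp_Delta \<theta> \<tau>)" "comp_Delta \<theta> \<tau> \<noteq> []" "set (comp_Delta \<theta> \<tau>) \<subseteq> {..n}"
proof -
  have \<tau>: "sorted_wrt (<) \<tau>" "set \<tau> \<subseteq> {..m}" "\<tau> \<noteq> []" using assms by (auto simp: nondegenerate_iff)
  have "sorted_wrt (\<lambda>k l. \<theta> ! k \<le> \<theta> ! l) \<tau>"
    using \<tau>(1) by (rule sorted_wrt_mono_rel[rotated]) (use \<tau>(2) in \<open>auto intro!: theta_mono\<close>)
  then show "sorted (comp_Delta \<theta> \<tau>)" by (simp add: comp_Delta_eq sorted_wrt_map)
  show "comp_Delta \<theta> \<tau> \<noteq> []" "set (comp_Delta \<theta> \<tau>) \<subseteq> {..n}"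
    using \<tau> theta_le by (auto simp: comp_Delta_eq)
qed

lemma comp_Delta_degenerate:
  assumes "\<tau> \<in> nondegenerate m" "comp_Delta \<theta> \<tau> \<notin> nondegenerate n"
  shows "\<not> distinct (comp_Delta \<theta> \<tau>)"
  using comp_Delta_sorted[OF assms(1)] assms(2) by (auto simp: nondegenerate_iff strict_sorted_iff)

text \<open>As \<open>\<theta>\<close> is monotone, strictly increasing values force strictly
  increasing arguments.\<close>

lemma lifts_nondegenerate:
  assumes "\<sigma> \<in> nondegenerate n"
  shows "lifts \<sigma> = {\<tau> \<in> nondegenerate m. comp_Delta \<theta> \<tau> = \<sigma>}"
proof -
  have "sorted_wrt (<) J" if "J \<in> lifts \<sigma>" for J
  proof -
    have "sorted_wrt (\<lambda>k l. \<theta> ! k < \<theta> ! l) J" "set J \<subseteq> {..m}"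
      using that assms by (auto simp: lifts_def nondegenerate_iff sorted_wrt_map)
    then show ?thesis
      by (elim sorted_wrt_mono_rel[rotated]) (metis atMost_iff not_le subsetD theta_mono)
  qed
  then show ?thesis
    using assms by (auto simp: lifts_def nondegenerate_iff comp_Delta_eq)
qed

text \<open>A simplex of the source whose image is nondegenerate lies over exactly one
  \<sigma>.\<close>

lemma sum_lifts:
  "(\<Sum>\<sigma>\<in>nondegenerate n. \<Sum>J\<in>lifts \<sigma>. F J) =
    (\<Sum>\<tau>\<in>{\<tau> \<in> nondegenerate m. comp_Delta \<theta> \<tau> \<in> nondegenerate n}. F \<tau>)"
proof -
  let ?S = "{\<tau> \<in> nondegenerate m. comp_Delta \<theta> \<tau> \<in> nondegenerate n}"
  have "(\<Sum>\<sigma>\<in>nondegenerate n. \<Sum>J\<in>{\<tau> \<in> ?S. comp_Delta \<theta> \<tau> = \<sigma>}. F J) = sum F ?S"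
    by (rule sum.group) (auto simp: finite_nondegenerate)
  moreover have "lifts \<sigma> = {\<tau> \<in> ?S. comp_Delta \<theta> \<tau> = \<sigma>}" if "\<sigma> \<in> nondegenerate n" for \<sigma>
    using lifts_nondegenerate[OF that] that by auto
  ultimately show ?thesis by simp
qed

text \<open>The sum over lifts misses the simplices with degenerate image, but there the pulled-back
  cochain is 0, since normalized cochains vanish on degenerate simplices.\<close>

lemma to_forms_pullback:
  assumes "\<And>\<sigma>. \<sigma> \<notin> nondegenerate n \<Longrightarrow> x \<sigma> = 0"
  shows "to_forms m (pullback m \<theta> x) = form_pullback m \<theta> (to_forms n x)"
proof -
  have "form_pullback m \<theta> (to_forms n x) =
      (\<Sum>\<sigma>\<in>nondegenerate n. \<Sum>J\<in>lifts \<sigma>. cst (x \<sigma>) * whitney m J)"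
    unfolding to_forms_def subst_sum[OF homog_pull_var]
    by (rule sum.cong[OF refl])
      (simp add: form_pullback form_pullback_whitney nondegenerate_iff sum_distrib_left)
  also have "\<dots> = (\<Sum>\<sigma>\<in>nondegenerate n. \<Sum>J\<in>lifts \<sigma>. cst (x (comp_Delta \<theta> J)) * whitney m J)"
    by (intro sum.cong refl) (simp add: lifts_def comp_Delta_eq)
  also have "\<dots> = (\<Sum>\<tau>\<in>{\<tau> \<in> nondegenerate m. comp_Delta \<theta> \<tau> \<in> nondegenerate n}.
      cst (x (comp_Delta \<theta> \<tau>)) * whitney m \<tau>)"
    by (rule sum_lifts)
  also have "\<dots> = (\<Sum>\<tau>\<in>nondegenerate m. cst (x (comp_Delta \<theta> \<tau>)) * whitney m \<tau>)"
  proof (rule sum.mono_neutral_left)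
    have "x (comp_Delta \<theta> \<tau>) = 0" if "comp_Delta \<theta> \<tau> \<notin> nondegenerate n" for \<tau>
      using assms that by blast
    then show "\<forall>\<tau>\<in>nondegenerate m - {\<tau> \<in> nondegenerate m. comp_Delta \<theta> \<tau> \<in> nondegenerate n}.
        cst (x (comp_Delta \<theta> \<tau>)) * whitney m \<tau> = 0" by auto
  qed (auto simp: finite_nondegenerate)
  also have "\<dots> = to_forms m (pullback m \<theta> x)"
    unfolding to_forms_def by (rule sum.cong[OF refl]) (simp add: pullback_def)
  finally show ?thesis by simp
qed

text \<open>Equal entries of a sorted list are adjacent, and a Poincare homotopy squares to
  zero.\<close>

lemma cones_degenerate: "sorted \<rho> \<Longrightarrow> \<not> distinct \<rho> \<Longrightarrow> cones \<rho> a = 0"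
proof (induction \<rho> arbitrary: a)
  case (Cons i \<rho>)
  show ?case
  proof (cases "distinct \<rho>")
    case True
    then have "i \<in> set \<rho>" using Cons.prems by simp
    then obtain j \<rho>' where \<rho>: "\<rho> = j # \<rho>'" by (cases \<rho>) auto
    then have "j = i" using Cons.prems(1) \<open>i \<in> set \<rho>\<close> by force
    then show ?thesis using \<rho> by simp
  qed (use Cons in simp)
qed simp

text \<open>If only the last vertex is repeated, the reason is a different one: a cone vanishes at
  its own apex.\<close>

lemma ev_cones_degenerate:
  assumes "sorted \<rho>" "\<not> distinct \<rho>"
  shows "ev (last \<rho>) (cones (butlast \<rho>) a) = 0"
proof -
  obtain \<rho>' i where \<rho>: "\<rho> = \<rho>' @ [i]" using assms(2) by (cases \<rho> rule: rev_cases) auto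
  show ?thesis
  proof (cases "distinct \<rho>'")
    case True
    then have i: "i \<in> set \<rho>'" using assms(2) \<rho> by simp
    then obtain \<rho>'' j where \<rho>': "\<rho>' = \<rho>'' @ [j]" by (cases \<rho>' rule: rev_cases) auto
    then have "j = i" using assms(1) i \<rho> by (force simp: sorted_append)
    then show ?thesis by (simp add: \<rho> \<rho>' butlast_append cones_append)
  next
    case False
    then show ?thesis using cones_degenerate[of \<rho>' a] assms(1) \<rho> by (simp add: sorted_append)
  qed
qed

lemma from_forms_pullback: "from_forms m (form_pullback m \<theta> a) = pullback m \<theta> (from_forms n a)"
proof
  fix \<tau>
  show "from_forms m (form_pullback m \<theta> a) \<tau> = pullback m \<theta> (from_forms n a) \<tau>"
  proof (cases "\<tau> \<in> nondegenerate m")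
    case True
    then have \<tau>: "set \<tau> \<subseteq> {..m}" "\<tau> \<noteq> []" by (auto simp: nondegenerate_iff)
    then have last: "last \<tau> \<le> m" using last_in_set by blast
    have "from_forms m (form_pullback m \<theta> a) \<tau> =
        ev (last \<tau>) (cones (butlast \<tau>) (form_pullback m \<theta> a))"
      using True by (simp add: from_forms_def)
    also have "\<dots> = ev (last \<tau>) (form_pullback m \<theta> (cones (map ((!) \<theta>) (butlast \<tau>)) a))"
      using \<tau> by (subst form_pullback_cones) (auto dest: in_set_butlastD)
    also have "\<dots> = ev (last (comp_Delta \<theta> \<tau>)) (cones (butlast (comp_Delta \<theta> \<tau>)) a)"
      using \<tau> by (simp add: ev_form_pullback[OF last] comp_Delta_eq last_map map_butlast)
    also have "\<dots> = from_forms n a (comp_Delta \<theta> \<tau>)"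
      using ev_cones_degenerate[OF comp_Delta_sorted(1)[OF True] comp_Delta_degenerate[OF True]]
      by (auto simp: from_forms_def)
    finally show ?thesis using True by (simp add: pullback_def)
  qed (simp add: from_forms_def pullback_def)
qed

text \<open>Lifts of nondegenerate simplices account for all nonzero terms, since the iterated cone
  of a simplex with degenerate image vanishes.\<close>

lemma dupont_pullback: "dupont m (form_pullback m \<theta> a) = form_pullback m \<theta> (dupont n a)"
proof -
  define F where "F \<tau> = koszul (int (length \<tau>)) (whitney m \<tau> * cones \<tau> (form_pullback m \<theta> a))" for \<tau>
  have koszul: "form_pullback m \<theta> (koszul k b) = koszul k (form_pullback m \<theta> b)" for k b
    by (simp add: koszul_def subst_minus[OF homog_pull_var])
  have "form_pullback m \<theta> (dupont n a) = (\<Sum>\<sigma>\<in>nondegenerate n. \<Sum>J\<in>lifts \<sigma>. F J)"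
    unfolding dupont_def subst_sum[OF homog_pull_var]
  proof (rule sum.cong[OF refl])
    fix \<sigma> assume \<sigma>: "\<sigma> \<in> nondegenerate n"
    have "form_pullback m \<theta> (koszul (int (length \<sigma>)) (whitney n \<sigma> * cones \<sigma> a)) =
        (\<Sum>J\<in>lifts \<sigma>. koszul (int (length \<sigma>)) (whitney m J * form_pullback m \<theta> (cones \<sigma> a)))"
      using \<sigma> by (simp add: koszul form_pullback form_pullback_whitney nondegenerate_iff
        sum_distrib_right) (simp add: koszul_def sum_negf)
    also have "\<dots> = (\<Sum>J\<in>lifts \<sigma>. F J)"
    proof (rule sum.cong[OF refl])
      fix J assume "J \<in> lifts \<sigma>"
      then have "set J \<subseteq> {..m}" "\<sigma> = map ((!) \<theta>) J" by (auto simp: lifts_def)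
      then show "koszul (int (length \<sigma>)) (whitney m J * form_pullback m \<theta> (cones \<sigma> a)) = F J"
        by (simp add: F_def form_pullback_cones)
    qed
    finally show "form_pullback m \<theta> (koszul (int (length \<sigma>)) (whitney n \<sigma> * cones \<sigma> a)) = sum F (lifts \<sigma>)" .
  qed
  also have "\<dots> = (\<Sum>\<tau>\<in>{\<tau> \<in> nondegenerate m. comp_Delta \<theta> \<tau> \<in> nondegenerate n}. F \<tau>)"
    by (rule sum_lifts)
  also have "\<dots> = (\<Sum>\<tau>\<in>nondegenerate m. F \<tau>)"
  proof (rule sum.mono_neutral_left)
    show "\<forall>\<tau>\<in>nondegenerate m - {\<tau> \<in> nondegenerate m. comp_Delta \<theta> \<tau> \<in> nondegenerate n}. F \<tau> = 0"
    proof
      fix \<tau> assume t: "\<tau> \<in> nondegenerate m - {\<tau> \<in> nondegenerate m. comp_Delta \<theta> \<tau> \<in> nondegenerate n}"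
      then have "cones (comp_Delta \<theta> \<tau>) a = 0"
        using cones_degenerate[OF comp_Delta_sorted(1) comp_Delta_degenerate] by auto
      moreover have "cones \<tau> (form_pullback m \<theta> a) = form_pullback m \<theta> (cones (comp_Delta \<theta> \<tau>) a)"
        using t by (subst form_pullback_cones[symmetric]) (auto simp: nondegenerate_iff comp_Delta_eq)
      ultimately have "cones \<tau> (form_pullback m \<theta> a) = 0"
        by (simp add: subst_0[OF homog_pull_var])
      then show "F \<tau> = 0" by (simp add: F_def koszul_def)
    qed
  qed (auto simp: finite_nondegenerate)
  finally show ?thesis by (simp add: F_def dupont_def)
qed

end

subsection \<open>The contraction is a retraction\<close>

lemma koszul_zero [simp]: "koszul k 0 = 0" and koszul_even [simp]: "koszul 0 a = a"
  by (simp_all add: koszul_def)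


lemma whitney_singleton: "whitney n [i] = bary n i"
  by (simp add: whitney_def)

text \<open>Restrict to \<tau>, itself read as a map into the simplex. A vertex of \<sigma> outside
  \<tau> has no preimage, so the Whitney form restricts to 0.\<close>

lemma from_forms_whitney_not_subset:
  assumes \<tau>: "\<tau> \<in> nondegenerate n" and \<sigma>: "set \<sigma> \<subseteq> {..n}" "\<not> set \<sigma> \<subseteq> set \<tau>"
  shows "from_forms n (whitney n \<sigma>) \<tau> = 0"
proof -
  define k where "k = length \<tau> - 1"
  let ?i = "[0..<k + 1]"
  have len: "length \<tau> = k + 1" using \<tau> by (cases \<tau>) (auto simp: k_def)
  have D: "\<tau> \<in> Delta k n" using \<tau> len by (auto simp: Delta_def nondegenerate_iff strict_sorted_iff)
  have i: "?i \<in> nondegenerate k" using sorted_wrt_upt[of 0 "k + 1"] by (auto simp: nondegenerate_iff simp del: upt_Suc)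
  have "comp_Delta \<tau> ?i = \<tau>" unfolding comp_Delta_def len[symmetric] by (rule map_nth)
  then have "from_forms n (whitney n \<sigma>) \<tau> = from_forms k (form_pullback k \<tau> (whitney n \<sigma>)) ?i"
    using i by (simp add: from_forms_pullback[OF D] pullback_def)
  also have "form_pullback k \<tau> (whitney n \<sigma>) = 0"
  proof -
    have "lifts k \<tau> \<sigma> = {}"
      using \<sigma>(2) len by (auto simp: lifts_def[OF D]) (metis atMost_iff less_Suc_eq_le nth_mem subsetD Suc_eq_plus1)
    then show ?thesis by (simp add: form_pullback_whitney[OF D \<sigma>(1)])
  qed
  finally show ?thesis by simp
qed

text \<open>Induction on the dimension by Stokes' theorem, with no integral computed. For \<tau>
  equal to \<open>i # \<sigma>\<close>, the derivative of the form of \<sigma> has the same value on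
  \<tau> as the form of \<tau>, and the coboundary sees only the face \<sigma>.\<close>

lemma from_forms_whitney_same:
  "\<tau> \<in> nondegenerate n \<Longrightarrow> from_forms n (whitney n \<tau>) \<tau> = (1 :: 'k::field_char_0)"
proof (induction "length \<tau>" arbitrary: \<tau>)
  case (Suc l)
  then obtain i \<sigma> where \<tau>: "\<tau> = i # \<sigma>" by (cases \<tau>) auto
  have s: "sorted_wrt (<) (i # \<sigma>)" "set \<sigma> \<subseteq> {..n}" "i \<le> n"
    using Suc.prems \<tau> by (auto simp: nondegenerate_iff)
  then have d: "distinct (i # \<sigma>)" by (simp add: strict_sorted_iff del: sorted_wrt.simps distinct.simps)
  show ?case
  proof (cases "\<sigma> = []")
    case True
    then show ?thesis
      using Suc.prems \<tau> by (simp add: from_forms_def whitney_singleton ev_bary s vtx_def)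
  next
    case False
    then have \<sigma>: "\<sigma> \<in> nondegenerate n" using s by (simp add: nondegenerate_iff)
    have one: "from_forms n (whitney n \<sigma>) \<sigma> = (1 :: 'k)" using Suc.hyps \<tau> \<sigma> by simp
    \<comment> \<open>Every other face of \<tau> lacks a vertex of \<sigma>.\<close>
    have "from_forms n (whitney n \<sigma>) (omit (Suc j) \<tau>) = (0 :: 'k)" if j: "j < length \<sigma>" for j
    proof (rule from_forms_whitney_not_subset)
      show "omit (Suc j) \<tau> \<in> nondegenerate n"
        using omit_nondegenerate[OF Suc.prems, of "Suc j"] by (simp add: \<tau>)
      have "\<sigma> ! j \<notin> set (omit (Suc j) \<tau>)"
      proof -
        have "distinct (i # take j \<sigma> @ \<sigma> ! j # drop (Suc j) \<sigma>)"
          using d id_take_nth_drop[OF j] by simp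
        then show ?thesis by (auto simp: \<tau>)
      qed
      then show "\<not> set \<sigma> \<subseteq> set (omit (Suc j) \<tau>)" using j nth_mem by blast
    qed (use s in simp)
    then have "coboundary n (from_forms n (whitney n \<sigma>)) \<tau> = (1 :: 'k)"
      using Suc.prems one
      by (simp add: coboundary_def \<tau> sum.lessThan_Suc_shift del: sum.lessThan_Suc)
    moreover have "from_forms n (ext_d (whitney n \<sigma>)) \<tau> = (from_forms n (whitney n \<tau>) \<tau> :: 'k)"
    proof -
      \<comment> \<open>Of the vertices that \<open>ext_d\<close> can add to \<sigma>, only
        \<open>i\<close> lies in \<tau>.\<close>
      have "from_forms n (whitney n (j # \<sigma>)) \<tau> = (0 :: 'k)" if "j \<le> n" "j \<noteq> i" for j
      proof (cases "j \<in> set \<sigma>")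
        case False
        then show ?thesis
          using that s by (intro from_forms_whitney_not_subset Suc.prems) (auto simp: \<tau>)
      qed (simp add: whitney_Cons_mem)
      then have "(\<Sum>j\<le>n. from_forms n (whitney n (j # \<sigma>)) \<tau>) =
          (\<Sum>j\<in>{i}. from_forms n (whitney n (j # \<sigma>)) \<tau> :: 'k)"
        using s by (intro sum.mono_neutral_right) auto
      then show ?thesis
        using False by (simp add: ext_d_whitney from_forms_sum sum_fun_apply \<tau>)
    qed
    ultimately show ?thesis by (simp add: from_forms_ext_d)
  qed
qed simp

text \<open>Different simplices are separated by degree if their dimensions differ, and by a vertex
  otherwise.\<close>

lemma from_forms_whitney:
  assumes \<sigma>: "\<sigma> \<in> nondegenerate n" and \<tau>: "\<tau> \<in> nondegenerate n"
  shows "from_forms n (whitney n \<sigma>) \<tau> = (if \<sigma> = \<tau> then 1 else (0 :: 'k::field_char_0))"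
proof (cases "\<sigma> = \<tau>")
  case False
  consider "length \<sigma> \<noteq> length \<tau>" | "\<not> set \<sigma> \<subseteq> set \<tau>"
    using False \<sigma> \<tau>
    by (metis card_subset_eq distinct_card List.finite_set nondegenerate_iff strict_sorted_iff
        sorted_distinct_set_unique)
  then show ?thesis
  proof cases
    case 1
    have "from_forms n (whitney n \<sigma> :: 'k form) \<in> N n (int (length \<sigma>) - 1)"
      by (rule from_forms_N[OF homog_whitney])
    then show ?thesis using 1 False by (auto simp: N_def simplex_dim_def)
  next
    case 2
    then show ?thesis
      using from_forms_whitney_not_subset[OF \<tau>] \<sigma> False by (auto simp: nondegenerate_iff)
  qed
qed (simp add: from_forms_whitney_same \<tau>)

lemma from_forms_to_forms:
  assumes "\<tau> \<in> nondegenerate n"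
  shows "from_forms n (to_forms n x) \<tau> = x \<tau>"
proof -
  have "from_forms n (to_forms n x) \<tau> = (\<Sum>\<sigma>\<in>nondegenerate n. x \<sigma> * from_forms n (whitney n \<sigma>) \<tau>)"
    by (simp add: to_forms_def from_forms_sum sum_fun_apply from_forms_cst_mult pointwise_def)
  also have "\<dots> = (\<Sum>\<sigma>\<in>nondegenerate n. if \<sigma> = \<tau> then x \<sigma> else 0)"
    by (rule sum.cong) (auto simp: from_forms_whitney assms)
  finally show ?thesis using assms by (simp add: finite_nondegenerate)
qed

lemma from_to_N: "x \<in> N n q \<Longrightarrow> from_forms n (to_forms n x) = x"
proof
  fix \<tau> assume "x \<in> N n q"
  then show "from_forms n (to_forms n x) \<tau> = x \<tau>"
    by (cases "\<tau> \<in> nondegenerate n") (auto simp: from_forms_to_forms, auto simp: from_forms_def N_def)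
qed

section \<open>The projection and the side conditions\<close>

definition proj :: "nat \<Rightarrow> 'k::field_char_0 form \<Rightarrow> 'k form" where
  "proj n a = to_forms n (from_forms n a)"

lemma to_forms_0 [simp]: "to_forms n 0 = 0"
  by (simp add: to_forms_def)

lemma proj_to_forms [simp]: "proj n (to_forms n x) = to_forms n x"
  unfolding proj_def by (simp only: to_forms_def) (simp add: from_forms_to_forms flip: to_forms_def)

lemma from_forms_proj [simp]: "from_forms n (proj n a) = from_forms n a"
  unfolding proj_def fun_eq_iff by (metis from_forms_to_forms from_forms_def)

lemma proj_proj [simp]: "proj n (proj n a) = proj n a"
  unfolding proj_def[of n a] by simp

lemma from_forms_minus: "from_forms n (a - b) = from_forms n a - from_forms n b"
  by (metis add_diff_cancel_right' diff_add_cancel from_forms_add)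

lemma to_forms_minus: "to_forms n (a - b) = to_forms n a - to_forms n b"
  by (metis add_diff_cancel_right' diff_add_cancel to_forms_add)

lemma dupont_minus: "dupont n (a - b) = dupont n a - dupont n b"
  by (metis add_diff_cancel_right' diff_add_cancel dupont_add)

lemma proj_add: "proj n (a + b) = proj n a + proj n b"
  and proj_minus: "proj n (a - b) = proj n a - proj n b"
  and proj_cst_mult: "proj n (cst r * a) = cst r * proj n a"
  by (simp_all add: proj_def from_forms_add from_forms_minus from_forms_cst_mult to_forms_add
      to_forms_minus to_forms_scale)

lemma ext_d_proj: "ext_d (proj n a) = proj n (ext_d a)"
  unfolding proj_def from_forms_ext_d by (subst to_forms_coboundary) (auto simp: from_forms_def)

lemma homog_proj: "homog q a \<Longrightarrow> homog q (proj n a)"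
  unfolding proj_def by (rule homog_to_forms[OF from_forms_N])

text \<open>Any homotopy can be modified so that the side conditions hold (Lambe and Stasheff).\<close>

definition dupont1 :: "nat \<Rightarrow> 'k::field_char_0 form \<Rightarrow> 'k form" where
  "dupont1 n a = dupont n (a - proj n a) - proj n (dupont n (a - proj n a))"

text \<open>The minus sign stems from the convention \<open>d h + h d = proj - 1\<close>. The result
  equals \<open>dupont1\<close> plus \<open>ext_d\<close> of its square, so it differs from
  \<open>dupont1\<close> by an exact term.\<close>

definition htpy :: "nat \<Rightarrow> 'k::field_char_0 form \<Rightarrow> 'k form" where
  "htpy n a = - dupont1 n (ext_d (dupont1 n a))"

lemma dupont1_add: "dupont1 n (a + b) = dupont1 n a + dupont1 n b"
  and dupont1_minus: "dupont1 n (a - b) = dupont1 n a - dupont1 n b"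
  by (simp_all add: dupont1_def proj_add proj_minus dupont_minus dupont_add)

lemma dupont1_cst_mult: "dupont1 n (cst r * a) = cst r * dupont1 n a"
  by (simp add: dupont1_def proj_cst_mult dupont_cst_mult proj_minus flip: right_diff_distrib)

lemma dupont1_0 [simp]: "dupont1 n 0 = 0"
  using dupont1_minus[of n 0 0] by simp

lemma dupont1_to_forms [simp]: "dupont1 n (to_forms n x) = 0"
proof -
  have "dupont n 0 = (0 :: 'a form)" using dupont_minus[of n 0 "0 :: 'a form"] by simp
  then show ?thesis using proj_minus[of n 0 "0 :: 'a form"] by (simp add: dupont1_def)
qed

lemma from_forms_dupont1 [simp]: "from_forms n (dupont1 n a) = 0"
  by (simp add: dupont1_def from_forms_minus)

lemma dupont1_homotopy: "ext_d (dupont1 n a) = proj n a - a - dupont1 n (ext_d a)"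
proof -
  let ?b = "a - proj n a"
  have "ext_d (dupont1 n a) = ext_d (dupont n ?b) - proj n (ext_d (dupont n ?b))"
    by (simp add: dupont1_def ext_d_proj)
  also have "ext_d (dupont n ?b) = proj n ?b - ?b - dupont n (ext_d ?b)"
    using dupont_homotopy[of n ?b] by (simp add: proj_def algebra_simps)
  finally show ?thesis by (simp add: dupont1_def proj_minus proj_add ext_d_proj algebra_simps)
qed

text \<open>Passing \<open>ext_d\<close> through each factor produces a term
  \<open>dupont1 n a\<close>, with opposite signs. The terms with the projection die on either side
  of \<open>dupont1\<close>.\<close>

lemma dupont1_dupont1_ext_d: "ext_d (dupont1 n (dupont1 n a)) = dupont1 n (dupont1 n (ext_d a))"
  by (simp add: dupont1_homotopy dupont1_minus proj_def)

lemma htpy_add: "htpy n (a + b) = htpy n a + htpy n b"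
  and htpy_cst_mult: "htpy n (cst r * a) = cst r * htpy n a"
  by (simp_all add: htpy_def dupont1_add dupont1_cst_mult)

lemma htpy_0 [simp]: "htpy n 0 = 0"
  by (simp add: htpy_def)

lemma htpy_minus: "htpy n (- a) = - htpy n a"
  using htpy_add[of n a "- a"] by (simp add: eq_neg_iff_add_eq_0 add.commute)

lemma htpy_to_forms [simp]: "htpy n (to_forms n x) = 0"
  by (simp add: htpy_def)

lemma from_forms_uminus: "from_forms n (- a) = - from_forms n a"
  using from_forms_minus[of n 0 a] by simp

lemma from_forms_htpy [simp]: "from_forms n (htpy n a) = 0"
  by (simp add: htpy_def from_forms_uminus)

lemma dupont1_uminus: "dupont1 n (- a) = - dupont1 n a"
  using dupont1_minus[of n 0 a] by simp

lemma htpy_htpy [simp]: "htpy n (htpy n a) = 0"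
proof -
  have "ext_d (dupont1 n (dupont1 n (ext_d b))) = 0" for b :: "'a form"
    by (simp add: dupont1_dupont1_ext_d)
  then show ?thesis by (simp add: htpy_def dupont1_uminus)
qed

lemma htpy_homotopy: "ext_d (htpy n a) + htpy n (ext_d a) = proj n a - a"
proof -
  have 1: "ext_d (dupont1 n (ext_d b)) = ext_d (proj n b) - ext_d b" for b
    using arg_cong[OF dupont1_homotopy[of n b], of ext_d] by (simp add: algebra_simps)
  have "ext_d (htpy n a) = - ext_d (proj n (dupont1 n a)) + ext_d (dupont1 n a)"
    using 1[of "dupont1 n a"] by (simp add: htpy_def)
  moreover have "htpy n (ext_d a) = dupont1 n (ext_d a)"
    using 1[of a] by (simp add: htpy_def dupont1_minus dupont1_uminus ext_d_proj)
      (simp add: proj_def)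
  moreover have "proj n (dupont1 n a) = 0" by (simp add: proj_def)
  ultimately show ?thesis by (simp add: dupont1_homotopy)
qed

lemma homog_htpy: "homog q a \<Longrightarrow> homog (q - 1) (htpy n a)"
proof -
  have 1: "homog q a \<Longrightarrow> homog (q - 1) (dupont1 n a)" for q and a :: "'a form"
    unfolding dupont1_def by (intro homog_diff homog_dupont homog_proj)
  assume "homog q a"
  from 1[OF homog_ext_d[OF 1[OF this]]] show ?thesis by (simp add: htpy_def homog_uminus)
qed

lemma htpy_pullback:
  assumes "\<theta> \<in> Delta m n"
  shows "htpy m (form_pullback m \<theta> a) = form_pullback m \<theta> (htpy n a)"
proof -
  note s = subst_minus[OF homog_pull_var]
  have p: "proj m (form_pullback m \<theta> b) = form_pullback m \<theta> (proj n b)" for b :: "'a form"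
    unfolding proj_def from_forms_pullback[OF assms]
    by (rule to_forms_pullback[OF assms]) (simp add: from_forms_def)
  have "dupont1 m (form_pullback m \<theta> b) = form_pullback m \<theta> (dupont1 n b)" for b :: "'a form"
    by (simp add: dupont1_def p s[symmetric] dupont_pullback[OF assms])
  then show ?thesis
    by (simp add: htpy_def s subst_ext_d[OF homog_pull_var, symmetric])
qed

section \<open>The unit cochain, and properties of the coboundary\<close>

definition unit_cochain :: "nat \<Rightarrow> nat list \<Rightarrow> 'k::field_char_0" where
  "unit_cochain n \<sigma> = (if \<sigma> \<in> nondegenerate n \<and> length \<sigma> = 1 then 1 else 0)"

lemma to_forms_unit: "to_forms n (unit_cochain n) = 1"
proof -
  have "to_forms n (unit_cochain n) = (\<Sum>\<sigma>\<in>(\<lambda>i. [i]) ` {..n}. cst (unit_cochain n \<sigma>) * whitney n \<sigma> :: 'a form)"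
    unfolding to_forms_def
    by (rule sum.mono_neutral_right)
      (auto simp: finite_nondegenerate nondegenerate_iff unit_cochain_def length_Suc_conv image_iff)
  also have "\<dots> = (\<Sum>i\<le>n. whitney n [i])"
    by (subst sum.reindex) (auto simp: inj_on_def unit_cochain_def nondegenerate_iff)
  finally show ?thesis by (simp add: sum_whitney_single)
qed

lemma unit_cochain_N: "unit_cochain n \<in> N n 0"
  by (auto simp: N_def unit_cochain_def simplex_dim_def split: if_splits)

text \<open>The Whitney map has a left inverse, so facts about the coboundary can be read off from
  \<open>ext_d\<close>.\<close>

lemma coboundary_eq: "x \<in> N n q \<Longrightarrow> coboundary n x = from_forms n (ext_d (to_forms n x))"
  by (simp add: from_forms_ext_d from_to_N)

lemma coboundary_coboundary:
  fixes x :: "nat list \<Rightarrow> 'k::field_char_0"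
  assumes "x \<in> N n q"
  shows "coboundary n (coboundary n x) = 0"
  by (metis assms coboundary_eq ext_d_ext_d from_forms_0 from_forms_ext_d)

lemma coboundary_N:
  fixes x :: "nat list \<Rightarrow> 'k::field_char_0"
  assumes "x \<in> N n q"
  shows "coboundary n x \<in> N n (q + 1)"
  unfolding coboundary_eq[OF assms] by (intro from_forms_N homog_ext_d homog_to_forms assms)

lemma pullback_N:
  fixes x :: "nat list \<Rightarrow> 'k::field_char_0"
  assumes "x \<in> N n q"
  shows "pullback m \<theta> x \<in> N m q"
  using assms by (auto simp: N_def pullback_def simplex_dim_def comp_Delta_def split: if_splits)

lemma coboundary_pullback:
  fixes x :: "nat list \<Rightarrow> 'k::field_char_0"
  assumes \<theta>: "\<theta> \<in> Delta m n" and x: "x \<in> N n q"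
  shows "coboundary m (pullback m \<theta> x) = pullback m \<theta> (coboundary n x)"
proof -
  have "to_forms m (pullback m \<theta> x) = form_pullback m \<theta> (to_forms n x)"
    using x by (intro to_forms_pullback[OF \<theta>]) (auto simp: N_def)
  then show ?thesis
    by (simp only: coboundary_eq[OF x] coboundary_eq[OF pullback_N[OF x]]
        subst_ext_d[OF homog_pull_var, symmetric] from_forms_pullback[OF \<theta>])
qed

lemma coboundary_unit: "coboundary n (unit_cochain n) = (0 :: _ \<Rightarrow> 'k::field_char_0)"
  by (simp add: coboundary_eq[OF unit_cochain_N] to_forms_unit)

section \<open>Transfer of the product to the cochains\<close>

subsection \<open>Coderivations, deconcatenation and shuffles\<close>

lemma koszul_add: "koszul k (a + b) = koszul k a + koszul k b"
  and koszul_minus: "koszul k (- a) = - koszul k a"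
  and koszul_diff: "koszul k (a - b) = koszul k a - koszul k b"
  by (simp_all add: koszul_def)

lemma koszul_sum: "koszul k (sum F I) = (\<Sum>i\<in>I. koszul k (F i))"
  by (simp add: koszul_def sum_negf)

lemma koszul_cong: "even (k - l) \<Longrightarrow> koszul k a = koszul l a"
  by (simp add: koszul_def)

lemma wdeg_simps [simp]: "wdeg [] = 0" "wdeg (a # w) = fst a + wdeg w" "wdeg (u @ v) = wdeg u + wdeg v"
  by (simp_all add: wdeg_def)

lemma words_simps [simp]: "[] \<in> words V" "(k, x) # w \<in> words V \<longleftrightarrow> x \<in> V k \<and> w \<in> words V"
  "u @ v \<in> words V \<longleftrightarrow> u \<in> words V \<and> v \<in> words V"
  by (auto simp: words_def)

lemma words_take: "w \<in> words V \<Longrightarrow> take i w \<in> words V"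
  and words_drop: "w \<in> words V \<Longrightarrow> drop i w \<in> words V"
  by (auto simp: words_def dest: in_set_takeD in_set_dropD)

text \<open>The pairing of a function on words with the coderivation determined by \<open>m\<close>.\<close>

fun coder :: "('v word \<Rightarrow> 'v) \<Rightarrow> ('v word \<Rightarrow> 'c::ab_group_add) \<Rightarrow> 'v word \<Rightarrow> 'c" where
  "coder m F [] = 0"
| "coder m F (a # w) =
    (\<Sum>k=1..Suc (length w). F ((wdeg (take k (a # w)) + 1, m (take k (a # w))) # drop k (a # w))) +
    koszul (fst a) (coder m (\<lambda>u. F (a # u)) w)"

text \<open>The double sum of the relation is ordered by length and position of the block. The
  recursion instead singles out the blocks that start at the first letter; the others have their
  position lowered by one.\<close>

lemma coder_eq:
  "(\<Sum>k = 1..length w. \<Sum>j = 0..length w - k. koszul (wdeg (take j w))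
      (F (take j w @ [(wdeg (take k (drop j w)) + 1, m (take k (drop j w)))] @ drop (j + k) w))) =
    coder m F w"
proof (induction w arbitrary: F)
  case (Cons a w)
  let ?t = "\<lambda>F w j k. koszul (wdeg (take j w))
      (F (take j w @ [(wdeg (take k (drop j w)) + 1, m (take k (drop j w)))] @ drop (j + k) w))"
  let ?n = "length w"
  have h: "(\<Sum>j = 0..Suc ?n - k. ?t F (a # w) j k) = ?t F (a # w) 0 k +
      (\<Sum>j\<in>{j. j + k \<le> ?n}. koszul (fst a) (?t (\<lambda>u. F (a # u)) w j k))" if k: "k \<in> {1..Suc ?n}" for k
  proof -
    have "(\<Sum>j = 0..Suc ?n - k. ?t F (a # w) j k) =
        ?t F (a # w) 0 k + (\<Sum>j = 1..Suc ?n - k. ?t F (a # w) j k)"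
      by (simp add: sum.atLeast_Suc_atMost)
    also have "(\<Sum>j = 1..Suc ?n - k. ?t F (a # w) j k) =
        (\<Sum>j\<in>{j. j + k \<le> ?n}. ?t F (a # w) (Suc j) k)"
      by (rule sum.reindex_bij_witness[of _ Suc "\<lambda>j. j - 1"]) (use k in auto)
    finally show ?thesis by (simp add: koszul_koszul)
  qed
  have "(\<Sum>k = 1..Suc ?n. \<Sum>j = 0..Suc ?n - k. ?t F (a # w) j k) =
      (\<Sum>k = 1..Suc ?n. ?t F (a # w) 0 k) +
      (\<Sum>k = 1..Suc ?n. \<Sum>j\<in>{j. j + k \<le> ?n}. koszul (fst a) (?t (\<lambda>u. F (a # u)) w j k))"
    by (subst sum.distrib[symmetric]) (rule sum.cong[OF refl h])
  also have "(\<Sum>k = 1..Suc ?n. \<Sum>j\<in>{j. j + k \<le> ?n}. koszul (fst a) (?t (\<lambda>u. F (a # u)) w j k)) =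
      (\<Sum>k = 1..?n. \<Sum>j\<in>{j. j + k \<le> ?n}. koszul (fst a) (?t (\<lambda>u. F (a # u)) w j k))"
    by simp
  also have "\<dots> = (\<Sum>k = 1..?n. \<Sum>j = 0..?n - k. koszul (fst a) (?t (\<lambda>u. F (a # u)) w j k))"
    by (intro sum.cong refl) auto
  also have "\<dots> = koszul (fst a) (coder m (\<lambda>u. F (a # u)) w)"
    unfolding Cons[symmetric] koszul_sum ..
  finally show ?case by simp
qed simp

lemma coder_add: "coder m (\<lambda>u. F u + G u) w = coder m F w + coder m G w"
  by (induction w arbitrary: F G) (simp_all add: sum.distrib koszul_add algebra_simps)

lemma coder_minus: "coder m (\<lambda>u. - F u) w = - coder m F w"
  by (induction w arbitrary: F) (simp_all add: sum_negf koszul_minus)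

lemma coder_hom:
  assumes "\<And>a b. h (a + b) = h a + h b"
  shows "coder m (\<lambda>u. h (F u)) w = h (coder m F w)"
proof -
  have 0: "h 0 = 0" using assms[of 0 0] by simp
  then have n: "h (- a) = - h a" for a
    using assms[of a "- a"] by (simp add: eq_neg_iff_add_eq_0 add.commute)
  have s: "h (sum G I) = (\<Sum>i\<in>I. h (G i))" for G :: "nat \<Rightarrow> _" and I
    by (induction I rule: infinite_finite_induct) (simp_all add: 0 assms)
  have k: "h (koszul k a) = koszul k (h a)" for k a by (simp add: koszul_def n)
  show ?thesis by (induction w arbitrary: F) (simp_all add: 0 assms s k del: sum.cl_ivl_Suc)
qed

lemma coder_cong:
  "(\<And>u. u \<noteq> [] \<Longrightarrow> F u = G u) \<Longrightarrow> coder m F w = coder m G w"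
proof (induction w arbitrary: F G)
  case (Cons a w)
  have "coder m (\<lambda>u. F (a # u)) w = coder m (\<lambda>u. G (a # u)) w" by (rule Cons.IH) (simp add: Cons.prems)
  then show ?case using Cons.prems by simp
qed simp

lemma coder_zero: "(\<And>u. u \<noteq> [] \<Longrightarrow> F u = 0) \<Longrightarrow> coder m F w = 0"
proof -
  have "coder m (\<lambda>u. 0 + 0) w = coder m (\<lambda>_. 0) w + (coder m (\<lambda>_. 0) w :: 'b)"
    by (rule coder_add)
  then have "coder m (\<lambda>_. 0) w = (0 :: 'b)" by simp
  then show "(\<And>u. u \<noteq> [] \<Longrightarrow> F u = 0) \<Longrightarrow> coder m F w = 0"
    using coder_cong[of F "\<lambda>_. 0" m w] by simp
qed

text \<open>The sign is that of an odd second function passing the first part of the word.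
  \<open>conv0\<close> is the version for an even second function.\<close>

fun conv :: "('v word \<Rightarrow> 'c) \<Rightarrow> ('v word \<Rightarrow> 'c) \<Rightarrow> 'v word \<Rightarrow> 'c::ring" where
  "conv F G [] = F [] * G []"
| "conv F G (a # w) = F [] * G (a # w) + koszul (fst a) (conv (\<lambda>u. F (a # u)) G w)"

fun conv0 :: "('v word \<Rightarrow> 'c) \<Rightarrow> ('v word \<Rightarrow> 'c) \<Rightarrow> 'v word \<Rightarrow> 'c::ring" where
  "conv0 F G [] = F [] * G []"
| "conv0 F G (a # w) = F [] * G (a # w) + conv0 (\<lambda>u. F (a # u)) G w"

lemma conv_eq: "conv F G w = (\<Sum>p\<le>length w. koszul (wdeg (take p w)) (F (take p w) * G (drop p w)))"
proof (induction w arbitrary: F)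
  case (Cons a w)
  show ?case by (simp add: Cons sum.atMost_Suc_shift koszul_sum koszul_koszul del: sum.atMost_Suc)
qed simp

lemma conv0_eq: "conv0 F G w = (\<Sum>p\<le>length w. F (take p w) * G (drop p w))"
  by (induction w arbitrary: F) (simp_all add: sum.atMost_Suc_shift del: sum.atMost_Suc)

lemma conv_add_left: "conv (\<lambda>u. F u + F' u) G w = conv F G w + conv F' G w"
  by (simp add: conv_eq distrib_right koszul_add sum.distrib)

lemma conv_mult_left: "conv (\<lambda>u. c * F u) G w = c * conv F G w"
  by (simp add: conv_eq mult.assoc sum_distrib_left koszul_mult_right)

lemma conv_koszul_left: "conv (\<lambda>u. koszul k (F u)) G w = koszul k (conv F G w)"
  by (simp add: conv_eq koszul_mult_left koszul_koszul koszul_sum add.commute)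

text \<open>The inner convolution on the right is even, so the outer one carries no sign.\<close>

lemma conv_assoc: "conv (conv F G) H w = conv0 F (conv G H) w"
proof (induction w arbitrary: F)
  case (Cons a w)
  have "conv (conv F G) H (a # w) = F [] * G [] * H (a # w) +
      koszul (fst a) (F [] * conv (\<lambda>u. G (a # u)) H w + koszul (fst a) (conv (conv (\<lambda>u. F (a # u)) G) H w))"
    by (simp add: conv_add_left conv_mult_left conv_koszul_left)
  then show ?case
    by (simp add: Cons koszul_add koszul_koszul koszul_mult_right distrib_left mult.assoc) 
      (simp add: koszul_def)
qed (simp add: mult.assoc)

text \<open>The block on which \<open>m\<close> acts lies in one half of the splitting. In the first
  half it raises the degree counted by the sign of \<open>conv\<close>, whence the minus; in the
  second, the sign for passing the first half cancels that of \<open>conv\<close>, whence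
  \<open>conv0\<close>.\<close>

lemma coder_conv:
  fixes F G :: "'v word \<Rightarrow> 'c::ring"
  shows "coder m (conv F G) w = conv0 F (coder m G) w - conv (coder m F) G w"
proof (induction w arbitrary: F)
  case (Cons a w)
  let ?w = "a # w"
  let ?m = "\<lambda>k w. (wdeg (take k w) + 1, m (take k w))"
  \<comment> \<open>The part of the coderivation in which the block starts at the first
    letter.\<close>
  define pre where "pre w = (\<Sum>k=1..length w. F (?m k w # drop k w))" for w
  have "(\<Sum>k=1..length ?w. koszul (wdeg (take k ?w)) (conv (\<lambda>u. F (?m k ?w # u)) G (drop k ?w))) =
      conv pre G ?w"
  proof -
    let ?h = "\<lambda>k p. koszul (wdeg (take p ?w)) (F (?m k ?w # take (p - k) (drop k ?w)) * G (drop p ?w))"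
    have "koszul (wdeg (take k ?w)) (conv (\<lambda>u. F (?m k ?w # u)) G (drop k ?w)) =
        (\<Sum>p\<in>{k..length ?w}. ?h k p)" if "k \<in> {1..length ?w}" for k
    proof -
      have "koszul (wdeg (take k ?w)) (conv (\<lambda>u. F (?m k ?w # u)) G (drop k ?w)) =
          (\<Sum>i\<le>length ?w - k. ?h k (k + i))"
      proof -
        have "wdeg (take (k + i) ?w) = wdeg (take k ?w) + wdeg (take i (drop k ?w))" for i
          by (simp only: take_add wdeg_simps)
        then show ?thesis
          by (simp only: conv_eq koszul_sum koszul_koszul length_drop diff_add_inverse diff_add_inverse2 drop_drop add.commute)
      qed
      also have "\<dots> = (\<Sum>p\<in>{k..length ?w}. ?h k p)"
        by (rule sum.reindex_bij_witness[of _ "\<lambda>p. p - k" "\<lambda>i. k + i"]) (use that in auto)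
      finally show ?thesis .
    qed
    then have "(\<Sum>k=1..length ?w. koszul (wdeg (take k ?w)) (conv (\<lambda>u. F (?m k ?w # u)) G (drop k ?w))) =
        (\<Sum>k=1..length ?w. \<Sum>p\<in>{k..length ?w}. ?h k p)"
      by (rule sum.cong[OF refl])
    \<comment> \<open>The block ends at \<open>k\<close> and the word is cut at some
      \<open>p\<close> not before \<open>k\<close>; regroup by \<open>p\<close>.\<close>
    also have "\<dots> = (\<Sum>(k, p)\<in>Sigma {1..length ?w} (\<lambda>k. {k..length ?w}). ?h k p)"
      by (rule sum.Sigma) auto
    also have "\<dots> = (\<Sum>(p, k)\<in>Sigma {..length ?w} (\<lambda>p. {1..p}). ?h k p)"
      by (rule sum.reindex_bij_witness[of _ "\<lambda>(p, k). (k, p)" "\<lambda>(k, p). (p, k)"]) auto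
    also have "\<dots> = (\<Sum>p\<le>length ?w. \<Sum>k=1..p. ?h k p)"
      by (rule sum.Sigma[symmetric]) auto
    also have "\<dots> = (\<Sum>p\<le>length ?w. koszul (wdeg (take p ?w)) (pre (take p ?w) * G (drop p ?w)))"
    proof (rule sum.cong[OF refl])
      fix p assume "p \<in> {..length ?w}"
      then have p: "p \<le> length ?w" by simp
      have "pre (take p ?w) = (\<Sum>k=1..p. F (?m k ?w # take (p - k) (drop k ?w)))"
        unfolding pre_def length_take min_absorb2[OF p]
        by (rule sum.cong[OF refl]) (simp only: take_take min_absorb1 atLeastAtMost_iff drop_take)
      then show "(\<Sum>k=1..p. ?h k p) = koszul (wdeg (take p ?w)) (pre (take p ?w) * G (drop p ?w))"
        by (simp only: sum_distrib_right koszul_sum)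
    qed
    finally show ?thesis by (simp only: conv_eq)
  qed
  moreover have "conv pre G ?w = koszul (fst a) (conv (\<lambda>u. pre (a # u)) G w)"
    by (simp add: pre_def)
  ultimately have pre: "(\<Sum>k=1..length ?w. koszul (wdeg (take k ?w)) (conv (\<lambda>u. F (?m k ?w # u)) G (drop k ?w))) =
      koszul (fst a) (conv (\<lambda>u. pre (a # u)) G w)" by simp
  have c: "coder m F (a # u) = pre (a # u) + koszul (fst a) (coder m (\<lambda>u. F (a # u)) u)" for u
    by (simp add: pre_def)
  have d: "coder m H ?w = (\<Sum>k=1..length ?w. H (?m k ?w # drop k ?w)) +
      koszul (fst a) (coder m (\<lambda>u. H (a # u)) w)" for H :: "_ \<Rightarrow> 'c"
    by simp
  have "(\<Sum>k=1..length ?w. conv F G (?m k ?w # drop k ?w)) =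
      F [] * (\<Sum>k=1..length ?w. G (?m k ?w # drop k ?w)) - koszul (fst a) (conv (\<lambda>u. pre (a # u)) G w)"
  proof -
    have "conv F G (?m k ?w # drop k ?w) = F [] * G (?m k ?w # drop k ?w) -
        koszul (wdeg (take k ?w)) (conv (\<lambda>u. F (?m k ?w # u)) G (drop k ?w))" for k
      unfolding conv.simps fst_conv by (simp add: koszul_def)
    then show ?thesis by (simp only: sum_subtractf sum_distrib_left pre)
  qed
  moreover have "coder m (\<lambda>u. conv F G (a # u)) w = F [] * coder m (\<lambda>u. G (a # u)) w +
      koszul (fst a) (conv0 (\<lambda>u. F (a # u)) (coder m G) w - conv (coder m (\<lambda>u. F (a # u))) G w)"
  proof -
    have "coder m (\<lambda>u. conv F G (a # u)) w = coder m (\<lambda>u. F [] * G (a # u)) w +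
        coder m (\<lambda>u. koszul (fst a) (conv (\<lambda>u. F (a # u)) G u)) w"
      by (simp add: coder_add)
    then show ?thesis
      by (simp add: coder_hom[where h = "\<lambda>x. F [] * x"] coder_hom[where h = "koszul (fst a)"]
          distrib_left koszul_add Cons)
  qed
  moreover have "conv (coder m F) G ?w = koszul (fst a) (conv (\<lambda>u. pre (a # u)) G w) +
      conv (coder m (\<lambda>u. F (a # u))) G w"
    by (simp only: conv.simps c conv_add_left conv_koszul_left koszul_add koszul_koszul coder.simps(1))
      (simp add: koszul_def)
  ultimately show ?case
    unfolding d[of "conv F G"] conv0.simps d[of G]
    by (simp add: koszul_add koszul_koszul distrib_left koszul_mult_right del: coder.simps)
      (simp add: koszul_def)
qed simp

section \<open>Signed shuffles\<close>

definition shuffle_sum :: "('v word \<Rightarrow> 'c::ab_group_add) \<Rightarrow> 'v word \<Rightarrow> 'v word \<Rightarrow> 'c" where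
  "shuffle_sum F u v = (\<Sum>(e, w) \<leftarrow> signed_shuffles u v. koszul e (F w))"

lemma koszul_sum_list: "koszul k (sum_list xs) = sum_list (map (koszul k) xs)"
  by (induction xs) (simp_all add: koszul_add)

lemma shuffle_sum_simps [simp]:
  "shuffle_sum F [] v = F v" "shuffle_sum F u [] = F u"
  "shuffle_sum F (a # u) (b # v) = shuffle_sum (\<lambda>w. F (a # w)) u (b # v) +
    koszul (fst b * wdeg (a # u)) (shuffle_sum (\<lambda>w. F (b # w)) (a # u) v)"
proof -
  show "shuffle_sum F u [] = F u" by (cases u) (simp_all add: shuffle_sum_def)
  have "shuffle_sum F (a # u) (b # v) = shuffle_sum (\<lambda>w. F (a # w)) u (b # v) +
      (\<Sum>(e, w)\<leftarrow>signed_shuffles (a # u) v. koszul (e + fst b * wdeg (a # u)) (F (b # w)))"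
    by (simp add: shuffle_sum_def comp_def case_prod_unfold)
  also have "(\<Sum>(e, w)\<leftarrow>signed_shuffles (a # u) v. koszul (e + fst b * wdeg (a # u)) (F (b # w))) =
      koszul (fst b * wdeg (a # u)) (shuffle_sum (\<lambda>w. F (b # w)) (a # u) v)"
    unfolding shuffle_sum_def koszul_sum_list map_map comp_def case_prod_unfold koszul_koszul
    by (simp add: add.commute)
  finally show "shuffle_sum F (a # u) (b # v) = shuffle_sum (\<lambda>w. F (a # w)) u (b # v) +
    koszul (fst b * wdeg (a # u)) (shuffle_sum (\<lambda>w. F (b # w)) (a # u) v)" .
qed (simp add: shuffle_sum_def)

lemma shuffle_sum_hom:
  assumes "\<And>a b. h (a + b) = h a + h b"
  shows "shuffle_sum (\<lambda>w. h (F w)) u v = h (shuffle_sum F u v)"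
proof -
  have 0: "h 0 = 0" using assms[of 0 0] by simp
  then have n: "h (- a) = - h a" for a
    using assms[of a "- a"] by (simp add: eq_neg_iff_add_eq_0 add.commute)
  have k: "h (koszul k a) = koszul k (h a)" for k a by (simp add: koszul_def n)
  show ?thesis
    by (induction u v arbitrary: F rule: signed_shuffles.induct) (simp_all add: assms k)
qed

lemma shuffle_sum_add:
  "shuffle_sum (\<lambda>w. F w + G w) u v = shuffle_sum F u v + shuffle_sum G u v"
  by (induction u v arbitrary: F G rule: signed_shuffles.induct) (simp_all add: koszul_add)

lemma shuffle_sum_cong:
  "(\<And>w. length w = length u + length v \<Longrightarrow> F w = G w) \<Longrightarrow> shuffle_sum F u v = shuffle_sum G u v"
proof (induction u v arbitrary: F G rule: signed_shuffles.induct)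
  case (3 a u b v)
  have "shuffle_sum (\<lambda>w. F (a # w)) u (b # v) = shuffle_sum (\<lambda>w. G (a # w)) u (b # v)"
    by (rule 3(1)) (simp add: "3.prems")
  moreover have "shuffle_sum (\<lambda>w. F (b # w)) (a # u) v = shuffle_sum (\<lambda>w. G (b # w)) (a # u) v"
    by (rule 3(2)) (simp add: "3.prems")
  ultimately show ?case by simp
qed simp_all

text \<open>Deconcatenation is compatible with shuffling: cutting a shuffle of \<open>u\<close> and
  \<open>v\<close> cuts both words. The sign consists of that of \<open>conv\<close> for the two
  prefixes and that of \<open>take j v\<close> passing \<open>drop i u\<close>.\<close>

lemma shuffle_sum_conv:
  fixes F G :: "'v word \<Rightarrow> 'c::ring"
  shows "shuffle_sum (conv F G) u v = (\<Sum>i\<le>length u. \<Sum>j\<le>length v.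
    koszul (wdeg (take i u) + wdeg (take j v) + wdeg (drop i u) * wdeg (take j v))
      (shuffle_sum F (take i u) (take j v) * shuffle_sum G (drop i u) (drop j v)))"
proof (induction u v arbitrary: F rule: signed_shuffles.induct)
  case (1 v)
  then show ?case by (simp add: conv_eq)
next
  case (2 a u)
  then show ?case by (simp only: shuffle_sum_simps conv_eq) (simp add: koszul_def)
next
  case (3 a u b v)
  let ?t = "\<lambda>F u v i j. koszul (wdeg (take i u) + wdeg (take j v) + wdeg (drop i u) * wdeg (take j v))
      (shuffle_sum F (take i u) (take j v) * shuffle_sum G (drop i u) (drop j v))"
  let ?F = "\<lambda>a w. F (a # w)"
  have conv: "shuffle_sum (\<lambda>w. conv F G (c # w)) u v =
      F [] * shuffle_sum (\<lambda>w. G (c # w)) u v + koszul (fst c) (shuffle_sum (conv (?F c) G) u v)" for c u v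
    by (simp add: shuffle_sum_add shuffle_sum_hom[where h = "\<lambda>x. F [] * x"]
        shuffle_sum_hom[where h = "koszul (fst c)"] distrib_left koszul_add)
  \<comment> \<open>A nonempty first part starts with \<open>a\<close> or with \<open>b\<close>,
    which splits each summand by its first letter.\<close>
  have split: "?t F (a # u) (b # v) i j =
      (if i = 0 \<and> j = 0 then F [] * shuffle_sum G (a # u) (b # v) else 0) +
      (if i = 0 then 0 else koszul (fst a) (?t (?F a) u (b # v) (i - 1) j)) +
      (if j = 0 then 0 else koszul (fst b * wdeg (a # u) + fst b) (?t (?F b) (a # u) v i (j - 1)))"
    if "i \<le> length (a # u)" for i j
  proof -
    have k: "koszul x y = koszul x' y" if "x = x'" for x x' and y :: 'c using that by simp
    show ?thesis
    proof (cases i)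
      case 0
      then show ?thesis by (cases j) (auto simp: koszul_koszul algebra_simps intro!: k)
    next
      case (Suc i')
      have wu: "wdeg u = wdeg (take i' u) + wdeg (drop i' u)" by (metis append_take_drop_id wdeg_simps(3))
      show ?thesis
      proof (cases j)
        case 0
        then show ?thesis using Suc by (simp add: koszul_koszul add.assoc)
      next
        case (Suc j')
        then show ?thesis using \<open>i = Suc i'\<close>
          by (simp add: distrib_right koszul_add koszul_mult_left koszul_koszul)
            (simp add: wu algebra_simps)
      qed
    qed
  qed
  have "(\<Sum>i\<le>length (a # u). \<Sum>j\<le>length (b # v). ?t F (a # u) (b # v) i j) =
      (\<Sum>i\<le>length (a # u). \<Sum>j\<le>length (b # v).
        (if i = 0 \<and> j = 0 then F [] * shuffle_sum G (a # u) (b # v) else 0)) +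
      (\<Sum>i\<le>length (a # u). \<Sum>j\<le>length (b # v).
        (if i = 0 then 0 else koszul (fst a) (?t (?F a) u (b # v) (i - 1) j))) +
      (\<Sum>i\<le>length (a # u). \<Sum>j\<le>length (b # v).
        (if j = 0 then 0 else koszul (fst b * wdeg (a # u) + fst b) (?t (?F b) (a # u) v i (j - 1))))"
    unfolding sum.distrib[symmetric] by (intro sum.cong refl split) simp
  also have "(\<Sum>i\<le>length (a # u). \<Sum>j\<le>length (b # v).
        (if i = 0 \<and> j = 0 then F [] * shuffle_sum G (a # u) (b # v) else 0)) =
      F [] * shuffle_sum G (a # u) (b # v)"
  proof -
    have "(\<Sum>j\<le>k. if i = 0 \<and> j = 0 then x else 0) = (if i = 0 then x else 0)" for i k :: nat and x :: 'c
      by (cases "i = 0") simp_all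
    then show ?thesis by (simp only: sum.delta finite_atMost atMost_iff zero_le if_True)
  qed
  also have "(\<Sum>i\<le>length (a # u). \<Sum>j\<le>length (b # v).
        (if i = 0 then 0 else koszul (fst a) (?t (?F a) u (b # v) (i - 1) j))) =
      koszul (fst a) (shuffle_sum (conv (?F a) G) u (b # v))"
    unfolding 3(1) koszul_sum length_Cons
    by (subst sum.atMost_Suc_shift) simp
  also have "(\<Sum>i\<le>length (a # u). \<Sum>j\<le>length (b # v).
        (if j = 0 then 0 else koszul (fst b * wdeg (a # u) + fst b) (?t (?F b) (a # u) v i (j - 1)))) =
      koszul (fst b * wdeg (a # u) + fst b) (shuffle_sum (conv (?F b) G) (a # u) v)"
    unfolding 3(2) koszul_sum length_Cons[of b v]
    by (rule sum.cong[OF refl], subst sum.atMost_Suc_shift) simp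
  finally show ?case
    unfolding shuffle_sum_simps(3)[of "conv F G"] conv shuffle_sum_simps(3)[of G]
    by (simp add: koszul_add koszul_koszul distrib_left koszul_mult_right add.assoc
        del: shuffle_sum_simps wdeg_simps) 
qed

subsection \<open>The transferred operations\<close>

text \<open>The components of an \<open>A\<^sub>\<infinity>\<close>-morphism from cochains to forms
  that starts with the Whitney map. In the sign, \<open>wdeg + 1\<close> is the unshifted degree of
  the left factor.\<close>

function transfer_p :: "nat \<Rightarrow> (nat list \<Rightarrow> 'k::field_char_0) word \<Rightarrow> 'k form" where
  "transfer_p n w =
    (if w = [] then 0 else if length w = 1 then to_forms n (snd (hd w))
     else htpy n (\<Sum>i\<in>{1..<length w}. koszul (wdeg (take i w) + 1)
       (transfer_p n (take i w) * transfer_p n (drop i w))))"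
  by auto
termination by (relation "measure (\<lambda>(n, w). length w)") auto

declare transfer_p.simps [simp del]

text \<open>\<open>transfer_p\<close> and \<open>transfer_m\<close> put different operators at the
  root of this same sum.\<close>

definition transfer_q :: "nat \<Rightarrow> (nat list \<Rightarrow> 'k::field_char_0) word \<Rightarrow> 'k form" where
  "transfer_q n w = (\<Sum>i\<in>{1..<length w}. koszul (wdeg (take i w) + 1)
     (transfer_p n (take i w) * transfer_p n (drop i w)))"

definition transfer_m :: "nat \<Rightarrow> (nat list \<Rightarrow> 'k::field_char_0) word \<Rightarrow> nat list \<Rightarrow> 'k" where
  "transfer_m n w = (if length w = 1 then coboundary n (snd (hd w)) else from_forms n (transfer_q n w))"

abbreviation cochains :: "nat \<Rightarrow> int \<Rightarrow> (nat list \<Rightarrow> 'k::zero) set" where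
  "cochains n \<equiv> shift (N n)"

lemma transfer_p_Nil [simp]: "transfer_p n [] = 0"
  and transfer_p_single [simp]: "transfer_p n [a] = to_forms n (snd a)"
  by (simp_all add: transfer_p.simps)

lemma transfer_q_short [simp]: "length w \<le> 1 \<Longrightarrow> transfer_q n w = 0"
  by (simp add: transfer_q_def)

lemma transfer_p_eq:
  "transfer_p n w = htpy n (transfer_q n w) + (if length w = 1 then to_forms n (snd (hd w)) else 0)"
proof (cases "length w \<le> 1")
  case True
  then show ?thesis by (cases w) auto
next
  case False
  then show ?thesis by (auto simp: transfer_p.simps[of n w] transfer_q_def)
qed

lemma transfer_m_eq:
  "transfer_m n w = from_forms n (transfer_q n w) + (if length w = 1 then coboundary n (snd (hd w)) else 0)"
  by (simp add: transfer_m_def)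

lemma transfer_q_conv: "transfer_q n w = - conv (transfer_p n) (transfer_p n) w"
proof -
  have "conv (transfer_p n) (transfer_p n) w =
      (\<Sum>i\<in>{1..<length w}. koszul (wdeg (take i w)) (transfer_p n (take i w) * transfer_p n (drop i w)))"
    unfolding conv_eq
  proof (rule sum.mono_neutral_right)
    show "\<forall>i\<in>{..length w} - {1..<length w}.
        koszul (wdeg (take i w)) (transfer_p n (take i w) * transfer_p n (drop i w)) = 0"
    proof
      fix i assume "i \<in> {..length w} - {1..<length w}"
      then have "i = 0 \<or> i = length w" by auto
      then show "koszul (wdeg (take i w)) (transfer_p n (take i w) * transfer_p n (drop i w)) = 0" by auto
    qed
  qed auto
  then show ?thesis
    unfolding transfer_q_def sum_negf[symmetric]
    by (simp only: sum_negf[symmetric]) (rule sum.cong[OF refl], simp add: koszul_def)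
qed

lemma mem_cochains: "x \<in> cochains n k \<longleftrightarrow> x \<in> N n (k + 1)"
  by (simp add: shift_def)

section \<open>Degrees of the transferred maps, and the relations between them\<close>

lemma homog_transfer_p: "w \<in> words (cochains n) \<Longrightarrow> homog (wdeg w + 1) (transfer_p n w)"
  and homog_transfer_q: "w \<in> words (cochains n) \<Longrightarrow> homog (wdeg w + 2) (transfer_q n w)"
proof -
  have "homog (wdeg w + 1) (transfer_p n w) \<and> homog (wdeg w + 2) (transfer_q n w)"
    if "w \<in> words (cochains n)" for w :: "(nat list \<Rightarrow> 'a) word"
    using that
  proof (induction "length w" arbitrary: w rule: less_induct)
    case less
    have q: "homog (wdeg w + 2) (transfer_q n w)"
      unfolding transfer_q_def
    proof (intro homog_sum homog_koszul)
      fix i assume i: "i \<in> {1..<length w}"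
      have "homog (wdeg (take i w) + 1) (transfer_p n (take i w))"
        "homog (wdeg (drop i w) + 1) (transfer_p n (drop i w))"
        using i less.hyps[of "take i w"] less.hyps[of "drop i w"] less.prems
        by (auto simp: words_take words_drop)
      from homog_mult[OF this]
      show "homog (wdeg w + 2) (transfer_p n (take i w) * transfer_p n (drop i w))"
        by (metis (no_types, opaque_lifting) add.assoc add.left_commute append_take_drop_id one_add_one wdeg_simps(3))
    qed
    from homog_htpy[OF q, of n] have "homog (wdeg w + 1) (htpy n (transfer_q n w))"
      by (simp add: add.commute)
    moreover have "homog (wdeg w + 1) (if length w = 1 then to_forms n (snd (hd w)) else 0)"
      using less.prems by (cases w) (auto intro: homog_0 homog_to_forms simp: mem_cochains)
    ultimately have "homog (wdeg w + 1) (transfer_p n w)"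
      unfolding transfer_p_eq by (rule homog_add)
    with q show ?case by blast
  qed
  then show "w \<in> words (cochains n) \<Longrightarrow> homog (wdeg w + 1) (transfer_p n w)"
    "w \<in> words (cochains n) \<Longrightarrow> homog (wdeg w + 2) (transfer_q n w)" by blast+
qed

lemma transfer_m_cochain:
  assumes "w \<in> words (cochains n)" "w \<noteq> []"
  shows "transfer_m n w \<in> cochains n (wdeg w + 1)"
proof (cases "length w = 1")
  case True
  then obtain k x where "w = [(k, x)]" by (cases w) auto
  then show ?thesis
    using assms(1) coboundary_N[of x n "k + 1"] by (simp add: transfer_m_def mem_cochains add.assoc)
next
  case False
  then show ?thesis
    using from_forms_N[OF homog_transfer_q[OF assms(1)], of n]
    by (simp add: transfer_m_def mem_cochains add.assoc)
qed

lemma par_transfer_p: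
  "w \<in> words (cochains n) \<Longrightarrow> par (transfer_p n w) = koszul (wdeg w + 1) (transfer_p n w)"
  by (rule homog_par[OF homog_transfer_p])

text \<open>A function supported on one-letter words sees only the operation applied to the whole
  word.\<close>

lemma coder_length_1:
  fixes F :: "int \<times> 'v \<Rightarrow> 'c::ab_group_add"
  assumes "w \<noteq> []"
  shows "coder m (\<lambda>u. if length u = 1 then F (hd u) else 0) w = F (wdeg w + 1, m w)"
proof -
  obtain a v where w: "w = a # v" using assms by (cases w) auto
  have "coder m (\<lambda>u. if length (a # u) = 1 then F (hd (a # u)) else 0) v = 0"
    by (rule coder_zero) simp
  moreover have "(\<Sum>k=1..Suc (length v). if length (drop k (a # v)) = 0
      then F (wdeg (take k (a # v)) + 1, m (take k (a # v))) else 0) =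
      (\<Sum>k\<in>{Suc (length v)}. F (wdeg (take k (a # v)) + 1, m (take k (a # v))))"
    by (rule sum.mono_neutral_cong_right) auto
  ultimately show ?thesis by (simp add: w del: sum.cl_ivl_Suc cong: if_cong)
qed

lemma coder_transfer_p:
  assumes "w \<noteq> []"
  shows "coder m (transfer_p n) w = htpy n (coder m (transfer_q n) w) + to_forms n (m w)"
proof -
  have "coder m (transfer_p n) w = coder m (\<lambda>w. htpy n (transfer_q n w) +
      (if length w = 1 then to_forms n (snd (hd w)) else 0)) w"
    by (rule coder_cong) (rule transfer_p_eq)
  then show ?thesis
    unfolding coder_add coder_length_1[OF assms, where F = "\<lambda>l. to_forms n (snd l)"]
    by (simp add: coder_hom htpy_add)
qed

lemma coder_transfer_m:
  assumes "w \<noteq> []"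
  shows "coder m (transfer_m n) w = from_forms n (coder m (transfer_q n) w) + coboundary n (m w)"
proof -
  have "coder m (transfer_m n) w = coder m (\<lambda>w. from_forms n (transfer_q n w) +
      (if length w = 1 then coboundary n (snd (hd w)) else 0)) w"
    by (rule coder_cong) (rule transfer_m_eq)
  then show ?thesis
    unfolding coder_add coder_length_1[OF assms, where F = "\<lambda>l. coboundary n (snd l)"]
    by (simp add: coder_hom from_forms_add)
qed

lemma conv0_diff_right: "conv0 F (\<lambda>u. G u - H u) w = conv0 F G w - conv0 F H w"
  by (simp add: conv0_eq right_diff_distrib sum_subtractf)

lemma conv_diff_left: "conv (\<lambda>u. G u - H u) F w = conv G F w - conv H F w"
  by (simp add: conv_eq left_diff_distrib koszul_diff sum_subtractf)

lemma conv_minus_left: "conv (\<lambda>u. - G u) F w = - conv G F w"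
  by (simp add: conv_eq koszul_minus sum_negf)

lemma conv0_minus_right: "conv0 F (\<lambda>u. - G u) w = - conv0 F G w"
  by (simp add: conv0_eq sum_negf)

text \<open>The Leibniz rule and \<open>coder_conv\<close>. The assumption on shorter words
  suffices: in a splitting with a half of full length the other half is empty, and the term is
  0.\<close>

lemma transfer_q_ext_d_step:
  fixes w :: "(nat list \<Rightarrow> 'a::field_char_0) word"
  assumes w: "w \<in> words (cochains n)"
    and p: "\<And>u. u \<in> words (cochains n) \<Longrightarrow> length u < length w \<Longrightarrow>
      ext_d (transfer_p n u) = coder m (transfer_p n) u - transfer_q n u"
  shows "ext_d (transfer_q n w) = - coder m (transfer_q n) w"
proof -
  let ?p = "transfer_p n :: (nat list \<Rightarrow> 'a) word \<Rightarrow> 'a form"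
  let ?dp = "\<lambda>u. coder m ?p u - transfer_q n u"
  have "ext_d (koszul (wdeg (take i w)) (?p (take i w) * ?p (drop i w))) =
      koszul (wdeg (take i w)) (?dp (take i w) * ?p (drop i w)) - ?p (take i w) * ?dp (drop i w)"
    if i: "i \<le> length w" for i
  proof -
    have tw: "take i w \<in> words (cochains n)" "drop i w \<in> words (cochains n)"
      using w by (auto intro: words_take words_drop)
    have "ext_d (?p (take i w)) * ?p (drop i w) = ?dp (take i w) * ?p (drop i w)"
      using p[OF tw(1)] i by (cases "i = length w") auto
    moreover have "?p (take i w) * ext_d (?p (drop i w)) = ?p (take i w) * ?dp (drop i w)"
      using p[OF tw(2)] i by (cases "i = 0") auto
    moreover have "ext_d (koszul k a) = koszul k (ext_d a)" for k and a :: "'a form"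
      by (simp add: koszul_def)
    ultimately show ?thesis
      using par_transfer_p[OF tw(1)] by (simp add: koszul_mult_left koszul_add koszul_koszul)
        (simp add: koszul_def)
  qed
  then have "ext_d (conv ?p ?p w) = conv ?dp ?p w - conv0 ?p ?dp w"
    unfolding conv_eq conv0_eq ext_d_sum sum_subtractf[symmetric] by (intro sum.cong refl) auto
  also have "\<dots> = - coder m (conv ?p ?p) w + (conv0 ?p (transfer_q n) w - conv (transfer_q n) ?p w)"
    by (simp add: coder_conv conv_diff_left conv0_diff_right)
  \<comment> \<open>Associativity of the product of forms: both sides are sums over the splittings
    into three parts.\<close>
  also have "conv0 ?p (transfer_q n) w = conv (transfer_q n) ?p w"
    unfolding transfer_q_conv[abs_def] conv0_minus_right conv_minus_left conv_assoc ..
  also have "- coder m (conv ?p ?p) w = coder m (transfer_q n) w"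
    unfolding transfer_q_conv[abs_def] coder_minus ..
  finally show ?thesis
    by (simp add: transfer_q_conv[of n w])
qed

text \<open>The equation of an \<open>A\<^sub>\<infinity>\<close>-morphism. On longer words the
  homotopy identity produces the projection, which is the term of \<open>transfer_m\<close> on the
  whole word, then \<open>- transfer_q\<close>, and \<open>htpy\<close> of a derivative known from
  the induction.\<close>

lemma ext_d_transfer_p:
  "w \<in> words (cochains n) \<Longrightarrow>
    ext_d (transfer_p n w) = coder (transfer_m n) (transfer_p n) w - transfer_q n w"
proof (induction "length w" arbitrary: w rule: less_induct)
  case less
  have q: "ext_d (transfer_q n w) = - coder (transfer_m n) (transfer_q n) w"
    by (rule transfer_q_ext_d_step[OF less.prems less.hyps])
  show ?case
  proof (cases "length w \<le> 1")
    case True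
    show ?thesis
    proof (cases w)
      case (Cons a v)
      then obtain k x where w: "w = [(k, x)]" using True by (cases a) auto
      then have "x [] = 0" using less.prems by (auto simp: mem_cochains N_def)
      then show ?thesis by (simp add: w transfer_m_def to_forms_coboundary)
    qed simp
  next
    case False
    then have w: "w \<noteq> []" "length w \<noteq> 1" by auto
    have "ext_d (transfer_p n w) = ext_d (htpy n (transfer_q n w))"
      using w by (simp add: transfer_p_eq)
    also have "\<dots> = proj n (transfer_q n w) - transfer_q n w - htpy n (ext_d (transfer_q n w))"
      using htpy_homotopy[of n "transfer_q n w"] by (simp add: algebra_simps)
    also have "\<dots> = coder (transfer_m n) (transfer_p n) w - transfer_q n w"
      using w by (simp add: q coder_transfer_p htpy_minus transfer_m_def proj_def)
    finally show ?thesis .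
  qed
qed

text \<open>\<open>from_forms\<close> is applied to the formula for the derivative of
  \<open>transfer_q\<close>. The operation on the whole word adds a coboundary, which cancels the
  result by Stokes' theorem.\<close>

theorem coder_transfer_m_zero:
  assumes w: "w \<in> words (cochains n)"
  shows "coder (transfer_m n) (transfer_m n) w = 0"
proof (cases "w = []")
  case False
  have q: "ext_d (transfer_q n w) = - coder (transfer_m n) (transfer_q n) w"
    by (rule transfer_q_ext_d_step[OF w ext_d_transfer_p])
  have "coder (transfer_m n) (transfer_m n) w =
      coboundary n (transfer_m n w) - from_forms n (ext_d (transfer_q n w))"
    using False by (simp add: coder_transfer_m q from_forms_uminus)
  also have "\<dots> = 0"
  proof (cases "length w = 1")
    case True
    then obtain k x where "w = [(k, x)]" by (cases w) auto
    then show ?thesis using w coboundary_coboundary[of x n "k + 1"]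
      by (simp add: transfer_m_def mem_cochains)
  qed (simp add: transfer_m_def from_forms_ext_d)
  finally show ?thesis .
qed simp

text \<open>A splitting that does not separate \<open>u\<close> from \<open>v\<close> has an empty
  half or contains a shuffle of shorter nonempty words, which vanishes by induction. The two that do
  separate them carry the same product in opposite orders.\<close>

lemma shuffle_transfer_q:
  fixes u v :: "(nat list \<Rightarrow> 'a::field_char_0) word"
  assumes "u \<in> words (cochains n)" "v \<in> words (cochains n)" "u \<noteq> []" "v \<noteq> []"
  shows "shuffle_sum (transfer_q n) u v = 0"
  using assms
proof (induction "length u + length v" arbitrary: u v rule: less_induct)
  case less
  let ?p = "transfer_p n :: (nat list \<Rightarrow> 'a) word \<Rightarrow> 'a form"
  have p: "shuffle_sum ?p u' v' = 0"
    if "length u' + length v' < length u + length v" "u' \<in> words (cochains n)" "v' \<in> words (cochains n)"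
      "u' \<noteq> []" "v' \<noteq> []" for u' v'
  proof -
    have "shuffle_sum ?p u' v' = shuffle_sum (\<lambda>w. htpy n (transfer_q n w)) u' v'"
    proof (rule shuffle_sum_cong)
      fix w :: "(nat list \<Rightarrow> 'a) word" assume "length w = length u' + length v'"
      then have "length w \<noteq> 1" using that by (cases u'; cases v') auto
      then show "?p w = htpy n (transfer_q n w)" by (simp add: transfer_p_eq)
    qed
    then show ?thesis using less.hyps[OF that] by (simp add: shuffle_sum_hom htpy_add)
  qed
  let ?s = "\<lambda>i j. koszul (wdeg (take i u) + wdeg (take j v) + wdeg (drop i u) * wdeg (take j v))
      (shuffle_sum ?p (take i u) (take j v) * shuffle_sum ?p (drop i u) (drop j v))"
  have zero: "?s i j = 0" if ij: "i \<le> length u" "j \<le> length v" "(i, j) \<noteq> (length u, 0)" "(i, j) \<noteq> (0, length v)" for i j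
  proof -
    have "shuffle_sum ?p (take i u) (take j v) = 0 \<or> shuffle_sum ?p (drop i u) (drop j v) = 0"
    proof (cases "i = 0 \<or> j = 0")
      case True
      show ?thesis
      proof (cases "i = 0 \<and> j = 0")
        case False
        then have "shuffle_sum ?p (drop i u) (drop j v) = 0"
          using True ij less.prems by (intro p) (auto intro: words_drop)
        then show ?thesis ..
      qed simp
    next
      case False
      show ?thesis
      proof (cases "i = length u \<and> j = length v")
        case False
        then have "shuffle_sum ?p (take i u) (take j v) = 0"
          using \<open>\<not> (i = 0 \<or> j = 0)\<close> ij less.prems by (intro p) (auto intro: words_take)
        then show ?thesis ..
      qed simp
    qed
    then show ?thesis by auto
  qed
  have "shuffle_sum (conv ?p ?p) u v = (\<Sum>i\<le>length u. \<Sum>j\<le>length v. ?s i j)"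
    by (rule shuffle_sum_conv)
  also have "\<dots> = (\<Sum>(i, j)\<in>{..length u} \<times> {..length v}. ?s i j)"
    by (rule sum.cartesian_product)
  also have "\<dots> = (\<Sum>(i, j)\<in>{(length u, 0), (0, length v)}. ?s i j)"
  proof (rule sum.mono_neutral_right)
    show "\<forall>p\<in>{..length u} \<times> {..length v} - {(length u, 0), (0, length v)}. (case p of (i, j) \<Rightarrow> ?s i j) = 0"
    proof
      fix p assume p: "p \<in> {..length u} \<times> {..length v} - {(length u, 0), (0, length v)}"
      obtain i j where "p = (i, j)" by (cases p)
      with p show "(case p of (i, j) \<Rightarrow> ?s i j) = 0" using zero[of i j] by simp
    qed
  qed auto
  also have "\<dots> = koszul (wdeg u) (?p u * ?p v) + koszul (wdeg v + wdeg u * wdeg v) (?p v * ?p u)"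
    using less.prems by simp
  \<comment> \<open>The forms have the unshifted degrees; this shift makes the sign opposite to that
    of the other splitting.\<close>
  also have "?p u * ?p v = koszul ((wdeg u + 1) * (wdeg v + 1)) (?p v * ?p u)"
    by (rule homog_commute) (use less.prems in \<open>auto intro: homog_transfer_p\<close>)
  also have "koszul (wdeg u) \<dots> + koszul (wdeg v + wdeg u * wdeg v) (?p v * ?p u) = 0"
    by (simp add: koszul_def)
  finally show ?case
    using shuffle_sum_hom[of uminus "conv ?p ?p" u v] by (simp add: transfer_q_conv[abs_def])
qed

theorem shuffle_transfer_m:
  fixes u v :: "(nat list \<Rightarrow> 'a::field_char_0) word"
  assumes "u \<in> words (cochains n)" "v \<in> words (cochains n)" "u \<noteq> []" "v \<noteq> []"
  shows "shuffle_sum (transfer_m n) u v = 0"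
proof -
  have "shuffle_sum (transfer_m n) u v = shuffle_sum (\<lambda>w. from_forms n (transfer_q n w)) u v"
  proof (rule shuffle_sum_cong)
    fix w :: "(nat list \<Rightarrow> 'a) word" assume "length w = length u + length v"
    then have "length w \<noteq> 1" using assms by (cases u; cases v) auto
    then show "transfer_m n w = from_forms n (transfer_q n w)" by (simp add: transfer_m_def)
  qed
  then show ?thesis using shuffle_transfer_q[OF assms] by (simp add: shuffle_sum_hom from_forms_add)
qed

section \<open>Linearity, identity and naturality of the transfer\<close>

lemma transfer_linear_aux:
  fixes u v :: "(nat list \<Rightarrow> 'a::field_char_0) word" and c :: 'a
  shows "transfer_p n (u @ (k, pointwise (*) c x + y) # v) =
      cst c * transfer_p n (u @ (k, x) # v) + transfer_p n (u @ (k, y) # v) \<and>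
    transfer_q n (u @ (k, pointwise (*) c x + y) # v) =
      cst c * transfer_q n (u @ (k, x) # v) + transfer_q n (u @ (k, y) # v)"
proof (induction "length u + length v" arbitrary: u v rule: less_induct)
  case less
  let ?w = "\<lambda>z. u @ (k, z) # v" and ?z = "pointwise (*) c x + y"
  let ?p = "transfer_p n :: (nat list \<Rightarrow> 'a) word \<Rightarrow> 'a form"
  let ?t = "\<lambda>w i. koszul (wdeg (take i w) + 1) (?p (take i w) * ?p (drop i w))"
  have t: "?t (?w ?z) i = cst c * ?t (?w x) i + ?t (?w y) i" if i: "1 \<le> i" "i < Suc (length u + length v)" for i
  proof (cases "i \<le> length u")
    case True
    then have "?p (drop i u @ (k, ?z) # v) = cst c * ?p (drop i u @ (k, x) # v) + ?p (drop i u @ (k, y) # v)"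
      using i less.hyps[of "drop i u" v] by auto
    then show ?thesis
      using True by (simp add: distrib_left koszul_add cst_left_commute koszul_mult_right)
  next
    case False
    then obtain l where l: "i = Suc (length u + l)" by (metis less_iff_Suc_add not_le add_Suc_right)
    then have "?p (u @ (k, ?z) # take l v) = cst c * ?p (u @ (k, x) # take l v) + ?p (u @ (k, y) # take l v)"
      using i less.hyps[of u "take l v"] by auto
    then show ?thesis
      using l by (simp add: distrib_right koszul_add mult.assoc koszul_mult_right)
  qed
  have len: "length (?w z) = Suc (length u + length v)" for z :: "nat list \<Rightarrow> 'a" by simp
  have q: "transfer_q n (?w ?z) = cst c * transfer_q n (?w x) + transfer_q n (?w y)"
    unfolding transfer_q_def len sum_distrib_left sum.distrib[symmetric]
    by (rule sum.cong[OF refl t]) auto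
  moreover have "(if length (?w ?z) = 1 then to_forms n (snd (hd (?w ?z))) else 0) =
      cst c * (if length (?w x) = 1 then to_forms n (snd (hd (?w x))) else 0) +
      (if length (?w y) = 1 then to_forms n (snd (hd (?w y))) else 0)"
    by (auto simp: to_forms_add to_forms_scale)
  ultimately have "?p (?w ?z) = cst c * ?p (?w x) + ?p (?w y)"
    unfolding transfer_p_eq by (simp add: htpy_add htpy_cst_mult distrib_left)
  with q show ?case by blast
qed

lemma transfer_m_linear:
  fixes c :: "'a::field_char_0"
  shows "transfer_m n (u @ (k, pointwise (*) c x + y) # v) =
      pointwise (*) c (transfer_m n (u @ (k, x) # v)) + transfer_m n (u @ (k, y) # v)"
proof -
  have "coboundary n (pointwise (*) c x + y) = pointwise (*) c (coboundary n x) + coboundary n y"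
    by (auto simp: fun_eq_iff coboundary_def pointwise_def koszul_add koszul_mult_right
        sum.distrib sum_distrib_left)
  moreover have "pointwise (*) c 0 = (0 :: 'i \<Rightarrow> 'a)" by (auto simp: pointwise_def)
  moreover have "pointwise (*) c (a + b) = pointwise (*) c a + pointwise (*) c b" for a b :: "nat list \<Rightarrow> 'a"
    by (auto simp: pointwise_def distrib_left)
  ultimately show ?thesis
    using transfer_linear_aux[of n u k c x y v]
    by (auto simp: transfer_m_eq from_forms_add from_forms_cst_mult)
qed

text \<open>A factor of length at least 2 that contains the unit is 0 by induction. Hence only
  splittings that isolate the unit survive, and its Whitney form is 1.\<close>

lemma transfer_q_unit:
  fixes u v :: "(nat list \<Rightarrow> 'a::field_char_0) word"
  assumes "length u + length v \<ge> 1"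
  shows "transfer_q n (u @ (- 1, unit_cochain n) # v) =
    (if v = [] then koszul (wdeg u + 1) (transfer_p n u) else if u = [] then transfer_p n v else 0) \<and>
    transfer_p n (u @ (- 1, unit_cochain n) # v) = 0"
  using assms
proof (induction "length u + length v" arbitrary: u v rule: less_induct)
  case less
  let ?e = "(- 1, unit_cochain n) :: int \<times> (nat list \<Rightarrow> 'a)"
  let ?p = "transfer_p n :: (nat list \<Rightarrow> 'a) word \<Rightarrow> 'a form"
  let ?w = "u @ ?e # v"
  let ?t = "\<lambda>i. koszul (wdeg (take i ?w) + 1) (?p (take i ?w) * ?p (drop i ?w))"
  have t: "?t i = (if i = length u \<and> v = [] then koszul (wdeg u + 1) (?p u) else 0) +
      (if i = 1 \<and> u = [] then ?p v else 0)" if i: "i \<in> {1..<length ?w}" for i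
  proof (cases "i \<le> length u")
    case True
    show ?thesis
    proof (cases "i = length u \<and> v = []")
      case True
      then show ?thesis using i by (auto simp: to_forms_unit)
    next
      case False
      then have "?p (drop i u @ ?e # v) = 0"
        using True i less.hyps[of "drop i u" v] by (cases v) auto
      then show ?thesis using True False i by auto
    qed
  next
    case False
    then obtain l where l: "i = Suc (length u + l)" by (metis less_iff_Suc_add not_le add_Suc_right)
    show ?thesis
    proof (cases "u = [] \<and> l = 0")
      case True
      then show ?thesis using l i by (auto simp: to_forms_unit)
    next
      case False
      then have "?p (u @ ?e # take l v) = 0"
        using l i less.hyps[of u "take l v"] by (cases u) auto
      then show ?thesis using l False by auto
    qed
  qed
  have "transfer_q n ?w = (\<Sum>i\<in>{1..<length ?w}.
      (if i = length u \<and> v = [] then koszul (wdeg u + 1) (?p u) else 0) +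
      (if i = 1 \<and> u = [] then ?p v else 0))"
    unfolding transfer_q_def by (rule sum.cong[OF refl t])
  also have "\<dots> = (\<Sum>i\<in>{1..<length ?w}. if i = length u then (if v = [] then koszul (wdeg u + 1) (?p u) else 0) else 0) +
      (\<Sum>i\<in>{1..<length ?w}. if i = 1 then (if u = [] then ?p v else 0) else 0)"
    unfolding sum.distrib by (intro arg_cong2[of _ _ _ _ "(+)"] sum.cong refl) auto
  also have "\<dots> = (if v = [] then koszul (wdeg u + 1) (?p u) else if u = [] then ?p v else 0)"
    using less.prems by (cases u; cases v) (auto simp: sum.delta, metis Suc_lessI length_greater_0_conv)
  finally have q: "transfer_q n ?w =
      (if v = [] then koszul (wdeg u + 1) (?p u) else if u = [] then ?p v else 0)" .
  have k: "htpy n (koszul k a) = koszul k (htpy n a)" for k and a :: "'a form"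
    by (simp add: koszul_def htpy_minus)
  \<comment> \<open>Two side conditions enter: \<open>htpy\<close> kills its own image and the
    Whitney forms.\<close>
  have "htpy n (?p w) = 0" for w
    by (simp add: transfer_p_eq htpy_add)
  then have "?p ?w = 0"
    using less.prems by (auto simp: transfer_p_eq[of n ?w] q k)
  with q show ?case by blast
qed

text \<open>What \<open>transfer_q_unit\<close> leaves is \<open>transfer_p\<close> on at least two
  letters. It lies in the image of \<open>htpy\<close>, which \<open>from_forms\<close>
  kills.\<close>

lemma transfer_m_unit:
  assumes "length u + length v \<ge> 2"
  shows "transfer_m n (u @ (- 1, unit_cochain n) # v) = 0"
proof -
  have k: "from_forms n (koszul k a) = koszul k (from_forms n a)" for k and a :: "'a form"
    by (simp add: koszul_def from_forms_uminus)
  have "from_forms n (transfer_p n w) = 0" if "length w \<noteq> 1" for w :: "(nat list \<Rightarrow> 'a) word"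
    using that by (simp add: transfer_p_eq)
  then show ?thesis
    using assms transfer_q_unit[of u v n] by (auto simp: transfer_m_def k)
qed

lemma transfer_m_unit_left:
  "x \<in> N n q \<Longrightarrow> transfer_m n [(- 1, unit_cochain n), (k, x)] = x"
  using transfer_q_unit[of "[]" "[(k, x)]" n] by (simp add: transfer_m_def from_to_N)

lemma transfer_m_unit_right:
  assumes "x \<in> N n q"
  shows "transfer_m n [(k, x), (- 1, unit_cochain n)] = koszul (k + 1) x"
proof -
  have "from_forms n (koszul k a) = koszul k (from_forms n a)" for k and a :: "'a form"
    by (simp add: koszul_def from_forms_uminus)
  then show ?thesis
    using transfer_q_unit[of "[(k, x)]" "[]" n] assms by (simp add: transfer_m_def from_to_N)
qed

lemma wdeg_map: "wdeg (map (\<lambda>(k, x). (k, f k x)) w) = wdeg w"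
  by (induction w) auto

lemma transfer_pullback:
  fixes w :: "(nat list \<Rightarrow> 'a::field_char_0) word"
  assumes \<theta>: "\<theta> \<in> Delta m n" and w: "w \<in> words (cochains n)"
  shows "transfer_p m (map (\<lambda>(k, x). (k, pullback m \<theta> x)) w) = form_pullback m \<theta> (transfer_p n w) \<and>
    transfer_q m (map (\<lambda>(k, x). (k, pullback m \<theta> x)) w) = form_pullback m \<theta> (transfer_q n w)"
  using w
proof (induction "length w" arbitrary: w rule: less_induct)
  case less
  let ?m = "map (\<lambda>(k, x). (k, pullback m \<theta> x)) :: (nat list \<Rightarrow> 'a) word \<Rightarrow> _"
  have k: "form_pullback m \<theta> (koszul k a) = koszul k (form_pullback m \<theta> a)" for k and a :: "'a form"
    by (simp add: koszul_def subst_minus[OF homog_pull_var])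
  have q: "transfer_q m (?m w) = form_pullback m \<theta> (transfer_q n w)"
    unfolding transfer_q_def subst_sum[OF homog_pull_var]
  proof (rule sum.cong)
    fix i assume i: "i \<in> {1..<length w}"
    have "transfer_p m (?m (take i w)) = form_pullback m \<theta> (transfer_p n (take i w))"
      "transfer_p m (?m (drop i w)) = form_pullback m \<theta> (transfer_p n (drop i w))"
      using i less.hyps[of "take i w"] less.hyps[of "drop i w"] less.prems
      by (auto simp: words_take words_drop)
    then show "koszul (wdeg (take i (?m w)) + 1) (transfer_p m (take i (?m w)) * transfer_p m (drop i (?m w))) =
        form_pullback m \<theta> (koszul (wdeg (take i w) + 1) (transfer_p n (take i w) * transfer_p n (drop i w)))"
      by (simp add: take_map drop_map k form_pullback wdeg_map)
  qed simp
  have "(if length (?m w) = 1 then to_forms m (snd (hd (?m w))) else 0) =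
      form_pullback m \<theta> (if length w = 1 then to_forms n (snd (hd w)) else 0)"
  proof (cases "length w = 1")
    case True
    then obtain k x where w: "w = [(k, x)]" by (cases w) auto
    then show ?thesis
      using less.prems to_forms_pullback[OF \<theta>, of x] by (auto simp: mem_cochains N_def)
  qed (simp add: subst_0[OF homog_pull_var])
  then have "transfer_p m (?m w) = form_pullback m \<theta> (transfer_p n w)"
    unfolding transfer_p_eq form_pullback q htpy_pullback[OF \<theta>] by simp
  with q show ?case by blast
qed

theorem transfer_m_pullback:
  fixes w :: "(nat list \<Rightarrow> 'a::field_char_0) word"
  assumes \<theta>: "\<theta> \<in> Delta m n" and w: "w \<in> words (cochains n)"
  shows "transfer_m m (map (\<lambda>(k, x). (k, pullback m \<theta> x)) w) = pullback m \<theta> (transfer_m n w)"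
proof (cases "length w = 1")
  case True
  then obtain k x where "w = [(k, x)]" by (cases w) auto
  then show ?thesis
    using w coboundary_pullback[OF \<theta>, of x "k + 1"] by (simp add: transfer_m_def mem_cochains)
next
  case False
  then show ?thesis
    using transfer_pullback[OF assms] by (simp add: transfer_m_def from_forms_pullback[OF \<theta>])
qed

section \<open>Coefficients in a differential graded commutative algebra\<close>

lemma koszul_apply: "koszul k f x = koszul k (f x)"
  by (simp add: koszul_def)

definition basis :: "nat list \<Rightarrow> nat list \<Rightarrow> 'k::zero_neq_one" where
  "basis \<sigma> \<tau> = (if \<tau> = \<sigma> then 1 else 0)"

text \<open>The accumulator of a product in a ring without unit: \<open>None\<close> is the empty product.\<close>

definition acc_mult :: "'a dg_alg \<Rightarrow> int \<Rightarrow> 'a option \<Rightarrow> int \<Rightarrow> 'a \<Rightarrow> 'a" where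
  "acc_mult R q A p b = (case A of None \<Rightarrow> b | Some a \<Rightarrow> dg_alg.mult R q p a b)"

text \<open>Extends a multilinear function \<open>G\<close> of scalar cochains to cochains with coefficients in \<open>R\<close>: the
  coefficients are multiplied from left to right, the product of those already read, of degree
  \<open>q\<close>, being moved past the next cochain.\<close>

fun ext_word :: "('k::field \<Rightarrow> 'a \<Rightarrow> 'a) \<Rightarrow> 'a::ab_group_add dg_alg \<Rightarrow> nat \<Rightarrow> int \<Rightarrow> 'a option
    \<Rightarrow> ((nat list \<Rightarrow> 'k) word \<Rightarrow> 'k) \<Rightarrow> (nat list \<Rightarrow> 'a) word \<Rightarrow> 'a" where
  "ext_word scale R n q A G [] = (case A of None \<Rightarrow> 0 | Some a \<Rightarrow> scale (G []) a)"
| "ext_word scale R n q A G (l # w) = (\<Sum>\<sigma>\<in>nondegenerate n.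
    let p = fst l + 1 - simplex_dim \<sigma> in
    koszul (q * (simplex_dim \<sigma> - 1))
      (ext_word scale R n (q + p) (Some (acc_mult R q A p (snd l \<sigma>)))
        (\<lambda>s. G ((simplex_dim \<sigma> - 1, basis \<sigma>) # s)) w))"

text \<open>\<open>fst (hd w) + 1\<close> is the unshifted degree of the letter, so
  \<open>diff R\<close> receives the degree of the coefficient at \<tau>. Its sign comes from
  passing the cochain.\<close>

definition tensor_m :: "('k::field_char_0 \<Rightarrow> 'a \<Rightarrow> 'a) \<Rightarrow> 'a::ab_group_add dg_alg \<Rightarrow> nat
    \<Rightarrow> (nat list \<Rightarrow> 'a) word \<Rightarrow> nat list \<Rightarrow> 'a" where
  "tensor_m scale R n w \<tau> = ext_word scale R n 0 None (\<lambda>s. transfer_m n s \<tau>) w +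
    (if length w = 1 \<and> \<tau> \<in> nondegenerate n then koszul (simplex_dim \<tau>)
      (diff R (fst (hd w) + 1 - simplex_dim \<tau>) (snd (hd w) \<tau>)) else 0)"

locale coefficients = dg_comm_algebra scale R
  for scale :: "'k::field_char_0 \<Rightarrow> 'a::ab_group_add \<Rightarrow> 'a" and R +
  fixes n :: nat
begin

abbreviation "ext \<equiv> ext_word scale R n"
abbreviation "letters \<equiv> shift (N_tensor n (part R))"
abbreviation "m\<^sub>R \<equiv> tensor_m scale R n"

section \<open>Multilinearity of the extension to coefficients\<close>

definition acc_ok :: "int \<Rightarrow> 'a option \<Rightarrow> bool" where
  "acc_ok q A \<longleftrightarrow> (case A of None \<Rightarrow> q = 0 | Some a \<Rightarrow> a \<in> part R q)"

lemma acc_ok_simps [simp]: "acc_ok 0 None" "acc_ok q (Some a) \<longleftrightarrow> a \<in> part R q"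
  by (simp_all add: acc_ok_def)

lemma part_0 [simp]: "0 \<in> part R k"
  and part_add: "a \<in> part R k \<Longrightarrow> b \<in> part R k \<Longrightarrow> a + b \<in> part R k"
  and part_scale: "a \<in> part R k \<Longrightarrow> scale c a \<in> part R k"
  using subspace_part by (auto intro: subspace_0 subspace_add subspace_scale)

lemma part_koszul: "a \<in> part R k \<Longrightarrow> koszul j a \<in> part R k"
  using subspace_neg[OF subspace_part] by (simp add: koszul_def)

lemma mult_part: "a \<in> part R p \<Longrightarrow> b \<in> part R q \<Longrightarrow> dg_alg.mult R p q a b \<in> part R (p + q)"
  using mult_linear_left by (auto simp: linear_on_into_def)

lemma mult_lin_left: "a \<in> part R p \<Longrightarrow> a' \<in> part R p \<Longrightarrow> b \<in> part R q \<Longrightarrow>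
    dg_alg.mult R p q (scale c a + a') b = scale c (dg_alg.mult R p q a b) + dg_alg.mult R p q a' b"
  using mult_linear_left[of b q p] by (auto simp: linear_on_into_def part_scale)

lemma mult_lin_right: "a \<in> part R p \<Longrightarrow> b \<in> part R q \<Longrightarrow> b' \<in> part R q \<Longrightarrow>
    dg_alg.mult R p q a (scale c b + b') = scale c (dg_alg.mult R p q a b) + dg_alg.mult R p q a b'"
  using mult_linear_right[of a p q] by (auto simp: linear_on_into_def part_scale)

lemma diff_part: "a \<in> part R k \<Longrightarrow> diff R k a \<in> part R (k + 1)"
  and diff_lin: "a \<in> part R k \<Longrightarrow> b \<in> part R k \<Longrightarrow>
    diff R k (scale c a + b) = scale c (diff R k a) + diff R k b"
  using d_linear[of k] by (auto simp: linear_on_into_def part_scale)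

lemma acc_mult_part: "acc_ok q A \<Longrightarrow> b \<in> part R p \<Longrightarrow> acc_mult R q A p b \<in> part R (q + p)"
  by (cases A) (auto simp: acc_ok_def acc_mult_def mult_part)

lemma acc_mult_lin: "acc_ok q A \<Longrightarrow> b \<in> part R p \<Longrightarrow> b' \<in> part R p \<Longrightarrow>
    acc_mult R q A p (scale c b + b') = scale c (acc_mult R q A p b) + acc_mult R q A p b'"
  by (cases A) (auto simp: acc_ok_def acc_mult_def mult_lin_right)

lemma letter_part: "x \<in> letters k \<Longrightarrow> \<sigma> \<in> nondegenerate n \<Longrightarrow> x \<sigma> \<in> part R (k + 1 - simplex_dim \<sigma>)"
  by (auto simp: shift_def N_tensor_def split: if_splits)

lemma letter_0: "x \<in> letters k \<Longrightarrow> \<sigma> \<notin> nondegenerate n \<Longrightarrow> x \<sigma> = 0"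
  by (auto simp: shift_def N_tensor_def split: if_splits)

lemma koszul_scale: "koszul k (scale c a) = scale c (koszul k a)"
  by (simp add: koszul_def)

lemma ext_lin_acc:
  assumes "w \<in> words letters" "a \<in> part R q" "a' \<in> part R q"
  shows "ext q (Some (scale c a + a')) G w = scale c (ext q (Some a) G w) + ext q (Some a') G w"
  using assms
proof (induction w arbitrary: q a a' G)
  case (Cons l w)
  obtain k x where l: "l = (k, x)" by (cases l)
  have "x \<sigma> \<in> part R (k + 1 - simplex_dim \<sigma>)" if "\<sigma> \<in> nondegenerate n" for \<sigma>
    using Cons.prems that l by (auto intro: letter_part)
  then show ?case
    using Cons
    by (simp add: l Let_def acc_mult_def mult_lin_left mult_part koszul_add koszul_scale
        sum.distrib scale_sum_right)
qed (simp add: scale_right_distrib scale_left_commute)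

lemma ext_acc_0: "w \<in> words letters \<Longrightarrow> ext q (Some 0) G w = 0"
  using ext_lin_acc[of w 0 q 0 1 G] by simp

lemma ext_acc_scale: "w \<in> words letters \<Longrightarrow> a \<in> part R q \<Longrightarrow>
    ext q (Some (scale c a)) G w = scale c (ext q (Some a) G w)"
  using ext_lin_acc[of w a q 0 c G] by (simp add: ext_acc_0)

lemma ext_lin_letter:
  assumes "u \<in> words letters" "v \<in> words letters" "x \<in> letters k" "y \<in> letters k" "acc_ok q A"
  shows "ext q A G (u @ (k, pointwise scale c x + y) # v) =
    scale c (ext q A G (u @ (k, x) # v)) + ext q A G (u @ (k, y) # v)"
  using assms
proof (induction u arbitrary: q A G)
  case Nil
  then show ?case
    by (simp add: Let_def pointwise_def letter_part acc_mult_lin acc_mult_part ext_lin_acc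
        koszul_add koszul_scale sum.distrib scale_sum_right)
next
  case (Cons l u)
  obtain j z where l: "l = (j, z)" by (cases l)
  have "z \<sigma> \<in> part R (j + 1 - simplex_dim \<sigma>)" if "\<sigma> \<in> nondegenerate n" for \<sigma>
    using Cons.prems that l by (auto intro: letter_part)
  then show ?case
    using Cons
    by (simp add: l Let_def acc_mult_part koszul_add koszul_scale sum.distrib scale_sum_right)
qed

lemma ext_lin_fun:
  "ext q A (\<lambda>s. c * G s + H s) w = scale c (ext q A G w) + ext q A H w"
  by (induction w arbitrary: q A G H)
    (simp_all add: Let_def koszul_add koszul_scale sum.distrib scale_sum_right scale_left_distrib
      split: option.split)

lemma ext_fun_0: "ext q A (\<lambda>s. 0) w = 0"
  by (induction w arbitrary: q A) (simp_all add: Let_def split: option.split)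

lemma ext_fun_sum: "finite I \<Longrightarrow> ext q A (\<lambda>s. \<Sum>i\<in>I. c i * G i s) w = (\<Sum>i\<in>I. scale (c i) (ext q A (G i) w))"
  by (induction I rule: finite_induct) (simp_all add: ext_fun_0 ext_lin_fun)

text \<open>Quantified over all functions on simplices and all degrees, since
  \<open>transfer_m\<close> is linear without restriction; so no membership conditions arise for
  scalar arguments.\<close>

definition multilin :: "((nat list \<Rightarrow> 'k) word \<Rightarrow> 'k) \<Rightarrow> bool" where
  "multilin G \<longleftrightarrow> (\<forall>u k c x y v.
    G (u @ (k, pointwise (*) c x + y) # v) = c * G (u @ (k, x) # v) + G (u @ (k, y) # v))"

lemma multilin_Cons: "multilin G \<Longrightarrow> multilin (\<lambda>s. G (l # s))"
  unfolding multilin_def by (metis append_Cons)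

lemma multilin_expand:
  assumes G: "multilin G" and v: "v \<in> N n q"
  shows "G ((k, v) # w) = (\<Sum>\<sigma>\<in>nondegenerate n. v \<sigma> * G ((k, basis \<sigma>) # w))"
proof -
  have lin: "G ((k, pointwise (*) c x + y) # w) = c * G ((k, x) # w) + G ((k, y) # w)" for c x y
    using G unfolding multilin_def by (metis append_Nil)
  have "pointwise (*) 1 0 + 0 = (0 :: nat list \<Rightarrow> 'k)" by (auto simp: pointwise_def)
  then have 0: "G ((k, 0) # w) = 0" using lin[of 1 0 0] by simp
  have e: "G ((k, \<Sum>\<sigma>\<in>I. pointwise (*) (v \<sigma>) (basis \<sigma>)) # w) = (\<Sum>\<sigma>\<in>I. v \<sigma> * G ((k, basis \<sigma>) # w))"
    if "finite I" for I
    using that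
  proof (induction I rule: finite_induct)
    case (insert \<sigma> I)
    show ?case unfolding sum.insert[OF insert.hyps] lin insert.IH ..
  qed (simp only: sum.empty 0)
  have v': "v = (\<Sum>\<sigma>\<in>nondegenerate n. pointwise (*) (v \<sigma>) (basis \<sigma>))"
  proof
    fix \<tau>
    have "(\<Sum>\<sigma>\<in>nondegenerate n. pointwise (*) (v \<sigma>) (basis \<sigma>)) \<tau> =
        (\<Sum>\<sigma>\<in>nondegenerate n. if \<sigma> = \<tau> then v \<sigma> else 0)"
      unfolding sum_fun_apply by (rule sum.cong) (auto simp: pointwise_def basis_def)
    then show "v \<tau> = (\<Sum>\<sigma>\<in>nondegenerate n. pointwise (*) (v \<sigma>) (basis \<sigma>)) \<tau>"
      using v by (auto simp: finite_nondegenerate N_def)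
  qed
  show ?thesis using e[OF finite_nondegenerate[of n]] unfolding v'[symmetric] .
qed

text \<open>The sum over simplices expands \<open>v\<close> in basis cochains. Wherever
  \<open>v\<close> is nonzero the dimension is \<open>s + 1\<close>, so all surviving terms share
  one sign and one coefficient degree.\<close>

lemma ext_Cons_pure:
  assumes G: "multilin G" and v: "v \<in> N n (s + 1)" and b: "b \<in> part R p"
    and w: "w \<in> words letters" and A: "acc_ok q A"
  shows "ext q A G ((s + p, pure_tensor scale v b) # w) =
    koszul (q * s) (ext (q + p) (Some (acc_mult R q A p b)) (\<lambda>u. G ((s, v) # u)) w)"
proof -
  have acc: "acc_mult R q A p b \<in> part R (q + p)" by (rule acc_mult_part[OF A b])
  have "(let p' = s + p + 1 - simplex_dim \<sigma> in koszul (q * (simplex_dim \<sigma> - 1))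
      (ext (q + p') (Some (acc_mult R q A p' (pure_tensor scale v b \<sigma>)))
        (\<lambda>u. G ((simplex_dim \<sigma> - 1, basis \<sigma>) # u)) w)) =
    koszul (q * s) (scale (v \<sigma>) (ext (q + p) (Some (acc_mult R q A p b)) (\<lambda>u. G ((s, basis \<sigma>) # u)) w))"
    if "\<sigma> \<in> nondegenerate n" for \<sigma>
  proof (cases "v \<sigma> = 0")
    case True
    have "acc_mult R q A p' 0 = 0" for p'
      using acc_mult_lin[OF A, of 0 p' 0 1] by simp
    then show ?thesis using True w by (simp add: pure_tensor_def ext_acc_0)
  next
    case False
    then have "simplex_dim \<sigma> = s + 1" using v by (auto simp: N_def)
    moreover have "acc_mult R q A p (scale c b) = scale c (acc_mult R q A p b)" for c
      using acc_mult_lin[OF A b part_0, of c] acc_mult_lin[OF A, of 0 p 0 1] by simp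
    ultimately show ?thesis using acc w by (simp add: pure_tensor_def ext_acc_scale)
  qed
  then have "ext q A G ((s + p, pure_tensor scale v b) # w) = (\<Sum>\<sigma>\<in>nondegenerate n.
      koszul (q * s) (scale (v \<sigma>) (ext (q + p) (Some (acc_mult R q A p b)) (\<lambda>u. G ((s, basis \<sigma>) # u)) w)))"
    by (simp add: Let_def)
  also have "\<dots> = koszul (q * s) (ext (q + p) (Some (acc_mult R q A p b))
      (\<lambda>u. \<Sum>\<sigma>\<in>nondegenerate n. v \<sigma> * G ((s, basis \<sigma>) # u)) w)"
    by (simp add: ext_fun_sum finite_nondegenerate koszul_sum)
  finally show ?thesis by (simp add: multilin_expand[OF G v])
qed

section \<open>Words of pure tensors\<close>

text \<open>A pure letter \<open>(s, v, p, b)\<close> stands for \<open>v \<otimes> b\<close>, where \<open>v\<close> has shifted degree \<open>s\<close> and \<open>b\<close> has degree \<open>p\<close>.\<close>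

definition pure_ok :: "int \<times> (nat list \<Rightarrow> 'k) \<times> int \<times> 'a \<Rightarrow> bool" where
  "pure_ok l \<longleftrightarrow> (case l of (s, v, p, b) \<Rightarrow> v \<in> cochains n s \<and> b \<in> part R p)"

definition total :: "int \<times> (nat list \<Rightarrow> 'k) \<times> int \<times> 'a \<Rightarrow> int \<times> (nat list \<Rightarrow> 'a)" where
  "total l = (case l of (s, v, p, b) \<Rightarrow> (s + p, pure_tensor scale v b))"

definition cochain_part :: "int \<times> (nat list \<Rightarrow> 'k) \<times> int \<times> 'a \<Rightarrow> int \<times> (nat list \<Rightarrow> 'k)" where
  "cochain_part l = (case l of (s, v, p, b) \<Rightarrow> (s, v))"

lemma pure_simps [simp]:
  "pure_ok (s, v, p, b) \<longleftrightarrow> v \<in> cochains n s \<and> b \<in> part R p"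
  "total (s, v, p, b) = (s + p, pure_tensor scale v b)"
  "cochain_part (s, v, p, b) = (s, v)"
  by (simp_all add: pure_ok_def total_def cochain_part_def)

definition rdeg :: "(int \<times> (nat list \<Rightarrow> 'k) \<times> int \<times> 'a) list \<Rightarrow> int" where
  "rdeg W = sum_list (map (\<lambda>(s, v, p, b). p) W)"

lemma rdeg_simps [simp]: "rdeg [] = 0" "rdeg ((s, v, p, b) # W) = p + rdeg W" "rdeg (U @ W) = rdeg U + rdeg W"
  by (simp_all add: rdeg_def)

abbreviation "sdeg W \<equiv> wdeg (map cochain_part W)"

lemma wdeg_total: "wdeg (map total W) = sdeg W + rdeg W"
  by (induction W) auto

text \<open>The exponent of the Koszul sign for sorting alternating cochains and coefficients into
  all cochains followed by all coefficients, when coefficients of degree \<open>q\<close> have been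
  read before.\<close>

fun psign :: "int \<Rightarrow> (int \<times> (nat list \<Rightarrow> 'k) \<times> int \<times> 'a) list \<Rightarrow> int" where
  "psign q [] = 0"
| "psign q ((s, v, p, b) # W) = q * s + psign (q + p) W"

fun rprod :: "int \<Rightarrow> 'a option \<Rightarrow> (int \<times> (nat list \<Rightarrow> 'k) \<times> int \<times> 'a) list \<Rightarrow> 'a" where
  "rprod q A [] = (case A of None \<Rightarrow> 0 | Some a \<Rightarrow> a)"
| "rprod q A ((s, v, p, b) # W) = rprod (q + p) (Some (acc_mult R q A p b)) W"

text \<open>The part of the Leibniz expansion of \<open>rprod q A W\<close> that differentiates the letters of \<open>W\<close>.\<close>

fun drprod :: "int \<Rightarrow> 'a option \<Rightarrow> (int \<times> (nat list \<Rightarrow> 'k) \<times> int \<times> 'a) list \<Rightarrow> 'a" where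
  "drprod q A [] = 0"
| "drprod q A ((s, v, p, b) # W) =
    koszul q (rprod (q + p + 1) (Some (acc_mult R q A (p + 1) (diff R p b))) W) +
    drprod (q + p) (Some (acc_mult R q A p b)) W"

lemma pure_letter: "v \<in> cochains n s \<Longrightarrow> b \<in> part R p \<Longrightarrow> pure_tensor scale v b \<in> letters (s + p)"
  unfolding shift_def
  by (rule pure_tensor_in[OF module_axioms subspace_part]) (auto simp: algebra_simps)

lemma total_words: "list_all pure_ok W \<Longrightarrow> map total W \<in> words letters"
  and cochain_words: "list_all pure_ok W \<Longrightarrow> map cochain_part W \<in> words (cochains n)"
  by (induction W) (auto intro: pure_letter)

lemma psign_shift: "psign (q + r) W = psign q W + r * sdeg W"
proof (induction W arbitrary: q)
  case (Cons l W)
  obtain s v p b where l: "l = (s, v, p, b)" by (cases l)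
  have "psign (q + r + p) W = psign (q + p) W + r * sdeg W"
    using Cons[of "q + p"] by (simp add: algebra_simps)
  then show ?case by (simp add: l algebra_simps)
qed simp

lemma psign_append: "psign q (U @ W) = psign q U + psign (q + rdeg U) W"
  by (induction U arbitrary: q) (auto simp: algebra_simps)

lemma rprod_part:
  "list_all pure_ok W \<Longrightarrow> acc_ok q A \<Longrightarrow> A \<noteq> None \<or> W \<noteq> [] \<Longrightarrow> rprod q A W \<in> part R (q + rdeg W)"
proof (induction W arbitrary: q A)
  case (Cons l W)
  obtain s v p b where l: "l = (s, v, p, b)" by (cases l)
  show ?case using Cons.prems Cons.IH[of "q + p" "Some (acc_mult R q A p b)"]
    by (simp add: l acc_mult_part add.assoc)
qed (auto split: option.splits)

lemma rprod_append:
  "A \<noteq> None \<or> U \<noteq> [] \<Longrightarrow> rprod q A (U @ W) = rprod (q + rdeg U) (Some (rprod q A U)) W"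
proof (induction U arbitrary: q A)
  case (Cons l U)
  obtain s v p b where l: "l = (s, v, p, b)" by (cases l)
  show ?case using Cons.IH[of "Some (acc_mult R q A p b)" "q + p"] by (simp add: l add.assoc)
qed (auto split: option.splits)

lemma acc_mult_assoc:
  assumes "acc_ok q A" "a \<in> part R p" "b \<in> part R r"
  shows "acc_mult R q A (p + r) (dg_alg.mult R p r a b) = dg_alg.mult R (q + p) r (acc_mult R q A p a) b"
  using assms by (cases A) (auto simp: acc_ok_def acc_mult_def mult_assoc)

lemma rprod_assoc:
  assumes "list_all pure_ok U" "a \<in> part R r" "acc_ok q A"
  shows "acc_mult R q A (r + rdeg U) (rprod r (Some a) U) = rprod (q + r) (Some (acc_mult R q A r a)) U"
  using assms
proof (induction U arbitrary: r a)
  case (Cons l U)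
  obtain s v p b where l: "l = (s, v, p, b)" by (cases l)
  have "acc_mult R q A (r + p + rdeg U) (rprod (r + p) (Some (dg_alg.mult R r p a b)) U) =
      rprod (q + (r + p)) (Some (acc_mult R q A (r + p) (dg_alg.mult R r p a b))) U"
    using Cons by (intro Cons.IH) (auto simp: l mult_part)
  then show ?case
    using Cons.prems acc_mult_assoc[of q A a r b p] by (simp add: l acc_mult_def[of _ _ "Some _"] add.assoc)
qed simp

text \<open>Multiplying out a block beforehand is what an operation applied to that block
  does.\<close>

lemma rprod_block:
  assumes "list_all pure_ok U" "U \<noteq> []" "acc_ok q A"
  shows "acc_mult R q A (rdeg U) (rprod 0 None U) = rprod q A U"
proof -
  obtain s v p b V where U: "U = (s, v, p, b) # V" using assms(2) by (cases U) auto
  show ?thesis using rprod_assoc[of V b p q A] assms by (simp add: U acc_mult_def[of _ _ None])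
qed

lemma ext_pure:
  assumes "multilin G" "list_all pure_ok W" "acc_ok q A" "A \<noteq> None \<or> W \<noteq> []"
  shows "ext q A G (map total W) = koszul (psign q W) (scale (G (map cochain_part W)) (rprod q A W))"
  using assms
proof (induction W arbitrary: q A G)
  case (Cons l W)
  obtain s v p b where l: "l = (s, v, p, b)" by (cases l)
  have "ext q A G (map total (l # W)) =
      koszul (q * s) (ext (q + p) (Some (acc_mult R q A p b)) (\<lambda>u. G ((s, v) # u)) (map total W))"
    using Cons.prems by (simp add: l ext_Cons_pure total_words shift_def del: ext_word.simps)
  also have "\<dots> = koszul (q * s) (koszul (psign (q + p) W) (scale (G ((s, v) # map cochain_part W))
      (rprod (q + p) (Some (acc_mult R q A p b)) W)))"
    using Cons.prems by (subst Cons.IH) (auto simp: l multilin_Cons acc_mult_part)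
  finally show ?case by (simp add: l koszul_koszul)
qed (auto split: option.splits)

lemma multilin_transfer: "multilin (\<lambda>s. transfer_m n s \<tau>)"
  unfolding multilin_def transfer_m_linear by (simp add: pointwise_def)

lemma transfer_m_dim:
  assumes "list_all pure_ok W" "W \<noteq> []" "transfer_m n (map cochain_part W) \<tau> \<noteq> 0"
  shows "\<tau> \<in> nondegenerate n" "simplex_dim \<tau> = sdeg W + 2"
  using transfer_m_cochain[OF cochain_words[OF assms(1)]] assms(2,3)
  by (auto simp: shift_def N_def)

lemma tensor_m_single:
  assumes "v \<in> cochains n s" "b \<in> part R p"
  shows "m\<^sub>R [(s + p, pure_tensor scale v b)] =
    pure_tensor scale (coboundary n v) b + koszul (s + 1) (pure_tensor scale v (diff R p b))"
proof
  fix \<tau>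
  have v: "v \<in> N n (s + 1)" using assms by (simp add: shift_def)
  have "ext 0 None (\<lambda>u. transfer_m n u \<tau>) [total (s, v, p, b)] = scale (coboundary n v \<tau>) b"
    using ext_pure[OF multilin_transfer, of "[(s, v, p, b)]" 0 None \<tau>] assms
    by (simp add: transfer_m_def acc_mult_def del: ext_word.simps)
  moreover have "(if \<tau> \<in> nondegenerate n then koszul (simplex_dim \<tau>)
      (diff R (s + p + 1 - simplex_dim \<tau>) (pure_tensor scale v b \<tau>)) else 0) =
      koszul (s + 1) (scale (v \<tau>) (diff R p b))"
  proof (cases "v \<tau> = 0")
    case True
    have "diff R j 0 = 0" for j using diff_lin[of 0 j 0 1] by simp
    then show ?thesis using True by (simp add: pure_tensor_def)
  next
    case False
    then have "\<tau> \<in> nondegenerate n" "simplex_dim \<tau> = s + 1" using v by (auto simp: N_def)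
    moreover have "diff R p (scale c b) = scale c (diff R p b)" for c
      using diff_lin[OF assms(2) part_0, of c] diff_lin[of 0 p 0 1] by simp
    ultimately show ?thesis by (simp add: pure_tensor_def)
  qed
  moreover have "m\<^sub>R [total (s, v, p, b)] \<tau> = ext 0 None (\<lambda>u. transfer_m n u \<tau>) [total (s, v, p, b)] +
      (if \<tau> \<in> nondegenerate n then koszul (simplex_dim \<tau>)
      (diff R (s + p + 1 - simplex_dim \<tau>) (pure_tensor scale v b \<tau>)) else 0)"
    by (simp add: tensor_m_def del: ext_word.simps)
  ultimately show "m\<^sub>R [(s + p, pure_tensor scale v b)] \<tau> = (pure_tensor scale (coboundary n v) b +
      koszul (s + 1) (pure_tensor scale v (diff R p b))) \<tau>"
    by (simp add: koszul_apply) (simp add: pure_tensor_def)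
qed

lemma tensor_m_pure:
  assumes "list_all pure_ok W" "length W \<ge> 2"
  shows "m\<^sub>R (map total W) = koszul (psign 0 W)
    (pure_tensor scale (transfer_m n (map cochain_part W)) (rprod 0 None W))"
proof
  fix \<tau>
  have "W \<noteq> []" using assms by auto
  then show "m\<^sub>R (map total W) \<tau> = koszul (psign 0 W)
    (pure_tensor scale (transfer_m n (map cochain_part W)) (rprod 0 None W)) \<tau>"
    using assms ext_pure[OF multilin_transfer assms(1), of 0 None \<tau>]
    by (simp add: tensor_m_def pure_tensor_def koszul_def del: ext_word.simps)
qed

section \<open>Reduction to pure tensors\<close>

lemma letters_subspace: "module.subspace (pointwise scale) (letters k)"
  unfolding shift_def by (rule subspace_N_tensor[OF module_axioms subspace_part])

lemmas module_pointwise_scale = module_pointwise[OF module_axioms]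
lemmas letters_add = module.subspace_add[OF module_pointwise_scale letters_subspace]
  and letters_0 = module.subspace_0[OF module_pointwise_scale letters_subspace]
  and letters_scale = module.subspace_scale[OF module_pointwise_scale letters_subspace]

lemma letters_sum: "(\<And>i. i \<in> I \<Longrightarrow> F i \<in> letters k) \<Longrightarrow> sum F I \<in> letters k"
  by (induction I rule: infinite_finite_induct) (simp_all only: sum.infinite sum.empty sum.insert
      letters_0 letters_add insert_iff simp_thms)

lemma letters_koszul: "x \<in> letters k \<Longrightarrow> koszul j x \<in> letters k"
proof -
  assume x: "x \<in> letters k"
  have "pointwise scale (- 1) x = - x" by (auto simp: pointwise_def)
  then show ?thesis using x letters_scale[OF x, of "- 1"] by (simp add: koszul_def)
qed

lemma basis_cochain: "\<sigma> \<in> nondegenerate n \<Longrightarrow> basis \<sigma> \<in> cochains n (simplex_dim \<sigma> - 1)"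
  by (auto simp: shift_def N_def basis_def)

lemma letter_expand:
  assumes "x \<in> letters k"
  shows "x = (\<Sum>\<sigma>\<in>nondegenerate n. pure_tensor scale (basis \<sigma>) (x \<sigma>))"
proof
  fix \<tau>
  have "(\<Sum>\<sigma>\<in>nondegenerate n. pure_tensor scale (basis \<sigma>) (x \<sigma>)) \<tau> =
      (\<Sum>\<sigma>\<in>nondegenerate n. if \<sigma> = \<tau> then x \<sigma> else 0)"
    unfolding sum_fun_apply by (rule sum.cong) (auto simp: pure_tensor_def basis_def)
  then show "x \<tau> = (\<Sum>\<sigma>\<in>nondegenerate n. pure_tensor scale (basis \<sigma>) (x \<sigma>)) \<tau>"
    using letter_0[OF assms] by (simp add: finite_nondegenerate)
qed

text \<open>A letter is a finite sum of basis cochains tensored with its values, so an additive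
  function is controlled by pure words. Letters are replaced from the left, the prefix staying pure.
  With \<open>S\<close> zero this proves identities, with \<open>S\<close> a graded part it proves
  membership.\<close>

lemma pure_extension:
  fixes T :: "(nat list \<Rightarrow> 'a) word \<Rightarrow> 'c::ab_group_add"
  assumes add: "\<And>u v k x y. u \<in> words letters \<Longrightarrow> v \<in> words letters \<Longrightarrow> x \<in> letters k \<Longrightarrow> y \<in> letters k \<Longrightarrow>
      T (u @ (k, x + y) # v) = T (u @ (k, x) # v) + T (u @ (k, y) # v)"
    and S: "0 \<in> S" "\<And>a b. a \<in> S \<Longrightarrow> b \<in> S \<Longrightarrow> a + b \<in> S"
    and pure: "\<And>W. list_all pure_ok W \<Longrightarrow> T (map total W) \<in> S"
    and w: "w \<in> words letters"
  shows "T w \<in> S"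
proof -
  have "T (map total U @ w) \<in> S" if "list_all pure_ok U" for U
    using w that
  proof (induction w arbitrary: U)
    case (Cons l w)
    obtain k x where l: "l = (k, x)" by (cases l)
    have x: "x \<in> letters k" and w: "w \<in> words letters" using Cons.prems l by auto
    let ?u = "map total U" and ?e = "\<lambda>\<sigma>. pure_tensor scale (basis \<sigma>) (x \<sigma>)"
    let ?l = "\<lambda>\<sigma>. (simplex_dim \<sigma> - 1, basis \<sigma>, k + 1 - simplex_dim \<sigma>, x \<sigma>)"
    have u: "?u \<in> words letters" by (rule total_words[OF Cons.prems(2)])
    have ok: "pure_ok (?l \<sigma>)" "total (?l \<sigma>) = (k, ?e \<sigma>)" if "\<sigma> \<in> nondegenerate n" for \<sigma>
      using that letter_part[OF x that] by (auto simp: basis_cochain)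
    have e: "?e \<sigma> \<in> letters k" if "\<sigma> \<in> nondegenerate n" for \<sigma>
      using pure_letter[OF basis_cochain[OF that] letter_part[OF x that]] by simp
    have 0: "T (?u @ (k, 0) # w) = 0" using add[OF u w letters_0 letters_0] by simp
    have step: "T (?u @ (k, ?e \<sigma>) # w) \<in> S" if "\<sigma> \<in> nondegenerate n" for \<sigma>
      using Cons.IH[OF w, of "U @ [?l \<sigma>]"] Cons.prems(2) ok[OF that] by simp
    have "T (?u @ (k, sum ?e I) # w) \<in> S" if "finite I" "I \<subseteq> nondegenerate n" for I
      using that
    proof (induction I rule: finite_induct)
      case (insert \<sigma> I)
      then have "sum ?e I \<in> letters k" "?e \<sigma> \<in> letters k" by (blast intro!: letters_sum e)+
      note a = add[OF u w this(2,1)]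
      show ?case
        unfolding sum.insert[OF insert.hyps] a using insert by (intro S(2) step) auto
    qed (simp only: sum.empty 0 S(1))
    from this[OF finite_nondegenerate subset_refl] show ?case
      unfolding letter_expand[OF x, symmetric] l .
  qed (use pure in simp)
  from this[of "[]"] show ?thesis by simp
qed

lemma tensor_m_linear:
  assumes "u \<in> words letters" "v \<in> words letters" "x \<in> letters k" "y \<in> letters k"
  shows "m\<^sub>R (u @ (k, pointwise scale c x + y) # v) =
    pointwise scale c (m\<^sub>R (u @ (k, x) # v)) + m\<^sub>R (u @ (k, y) # v)"
proof
  fix \<tau>
  have "koszul j (diff R (k + 1 - simplex_dim \<tau>) (scale c (x \<tau>) + y \<tau>)) =
      scale c (koszul j (diff R (k + 1 - simplex_dim \<tau>) (x \<tau>))) +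
      koszul j (diff R (k + 1 - simplex_dim \<tau>) (y \<tau>))" if "\<tau> \<in> nondegenerate n" for j
    using diff_lin[OF letter_part[OF assms(3) that] letter_part[OF assms(4) that]]
    by (simp add: koszul_add koszul_scale)
  then show "m\<^sub>R (u @ (k, pointwise scale c x + y) # v) \<tau> =
      (pointwise scale c (m\<^sub>R (u @ (k, x) # v)) + m\<^sub>R (u @ (k, y) # v)) \<tau>"
    using ext_lin_letter[OF assms, where q = 0 and A = None and c = c]
    by (auto simp: tensor_m_def pointwise_def scale_right_distrib)
qed

lemma tensor_m_add:
  assumes "u \<in> words letters" "v \<in> words letters" "x \<in> letters k" "y \<in> letters k"
  shows "m\<^sub>R (u @ (k, x + y) # v) = m\<^sub>R (u @ (k, x) # v) + m\<^sub>R (u @ (k, y) # v)"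
proof -
  have p: "pointwise scale 1 z = z" for z :: "nat list \<Rightarrow> 'a" by (auto simp: pointwise_def)
  show ?thesis using tensor_m_linear[OF assms, of 1] unfolding p .
qed

lemma tensor_m_letter:
  assumes "w \<in> words letters" "w \<noteq> []"
  shows "m\<^sub>R w \<in> letters (wdeg w + 1)"
proof -
  \<comment> \<open>The guard fixes the target degree, so that one \<open>S\<close> serves all pure
    words.\<close>
  let ?T = "\<lambda>u. if u \<noteq> [] \<and> wdeg u = wdeg w then m\<^sub>R u else 0"
  have "?T w \<in> letters (wdeg w + 1)"
  proof (rule pure_extension[where T = ?T, OF _ letters_0 letters_add _ assms(1)])
    fix W assume W: "list_all pure_ok W"
    have "m\<^sub>R (map total W) \<in> letters (wdeg (map total W) + 1)" if "W \<noteq> []"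
    proof (cases "length W = 1")
      case True
      then obtain s v p b where l: "W = [(s, v, p, b)]" by (cases W) auto
      have "pure_tensor scale (coboundary n v) b \<in> letters (s + 1 + p)"
        "pure_tensor scale v (diff R p b) \<in> letters (s + (p + 1))"
        using W l coboundary_N[of v n "s + 1"] diff_part[of b p]
        by (auto simp: shift_def[of "N n"] intro!: pure_letter)
      then have "pure_tensor scale (coboundary n v) b + koszul (s + 1) (pure_tensor scale v (diff R p b))
          \<in> letters (s + p + 1)"
        by (intro letters_add letters_koszul) (simp_all add: add.assoc add.commute[of p 1])
      moreover have "m\<^sub>R (map total W) =
          pure_tensor scale (coboundary n v) b + koszul (s + 1) (pure_tensor scale v (diff R p b))"
        using tensor_m_single[of v s b p] W unfolding l by simp
      ultimately show ?thesis by (simp add: l)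
    next
      case False
      then have len: "length W \<ge> 2" using that by (cases W; cases "tl W") auto
      have "pure_tensor scale (transfer_m n (map cochain_part W)) (rprod 0 None W) \<in> letters (sdeg W + 1 + rdeg W)"
        using transfer_m_cochain[OF cochain_words[OF W]] rprod_part[OF W, of 0 None] that
        by (auto intro!: pure_letter)
      then show ?thesis
        unfolding tensor_m_pure[OF W len] wdeg_total by (auto simp: ac_simps intro!: letters_koszul)
    qed
    then show "?T (map total W) \<in> letters (wdeg w + 1)" by (auto simp: letters_0)
  qed (auto simp: tensor_m_add)
  then show ?thesis using assms(2) by simp
qed

section \<open>The coderivation of the extended operations\<close>

lemma coder_cong_words:
  assumes "\<And>u. u \<in> words letters \<Longrightarrow> u \<noteq> [] \<Longrightarrow> F u = G u" "w \<in> words letters"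
  shows "coder m\<^sub>R F w = coder m\<^sub>R G w"
  using assms
proof (induction w arbitrary: F G)
  case (Cons l w)
  obtain k x where l: "l = (k, x)" by (cases l)
  have "coder m\<^sub>R (\<lambda>u. F (l # u)) w = coder m\<^sub>R (\<lambda>u. G (l # u)) w"
    using Cons.prems by (intro Cons.IH) (auto simp: l)
  moreover have "(wdeg (take j (l # w)) + 1, m\<^sub>R (take j (l # w))) # drop j (l # w) \<in> words letters"
    if "j \<in> {1..Suc (length w)}" for j
  proof -
    have "take j (l # w) \<in> words letters" "drop j (l # w) \<in> words letters" "take j (l # w) \<noteq> []"
      using Cons.prems(2) that by (auto intro: words_take words_drop simp del: take_Cons' drop_Cons' words_simps(2))
    then show ?thesis using tensor_m_letter by auto
  qed
  ultimately show ?case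
    using Cons.prems(1) by (simp del: take_Cons' drop_Cons' sum.cl_ivl_Suc)
qed simp

lemma ext_koszul_letter:
  assumes "w \<in> words letters" "x \<in> letters k" "acc_ok q A"
  shows "ext q A G ((k, koszul j x) # w) = koszul j (ext q A G ((k, x) # w))"
proof -
  have p: "pointwise scale (- 1) x + 0 = - x" by (auto simp: pointwise_def)
  have "pointwise scale 1 0 + 0 = (0 :: nat list \<Rightarrow> 'a)" by (auto simp: pointwise_def)
  then have 0: "ext q A G ((k, 0) # w) = 0"
    using ext_lin_letter[of "[]" w 0 k 0 q A G 1] assms letters_0[of k] by (simp del: ext_word.simps)
  have "ext q A G ((k, - x) # w) = - ext q A G ((k, x) # w)"
    using ext_lin_letter[of "[]" w x k 0 q A G "- 1"] assms letters_0[of k] 0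
    unfolding p by (simp del: ext_word.simps)
  then show ?thesis by (simp add: koszul_def del: ext_word.simps)
qed

text \<open>The operation contracts \<open>U\<close> to one letter whose coefficient is the product
  of the block. Its cochain part has gained degree 1, which the coefficients already read, of degree
  \<open>q\<close>, have to pass.\<close>

lemma ext_modified_long:
  assumes G: "multilin G" and U: "list_all pure_ok U" "length U \<ge> 2" and Z: "list_all pure_ok Z" and A: "acc_ok q A"
  shows "ext q A G ((wdeg (map total U) + 1, m\<^sub>R (map total U)) # map total Z) =
    koszul (psign q (U @ Z) + q) (scale (G ((sdeg U + 1, transfer_m n (map cochain_part U)) # map cochain_part Z))
      (rprod q A (U @ Z)))"
proof -
  have ne: "U \<noteq> []" using U by auto
  let ?L = "(sdeg U + 1, transfer_m n (map cochain_part U), rdeg U, rprod 0 None U)"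
  have L: "pure_ok ?L"
    using transfer_m_cochain[OF cochain_words[OF U(1)]] rprod_part[OF U(1), of 0 None] ne by simp
  then have tL: "snd (total ?L) \<in> letters (fst (total ?L))" using pure_letter by simp
  have deg: "wdeg (map total U) + 1 = fst (total ?L)" by (simp add: wdeg_total)
  have "ext q A G ((wdeg (map total U) + 1, m\<^sub>R (map total U)) # map total Z) =
      koszul (psign 0 U) (ext q A G (map total (?L # Z)))"
    unfolding deg tensor_m_pure[OF U] using ext_koszul_letter[OF total_words[OF Z] tL A]
    by (simp del: ext_word.simps)
  also have "\<dots> = koszul (psign 0 U) (koszul (psign q (?L # Z))
      (scale (G (map cochain_part (?L # Z))) (rprod q A (?L # Z))))"
    using L Z by (subst ext_pure[OF G _ A]) auto
  also have "rprod q A (?L # Z) = rprod q A (U @ Z)"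
    using rprod_append[of A U q Z] ne by (simp add: rprod_block[OF U(1) ne A])
  also have "psign q (?L # Z) = psign q (U @ Z) + q - psign 0 U"
    using psign_shift[of 0 q U] by (simp add: psign_append algebra_simps)
  finally show ?thesis by (simp add: koszul_koszul)
qed

text \<open>The coboundary term behaves like a longer block. The other term raises the degree of a
  coefficient, which then passes the cochains of \<open>Z\<close>; this accounts for
  \<open>sdeg Z\<close>.\<close>

lemma ext_modified_single:
  assumes G: "multilin G" and l: "v \<in> cochains n s" "b \<in> part R p" and Z: "list_all pure_ok Z" and A: "acc_ok q A"
  shows "ext q A G ((s + p + 1, m\<^sub>R [(s + p, pure_tensor scale v b)]) # map total Z) =
    koszul (q * s + psign (q + p) Z + q) (scale (G ((s + 1, coboundary n v) # map cochain_part Z))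
      (rprod (q + p) (Some (acc_mult R q A p b)) Z)) +
    koszul (q * s + psign (q + p) Z + s + sdeg Z + 1) (scale (G ((s, v) # map cochain_part Z))
      (rprod (q + p + 1) (Some (acc_mult R q A (p + 1) (diff R p b))) Z))"
proof -
  let ?L = "(s + 1, coboundary n v, p, b)" and ?M = "(s, v, p + 1, diff R p b)"
  have L: "pure_ok ?L" "pure_ok ?M"
    using l coboundary_N[of v n "s + 1"] diff_part[OF l(2)] by (auto simp: shift_def[of "N n"])
  have tL: "pure_tensor scale (coboundary n v) b \<in> letters (s + p + 1)"
    "pure_tensor scale v (diff R p b) \<in> letters (s + p + 1)"
    using L pure_letter[of "coboundary n v" "s + 1" b p] pure_letter[of v s "diff R p b" "p + 1"]
    by (simp_all add: algebra_simps)
  have z: "map total Z \<in> words letters" by (rule total_words[OF Z])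
  have p: "pointwise scale 1 x = x" for x :: "nat list \<Rightarrow> 'a" by (auto simp: pointwise_def)
  have "ext q A G ((s + p + 1, m\<^sub>R [(s + p, pure_tensor scale v b)]) # map total Z) =
      ext q A G ((s + p + 1, pure_tensor scale (coboundary n v) b) # map total Z) +
      ext q A G ((s + p + 1, koszul (s + 1) (pure_tensor scale v (diff R p b))) # map total Z)"
    unfolding tensor_m_single[OF l]
    using ext_lin_letter[OF _ z tL(1) letters_koszul[OF tL(2)] A, of "[]" G 1 "s + 1"]
    unfolding p by (simp del: ext_word.simps)
  also have "\<dots> = ext q A G (map total (?L # Z)) + koszul (s + 1) (ext q A G (map total (?M # Z)))"
    unfolding ext_koszul_letter[OF z tL(2) A] by (simp add: algebra_simps del: ext_word.simps)
  also have "\<dots> = koszul (psign q (?L # Z)) (scale (G (map cochain_part (?L # Z))) (rprod q A (?L # Z))) +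
      koszul (s + 1) (koszul (psign q (?M # Z)) (scale (G (map cochain_part (?M # Z))) (rprod q A (?M # Z))))"
    using L Z by (subst (1 2) ext_pure[OF G _ A]) auto
  also have "psign q (?M # Z) = q * s + psign (q + p) Z + sdeg Z"
    using psign_shift[of "q + p" 1 Z] by (simp add: algebra_simps)
  finally show ?thesis by (simp add: koszul_koszul algebra_simps)
qed

text \<open>Extending to coefficients commutes with the coderivation, up to the terms where a single
  letter has its coefficient differentiated. These add up to the Leibniz expansion
  \<open>drprod\<close>.\<close>

theorem coder_ext:
  assumes "multilin G" "list_all pure_ok W" "acc_ok q A" "A \<noteq> None \<or> W \<noteq> []"
  shows "coder m\<^sub>R (ext q A G) (map total W) = koszul (psign q W + q)
    (scale (coder (transfer_m n) G (map cochain_part W)) (rprod q A W) +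
     koszul (sdeg W + 1) (scale (G (map cochain_part W)) (drprod q A W)))"
  using assms
proof (induction W arbitrary: q A G)
  case (Cons l W)
  obtain s v p b where l: "l = (s, v, p, b)" by (cases l)
  have lok: "v \<in> cochains n s" "b \<in> part R p" and W: "list_all pure_ok W" using Cons.prems l by auto
  have tW: "map total W \<in> words letters" by (rule total_words[OF W])
  note G = Cons.prems(1) and A = Cons.prems(3)
  let ?W = "l # W" and ?c = "map cochain_part" and ?A = "Some (acc_mult R q A p b)"
  define c where "c k = G ((sdeg (take k ?W) + 1, transfer_m n (?c (take k ?W))) # ?c (drop k ?W))" for k
  \<comment> \<open>The second term of \<open>ext_modified_single\<close>, present only for the
    block of length 1.\<close>
  define X where "X = koszul (q * s + psign (q + p) W + s + sdeg W + 1) (scale (G ((s, v) # ?c W))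
      (rprod (q + p + 1) (Some (acc_mult R q A (p + 1) (diff R p b))) W))"
  have "ext q A G ((wdeg (take k (map total ?W)) + 1, m\<^sub>R (take k (map total ?W))) # drop k (map total ?W)) =
      koszul (psign q ?W + q) (scale (c k) (rprod q A ?W)) + (if k = 1 then X else 0)"
    if k: "k \<in> {1..Suc (length W)}" for k
  proof (cases "k = 1")
    case True
    show ?thesis
      using ext_modified_single[OF G lok W A]
      by (simp add: True c_def X_def l transfer_m_def del: ext_word.simps)
  next
    case False
    have ok: "list_all pure_ok (take k ?W)" "list_all pure_ok (drop k ?W)"
      using Cons.prems(2) by (metis append_take_drop_id list_all_append)+
    have "length (take k ?W) \<ge> 2" using k False by auto
    from ext_modified_long[OF G ok(1) this ok(2) A] show ?thesis
      using False by (simp only: c_def take_map drop_map append_take_drop_id if_False add_0_right)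
  qed
  then have "(\<Sum>k=1..Suc (length W). ext q A G ((wdeg (take k (map total ?W)) + 1,
      m\<^sub>R (take k (map total ?W))) # drop k (map total ?W))) =
      (\<Sum>k=1..Suc (length W). koszul (psign q ?W + q) (scale (c k) (rprod q A ?W)) + (if k = 1 then X else 0))"
    by (rule sum.cong[OF refl])
  also have "\<dots> = koszul (psign q ?W + q) (scale (\<Sum>k=1..Suc (length W). c k) (rprod q A ?W)) + X"
    by (simp add: sum.distrib koszul_sum scale_sum_left del: sum.cl_ivl_Suc psign.simps rprod.simps)
  finally have first: "(\<Sum>k=1..Suc (length W). ext q A G ((wdeg (take k (map total ?W)) + 1,
      m\<^sub>R (take k (map total ?W))) # drop k (map total ?W))) =
      koszul (psign q ?W + q) (scale (\<Sum>k=1..Suc (length W). c k) (rprod q A ?W)) + X" .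
  have "coder m\<^sub>R (\<lambda>u. ext q A G (total l # u)) (map total W) =
      coder m\<^sub>R (\<lambda>u. koszul (q * s) (ext (q + p) ?A (\<lambda>u. G ((s, v) # u)) u)) (map total W)"
    using ext_Cons_pure[OF G _ lok(2) _ A, of v s] lok(1)
    by (intro coder_cong_words tW) (simp add: l shift_def[of "N n"] del: ext_word.simps)
  also have "\<dots> = koszul (q * s) (koszul (psign (q + p) W + (q + p))
      (scale (coder (transfer_m n) (\<lambda>u. G ((s, v) # u)) (?c W)) (rprod (q + p) ?A W) +
       koszul (sdeg W + 1) (scale (G ((s, v) # ?c W)) (drprod (q + p) ?A W))))"
    unfolding coder_hom[where h = "koszul (q * s)", OF koszul_add]
    by (subst Cons.IH[OF multilin_Cons[OF G] W]) (simp_all add: acc_mult_part[OF A lok(2)])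
  finally have second: "coder m\<^sub>R (\<lambda>u. ext q A G (total l # u)) (map total W) =
      koszul (q * s) (koszul (psign (q + p) W + (q + p))
      (scale (coder (transfer_m n) (\<lambda>u. G ((s, v) # u)) (?c W)) (rprod (q + p) ?A W) +
       koszul (sdeg W + 1) (scale (G ((s, v) # ?c W)) (drprod (q + p) ?A W))))" .
  have "coder (transfer_m n) G (?c ?W) = (\<Sum>k=1..Suc (length W).
      G ((wdeg (take k (?c ?W)) + 1, transfer_m n (take k (?c ?W))) # drop k (?c ?W))) +
      koszul s (coder (transfer_m n) (\<lambda>u. G ((s, v) # u)) (?c W))"
    by (simp add: l del: sum.cl_ivl_Suc)
  then have c: "coder (transfer_m n) G (?c ?W) = (\<Sum>k=1..Suc (length W). c k) +
      koszul s (coder (transfer_m n) (\<lambda>u. G ((s, v) # u)) (?c W))"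
    by (simp only: c_def take_map drop_map)
  have u: "coder m\<^sub>R (ext q A G) (map total ?W) = (\<Sum>k=1..Suc (length W). ext q A G
      ((wdeg (take k (map total ?W)) + 1, m\<^sub>R (take k (map total ?W))) # drop k (map total ?W))) +
      koszul (s + p) (coder m\<^sub>R (\<lambda>u. ext q A G (total l # u)) (map total W))"
    by (simp add: l del: ext_word.simps sum.cl_ivl_Suc)
  have 1: "koszul (s + p) (koszul (q * s) (koszul (k + (q + p)) (x + koszul (S + 1) y))) =
      koszul (q * s + k + q + s) x + koszul (q * s + k + q + s + S + 1) y" for k S and x y :: 'a
    unfolding koszul_add koszul_koszul
    by (intro arg_cong2[of _ _ _ _ "(+)"] koszul_cong) simp_all
  have 2: "koszul (q * s + k + q) (scale (C + koszul s C') r + koszul (s + S + 1) (scale g (koszul q x + y))) =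
      koszul (q * s + k + q) (scale C r) + koszul (q * s + k + q + s) (scale C' r) +
      (koszul (q * s + k + s + S + 1) (scale g x) + koszul (q * s + k + q + s + S + 1) (scale g y))"
    for k S C C' g and r x y :: 'a
  proof -
    have "scale (koszul s C') r = koszul s (scale C' r)" by (simp add: koszul_def)
    then show ?thesis
      unfolding scale_left_distrib scale_right_distrib koszul_add koszul_scale[symmetric] koszul_koszul
      by (simp add: koszul_koszul) (intro arg_cong2[of _ _ _ _ "(+)"] koszul_cong refl; simp)
  qed
  have l': "psign q ?W = q * s + psign (q + p) W" "rprod q A ?W = rprod (q + p) ?A W"
    "drprod q A ?W = koszul q (rprod (q + p + 1) (Some (acc_mult R q A (p + 1) (diff R p b))) W) +
      drprod (q + p) ?A W"
    "?c ?W = (s, v) # ?c W" "sdeg ?W = s + sdeg W"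
    by (simp_all add: l)
  show ?case
    unfolding u first second c X_def l'(1-3,5) 1 2 unfolding l'(4) by (simp only: add.assoc add.commute add.left_commute)
qed simp

end

context coefficients
begin

subsection \<open>The relations for the extended operations\<close>

lemma rprod_lin:
  assumes "list_all pure_ok W" "a \<in> part R q" "a' \<in> part R q"
  shows "rprod q (Some (scale c a + a')) W = scale c (rprod q (Some a) W) + rprod q (Some a') W"
  using assms
proof (induction W arbitrary: q a a')
  case (Cons l W)
  obtain s v p b where l: "l = (s, v, p, b)" by (cases l)
  show ?case using Cons by (simp add: l acc_mult_def mult_lin_left mult_part)
qed simp

lemma rprod_add:
  assumes "list_all pure_ok W" "a \<in> part R q" "a' \<in> part R q"
  shows "rprod q (Some (a + a')) W = rprod q (Some a) W + rprod q (Some a') W"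
  using rprod_lin[OF assms, of 1] by simp

lemma rprod_koszul:
  assumes "list_all pure_ok W" "a \<in> part R q"
  shows "rprod q (Some (koszul k a)) W = koszul k (rprod q (Some a) W)"
  using rprod_lin[OF assms part_0, where c = "- 1"] rprod_lin[OF assms(1) part_0 part_0, where c = 1 and q = q]
  by (simp add: koszul_def)

lemma diff_rprod_Some:
  assumes "list_all pure_ok W" "a \<in> part R q"
  shows "diff R (q + rdeg W) (rprod q (Some a) W) =
    rprod (q + 1) (Some (diff R q a)) W + drprod q (Some a) W"
  using assms
proof (induction W arbitrary: q a)
  case (Cons l W)
  obtain s v p b where l: "l = (s, v, p, b)" by (cases l)
  have b: "b \<in> part R p" and W: "list_all pure_ok W" using Cons.prems l by auto
  note a = Cons.prems(2)
  have d: "dg_alg.mult R (q + 1) p (diff R q a) b \<in> part R (q + p + 1)"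
    "dg_alg.mult R q (p + 1) a (diff R p b) \<in> part R (q + p + 1)"
    using mult_part[OF diff_part[OF a] b] mult_part[OF a diff_part[OF b]] by (simp_all add: algebra_simps)
  have "diff R (q + rdeg (l # W)) (rprod q (Some a) (l # W)) =
      diff R (q + p + rdeg W) (rprod (q + p) (Some (dg_alg.mult R q p a b)) W)"
    by (simp add: l acc_mult_def add.assoc)
  also have "\<dots> = rprod (q + p + 1) (Some (diff R (q + p) (dg_alg.mult R q p a b))) W +
      drprod (q + p) (Some (dg_alg.mult R q p a b)) W"
    using Cons.IH[OF W mult_part[OF a b]] by simp
  also have "rprod (q + p + 1) (Some (diff R (q + p) (dg_alg.mult R q p a b))) W =
      rprod (q + p + 1) (Some (dg_alg.mult R (q + 1) p (diff R q a) b)) W +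
      koszul q (rprod (q + p + 1) (Some (dg_alg.mult R q (p + 1) a (diff R p b))) W)"
    unfolding leibniz[OF a b] by (simp add: rprod_add W d part_koszul rprod_koszul)
  finally show ?case by (simp add: l acc_mult_def add.assoc add.commute[of p 1])
qed simp

lemma diff_rprod:
  assumes "list_all pure_ok W" "W \<noteq> []"
  shows "diff R (rdeg W) (rprod 0 None W) = drprod 0 None W"
proof -
  obtain s v p b V where W: "W = (s, v, p, b) # V" using assms(2) by (cases W) auto
  show ?thesis
    using diff_rprod_Some[of V b p] assms(1) by (simp add: W acc_mult_def add.commute)
qed

lemma diff_0 [simp]: "diff R j 0 = 0"
  using diff_lin[of 0 j 0 1] by simp

lemma diff_scale: "a \<in> part R k \<Longrightarrow> diff R k (scale c a) = scale c (diff R k a)"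
  using diff_lin[of a k 0 c] by simp

lemma diff_koszul: "a \<in> part R k \<Longrightarrow> diff R k (koszul j a) = koszul j (diff R k a)"
  using diff_scale[of a k "- 1"] by (simp add: koszul_def)

text \<open>The relation for scalar cochains leaves only the Leibniz expansion of the product of
  coefficients. It cancels against the differential of \<open>R\<close> applied after the
  operation.\<close>

lemma coder_tensor_pure:
  assumes W: "list_all pure_ok W"
  shows "coder m\<^sub>R m\<^sub>R (map total W) = 0"
proof (cases "W = []")
  case False
  let ?w = "map total W" and ?mK = "transfer_m n (map cochain_part W)"
  show ?thesis
  proof
    fix \<tau>
    define D where "D l = (if \<tau> \<in> nondegenerate n then koszul (simplex_dim \<tau>)
      (diff R (fst l + 1 - simplex_dim \<tau>) (snd l \<tau>)) else 0)" for l
    have "coder m\<^sub>R m\<^sub>R ?w \<tau> = coder m\<^sub>R (\<lambda>u. m\<^sub>R u \<tau>) ?w"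
      by (rule coder_hom[where h = "\<lambda>f. f \<tau>", symmetric]) simp
    also have "\<dots> = coder m\<^sub>R (\<lambda>u. ext 0 None (\<lambda>s. transfer_m n s \<tau>) u + (if length u = 1 then D (hd u) else 0)) ?w"
      by (rule coder_cong) (auto simp: tensor_m_def D_def)
    also have "\<dots> = coder m\<^sub>R (ext 0 None (\<lambda>s. transfer_m n s \<tau>)) ?w + D (wdeg ?w + 1, m\<^sub>R ?w)"
      using False unfolding coder_add by (subst coder_length_1) auto
    also have "coder m\<^sub>R (ext 0 None (\<lambda>s. transfer_m n s \<tau>)) ?w =
        koszul (psign 0 W + sdeg W + 1) (scale (?mK \<tau>) (drprod 0 None W))"
    proof -
      have "coder (transfer_m n) (\<lambda>s. transfer_m n s \<tau>) (map cochain_part W) =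
          coder (transfer_m n) (transfer_m n) (map cochain_part W) \<tau>"
        by (rule coder_hom[where h = "\<lambda>f. f \<tau>"]) simp
      also have "\<dots> = 0" using coder_transfer_m_zero[OF cochain_words[OF W]] by simp
      finally show ?thesis
        using coder_ext[OF multilin_transfer W, of 0 None \<tau>] False by (simp add: koszul_koszul add.assoc)
    qed
    also have "\<dots> + D (wdeg ?w + 1, m\<^sub>R ?w) = 0"
    \<comment> \<open>On a single letter the operation itself contains the differential of
      \<open>R\<close>, so its square appears too.\<close>
    proof (cases "length W = 1")
      case True
      then obtain s v p b where l: "W = [(s, v, p, b)]" by (cases W) auto
      have v: "v \<in> N n (s + 1)" and b: "b \<in> part R p" using W by (auto simp: l shift_def[of "N n"])
      have m: "m\<^sub>R ?w \<tau> = scale (coboundary n v \<tau>) b + koszul (s + 1) (scale (v \<tau>) (diff R p b))"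
        using tensor_m_single[of v s b p] W
        by (simp add: l koszul_apply) (simp add: pure_tensor_def)
      have mK: "?mK = coboundary n v" by (simp add: l transfer_m_def)
      show ?thesis
      \<comment> \<open>The two parts of the operation on one letter live on simplices of different
        dimension, so at most one is nonzero at \<tau>.\<close>
      proof (cases "coboundary n v \<tau> = 0")
        case True
        have z: "diff R j (koszul (s + 1) (scale (v \<tau>) (diff R p b))) = 0"
          if "j = s + p + 2 - simplex_dim \<tau>" for j
        proof (cases "v \<tau> = 0")
          case False
          then have "simplex_dim \<tau> = s + 1" using v by (auto simp: N_def)
          then show ?thesis
            using diff_part[OF b] d_squared[OF b]
            by (simp add: that diff_koszul diff_scale part_scale add.commute)
        qed simp
        have "diff R (wdeg ?w + 1 + 1 - simplex_dim \<tau>) (koszul (s + 1) (scale (v \<tau>) (diff R p b))) = 0"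
          by (rule z) (simp add: l)
        then have "D (wdeg ?w + 1, m\<^sub>R ?w) = 0"
          unfolding D_def fst_conv snd_conv m True by simp
        then show ?thesis by (simp add: mK True)
      next
        case False
        then have t: "\<tau> \<in> nondegenerate n" "simplex_dim \<tau> = s + 2"
          using coboundary_N[OF v] by (auto simp: N_def)
        then have "v \<tau> = 0" using v by (auto simp: N_def)
        then show ?thesis
          using t b by (simp add: mK D_def m diff_scale)
            (simp add: l acc_mult_def diff_scale koszul_def)
      qed
    next
      case False
      then have len: "length W \<ge> 2" using \<open>W \<noteq> []\<close> by (cases W; cases "tl W") auto
      have m: "m\<^sub>R ?w \<tau> = koszul (psign 0 W) (scale (?mK \<tau>) (rprod 0 None W))"
        unfolding tensor_m_pure[OF W len] koszul_apply by (simp add: pure_tensor_def)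
      show ?thesis
      proof (cases "?mK \<tau> = 0")
        case False
        have r: "rprod 0 None W \<in> part R (rdeg W)" using rprod_part[OF W, of 0 None] \<open>W \<noteq> []\<close> by simp
        have t: "\<tau> \<in> nondegenerate n" "simplex_dim \<tau> = sdeg W + 2"
          using transfer_m_dim[OF W \<open>W \<noteq> []\<close> False] by auto
        then have "D (wdeg ?w + 1, m\<^sub>R ?w) = koszul (sdeg W + 2)
            (koszul (psign 0 W) (scale (?mK \<tau>) (drprod 0 None W)))"
          using r by (simp add: D_def m wdeg_total diff_koszul diff_scale part_scale diff_rprod[OF W \<open>W \<noteq> []\<close>])
        then show ?thesis by (simp add: koszul_koszul) (simp add: koszul_def)
      qed (simp add: D_def m)
    qed
    finally show "coder m\<^sub>R m\<^sub>R ?w \<tau> = 0 \<tau>" by simp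
  qed
qed simp

text \<open>Additivity holds wherever the letter lies: before, inside or after the block. It is the
  hypothesis under which the relation can be tested on pure words.\<close>

lemma coder_additive:
  fixes F :: "(nat list \<Rightarrow> 'a) word \<Rightarrow> 'c::ab_group_add"
  assumes F: "\<And>u v k x y. u \<in> words letters \<Longrightarrow> v \<in> words letters \<Longrightarrow> x \<in> letters k \<Longrightarrow> y \<in> letters k \<Longrightarrow>
      F (u @ (k, x + y) # v) = F (u @ (k, x) # v) + F (u @ (k, y) # v)"
    and uv: "u \<in> words letters" "v \<in> words letters" and xy: "x \<in> letters k" "y \<in> letters k"
  shows "coder m\<^sub>R F (u @ (k, x + y) # v) = coder m\<^sub>R F (u @ (k, x) # v) + coder m\<^sub>R F (u @ (k, y) # v)"
  using F uv
proof (induction u arbitrary: F)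
  case Nil
  note F = Nil.prems(1)
  let ?w = "\<lambda>z. (k, z) # v"
  let ?t = "\<lambda>z j. F ((wdeg (take j (?w z)) + 1, m\<^sub>R (take j (?w z))) # drop j (?w z))"
  have "?t (x + y) j = ?t x j + ?t y j" if j1: "j \<in> {1..Suc (length v)}" for j
  proof -
    obtain i where j: "j = Suc i" using j1 by (cases j) auto
    have tv: "take i v \<in> words letters" "drop i v \<in> words letters"
      using Nil.prems by (auto intro: words_take words_drop)
    have "m\<^sub>R ((k, x) # take i v) \<in> letters (k + wdeg (take i v) + 1)"
      "m\<^sub>R ((k, y) # take i v) \<in> letters (k + wdeg (take i v) + 1)"
      using tensor_m_letter[of "(k, x) # take i v"] tensor_m_letter[of "(k, y) # take i v"] tv xy by simp_all
    note f = F[OF words_simps(1) tv(2) this, unfolded append_Nil]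
    note m = tensor_m_add[OF words_simps(1) tv(1) xy, unfolded append_Nil]
    show ?thesis
      by (simp only: j take_Suc_Cons drop_Suc_Cons wdeg_simps fst_conv m f)
  qed
  then have "(\<Sum>j=1..Suc (length v). ?t (x + y) j) = (\<Sum>j=1..Suc (length v). ?t x j) + (\<Sum>j=1..Suc (length v). ?t y j)"
    unfolding sum.distrib[symmetric] by (rule sum.cong[OF refl])
  moreover have "coder m\<^sub>R (\<lambda>w. F ((k, x + y) # w)) v =
      coder m\<^sub>R (\<lambda>w. F ((k, x) # w)) v + coder m\<^sub>R (\<lambda>w. F ((k, y) # w)) v"
    unfolding coder_add[symmetric]
    by (rule coder_cong_words, rule F[OF words_simps(1) _ xy, unfolded append_Nil], assumption, rule Nil.prems(3))
  ultimately show ?case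
    unfolding append_Nil coder.simps fst_conv
    by (simp only: koszul_add add.assoc add.left_commute add.commute)
next
  case (Cons l u)
  note F = Cons.prems(1)
  let ?w = "\<lambda>z. l # u @ (k, z) # v"
  let ?t = "\<lambda>z j. F ((wdeg (take j (?w z)) + 1, m\<^sub>R (take j (?w z))) # drop j (?w z))"
  obtain i z where l: "l = (i, z)" by (cases l)
  have lu: "l # u \<in> words letters" using Cons.prems by simp
  have "?t (x + y) j = ?t x j + ?t y j" if j: "j \<in> {1..length (l # u) + Suc (length v)}" for j
  proof (cases "j \<le> length (l # u)")
    case True
    have tu: "take j (l # u) \<in> words letters" "drop j (l # u) \<in> words letters" "take j (l # u) \<noteq> []"
      using lu j by (auto intro!: words_take words_drop simp del: words_simps(2) take_Cons' drop_Cons')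
    have w: "take j (?w z) = take j (l # u)" "drop j (?w z) = drop j (l # u) @ (k, z) # v" for z
      using True by (simp_all only: append_Cons[symmetric] take_append drop_append) simp_all
    have "(wdeg (take j (l # u)) + 1, m\<^sub>R (take j (l # u))) # drop j (l # u) \<in> words letters"
      using tensor_m_letter[OF tu(1,3)] tu(2) by simp
    from F[OF this Cons.prems(3) xy] show ?thesis unfolding w append_Cons .
  next
    case False
    define r where "r = j - length (l # u) - 1"
    have w: "take j (?w z) = (l # u) @ (k, z) # take r v" "drop j (?w z) = drop r v" for z
      using False by (simp_all only: append_Cons[symmetric] take_append drop_append) (simp_all add: r_def take_Cons' drop_Cons')
    have tv: "take r v \<in> words letters" "drop r v \<in> words letters"
      using Cons.prems by (auto intro: words_take words_drop)
    have mem: "(l # u) @ (k, z) # take r v \<in> words letters" if "z \<in> letters k" for z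
      by (simp only: words_simps(3)[of "l # u"] words_simps(2) lu tv that simp_thms)
    have m: "m\<^sub>R ((l # u) @ (k, z) # take r v) \<in> letters (wdeg ((l # u) @ (k, z) # take r v) + 1)"
      if "z \<in> letters k" for z
      using tensor_m_letter[OF mem[OF that]] by simp
    have wd: "wdeg ((l # u) @ (k, z) # take r v) = wdeg (l # u) + k + wdeg (take r v)"
      for z :: "nat list \<Rightarrow> 'a" by simp
    note f = F[OF words_simps(1) tv(2) m[OF xy(1), unfolded wd] m[OF xy(2), unfolded wd],
      unfolded append_Nil]
    show ?thesis unfolding w tensor_m_add[OF lu tv(1) xy] wd by (rule f)
  qed
  then have "(\<Sum>j=1..length (l # u) + Suc (length v). ?t (x + y) j) =
      (\<Sum>j=1..length (l # u) + Suc (length v). ?t x j) + (\<Sum>j=1..length (l # u) + Suc (length v). ?t y j)"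
    unfolding sum.distrib[symmetric] by (rule sum.cong[OF refl])
  moreover have "coder m\<^sub>R (\<lambda>w. F (l # w)) (u @ (k, x + y) # v) =
      coder m\<^sub>R (\<lambda>w. F (l # w)) (u @ (k, x) # v) + coder m\<^sub>R (\<lambda>w. F (l # w)) (u @ (k, y) # v)"
    using Cons.prems F[of "l # _"] by (intro Cons.IH) (auto simp: l)
  moreover have len: "Suc (length (u @ (k, z) # v)) = length (l # u) + Suc (length v)"
    for z :: "nat list \<Rightarrow> 'a" by simp
  ultimately show ?case
    unfolding append_Cons coder.simps len
    by (simp only: koszul_add add.assoc add.left_commute add.commute)
qed

theorem coder_tensor:
  assumes "w \<in> words letters"
  shows "coder m\<^sub>R m\<^sub>R w = 0"
proof -
  have "coder m\<^sub>R m\<^sub>R w \<in> {0}"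
    by (rule pure_extension[OF _ _ _ _ assms]) (auto simp: coder_tensor_pure intro!: coder_additive tensor_m_add)
  then show ?thesis by simp
qed

section \<open>Shuffles of words with coefficients\<close>

lemma shuffle_sum_cong_words:
  assumes "\<And>w. w \<in> words V \<Longrightarrow> F w = G w" "u \<in> words V" "v \<in> words V"
  shows "shuffle_sum F u v = shuffle_sum G u v"
  using assms
proof (induction u v arbitrary: F G rule: signed_shuffles.induct)
  case (3 a u b v)
  have "shuffle_sum (\<lambda>w. F (a # w)) u (b # v) = shuffle_sum (\<lambda>w. G (a # w)) u (b # v)"
    using "3.prems" by (intro 3(1)) (auto simp: words_def)
  moreover have "shuffle_sum (\<lambda>w. F (b # w)) (a # u) v = shuffle_sum (\<lambda>w. G (b # w)) (a # u) v"
    using "3.prems" by (intro 3(2)) (auto simp: words_def)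
  ultimately show ?case by simp
qed simp_all

text \<open>Graded commutativity is applied once, to the product of the whole block
  \<open>U\<close>. An empty block is separate, as \<open>R\<close> may have no unit to stand for
  its product.\<close>

lemma rprod_swap:
  assumes U: "list_all pure_ok U" and V: "list_all pure_ok V" and l: "pure_ok (s, v, p, b)"
    and A: "acc_ok q A"
  shows "rprod q A ((s, v, p, b) # U @ V) = koszul (p * rdeg U) (rprod q A (U @ (s, v, p, b) # V))"
proof (cases "U = []")
  case False
  let ?l = "(s, v, p, b)"
  let ?r = "rprod 0 None U" and ?P = "rdeg U"
  have b: "b \<in> part R p" and r: "?r \<in> part R ?P"
    using l rprod_part[OF U, of 0 None] False by auto
  have 1: "rprod 0 None (?l # U) = dg_alg.mult R p ?P b ?r"
    using rprod_block[OF U False, of p "Some b"] b by (simp add: acc_mult_def)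
  have 2: "rprod 0 None (U @ [?l]) = dg_alg.mult R ?P p ?r b"
    using rprod_append[of None U 0 "[?l]"] False by (simp add: acc_mult_def)
  have ok: "list_all pure_ok (?l # U)" "list_all pure_ok (U @ [?l])" using U l by auto
  have "dg_alg.mult R p ?P b ?r = koszul (p * ?P) (dg_alg.mult R ?P p ?r b)"
    by (rule mult_graded_comm[OF b r])
  moreover have "acc_mult R q A (p + ?P) (koszul k x) = koszul k (acc_mult R q A (p + ?P) x)"
    if "x \<in> part R (p + ?P)" for k x
    using acc_mult_lin[OF A that part_0, where c = "- 1"]
      acc_mult_lin[OF A part_0 part_0, where c = 1 and p = "p + ?P"]
    by (simp add: koszul_def)
  moreover have m: "dg_alg.mult R ?P p ?r b \<in> part R (p + ?P)"
    using mult_part[OF r b] by (simp add: add.commute)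
  ultimately have "rprod q A (?l # U) = koszul (p * ?P) (rprod q A (U @ [?l]))"
    using rprod_block[OF ok(1) _ A] rprod_block[OF ok(2) _ A] by (simp add: 1 2 add.commute[of ?P p] del: rprod.simps)
  moreover have "rprod q A (U @ [?l]) \<in> part R (q + p + ?P)"
    using rprod_part[OF ok(2) A] by (simp add: algebra_simps)
  moreover have "rprod q A (?l # U @ V) = rprod (q + p + ?P) (Some (rprod q A (?l # U))) V"
    using rprod_append[of A "?l # U" q V] by (simp add: add.assoc)
  moreover have "rprod q A (U @ ?l # V) = rprod (q + p + ?P) (Some (rprod q A (U @ [?l]))) V"
    using rprod_append[of A "U @ [?l]" q V] by (simp add: ac_simps)
  ultimately show ?thesis using rprod_koszul[OF V] by (simp del: rprod.simps)
qed simp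

text \<open>All shuffles have the same product of coefficients up to sign. When a letter of
  \<open>V\<close> passes \<open>U\<close>, the commutation of coefficients and the change in
  \<open>psign\<close> use up the Koszul sign of total degrees, except for the product of cochain
  degrees, which is the sign of the scalar shuffle.\<close>

lemma shuffle_ext:
  assumes "multilin G" "list_all pure_ok U" "list_all pure_ok V" "acc_ok q A" "A \<noteq> None \<or> U @ V \<noteq> []"
  shows "shuffle_sum (ext q A G) (map total U) (map total V) = koszul (psign q (U @ V))
    (scale (shuffle_sum G (map cochain_part U) (map cochain_part V)) (rprod q A (U @ V)))"
  using assms
proof (induction "length U + length V" arbitrary: U V q A G rule: less_induct)
  case less
  note G = less.prems(1) and U = less.prems(2) and V = less.prems(3) and A = less.prems(4)
  show ?case
  proof (cases "U = [] \<or> V = []")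
    case True
    then show ?thesis
      using ext_pure[OF G V A] ext_pure[OF G U A] less.prems(5) by (auto simp del: ext_word.simps)
  next
    case False
    then obtain a U' c V' where UV: "U = a # U'" "V = c # V'" by (metis list.exhaust)
    obtain s v p b where a: "a = (s, v, p, b)" by (cases a)
    obtain s' v' p' b' where c: "c = (s', v', p', b')" by (cases c)
    have ok: "v \<in> cochains n s" "b \<in> part R p" "v' \<in> cochains n s'" "b' \<in> part R p'"
      "list_all pure_ok U'" "list_all pure_ok V'"
      using U V by (auto simp: UV a c)
    have words: "map total U \<in> words letters" "map total V \<in> words letters"
      "map total U' \<in> words letters" "map total V' \<in> words letters"
      using U V ok by (auto intro: total_words)
    have 1: "shuffle_sum (\<lambda>w. ext q A G (total a # w)) (map total U') (map total V) =
        koszul (psign q (U @ V)) (scale (shuffle_sum (\<lambda>w. G ((s, v) # w)) (map cochain_part U') (map cochain_part V))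
        (rprod q A (U @ V)))"
    proof -
      have "shuffle_sum (\<lambda>w. ext q A G (total a # w)) (map total U') (map total V) =
          shuffle_sum (\<lambda>w. koszul (q * s) (ext (q + p) (Some (acc_mult R q A p b)) (\<lambda>w. G ((s, v) # w)) w))
            (map total U') (map total V)"
        using ext_Cons_pure[OF G _ ok(2) _ A, of v s] ok(1) words
        by (intro shuffle_sum_cong_words[where V = letters]) (simp_all add: a shift_def[of "N n"] del: ext_word.simps)
      also have "\<dots> = koszul (q * s) (koszul (psign (q + p) (U' @ V))
          (scale (shuffle_sum (\<lambda>w. G ((s, v) # w)) (map cochain_part U') (map cochain_part V))
            (rprod (q + p) (Some (acc_mult R q A p b)) (U' @ V))))"
        unfolding shuffle_sum_hom[where h = "koszul (q * s)", OF koszul_add]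
        by (subst less.hyps[OF _ multilin_Cons[OF G] ok(5) V]) (simp_all add: UV(1) acc_mult_part[OF A ok(2)])
      finally show ?thesis by (simp add: UV(1) a koszul_koszul)
    qed
    have 2: "shuffle_sum (\<lambda>w. ext q A G (total c # w)) (map total U) (map total V') =
        koszul (psign q (c # U @ V')) (scale (shuffle_sum (\<lambda>w. G ((s', v') # w)) (map cochain_part U) (map cochain_part V'))
        (rprod q A (c # U @ V')))"
    proof -
      have "shuffle_sum (\<lambda>w. ext q A G (total c # w)) (map total U) (map total V') =
          shuffle_sum (\<lambda>w. koszul (q * s') (ext (q + p') (Some (acc_mult R q A p' b')) (\<lambda>w. G ((s', v') # w)) w))
            (map total U) (map total V')"
        using ext_Cons_pure[OF G _ ok(4) _ A, of v' s'] ok(3) words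
        by (intro shuffle_sum_cong_words[where V = letters]) (simp_all add: c shift_def[of "N n"] del: ext_word.simps)
      also have "\<dots> = koszul (q * s') (koszul (psign (q + p') (U @ V'))
          (scale (shuffle_sum (\<lambda>w. G ((s', v') # w)) (map cochain_part U) (map cochain_part V'))
            (rprod (q + p') (Some (acc_mult R q A p' b')) (U @ V'))))"
        unfolding shuffle_sum_hom[where h = "koszul (q * s')", OF koszul_add]
        by (subst less.hyps[OF _ multilin_Cons[OF G] U ok(6)]) (simp_all add: UV(2) acc_mult_part[OF A ok(4)])
      finally show ?thesis by (simp add: c koszul_koszul)
    qed
    \<comment> \<open>With \<open>c\<close> moved in front of \<open>U\<close>, its coefficient has
      to pass the cochains of \<open>U\<close>, while the coefficients of \<open>U\<close> no longer
      pass its cochain.\<close>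
    have sign: "psign q (c # U @ V') = psign q (U @ V) + p' * sdeg U - rdeg U * s'"
      using psign_shift[of "q" p' "U @ V'"] psign_shift[of "q + rdeg U" p' V'] psign_shift[of q "rdeg U" V']
      by (simp add: c UV(2) psign_append algebra_simps)
    have "shuffle_sum (ext q A G) (map total U) (map total V) =
        shuffle_sum (\<lambda>w. ext q A G (total a # w)) (map total U') (map total V) +
        koszul ((s' + p') * (sdeg U + rdeg U)) (shuffle_sum (\<lambda>w. ext q A G (total c # w)) (map total U) (map total V'))"
    proof -
      have "wdeg (total a # map total U') = sdeg U + rdeg U"
        using wdeg_total[of U] by (simp add: UV(1))
      then show ?thesis by (simp add: UV c del: ext_word.simps wdeg_simps)
    qed
    also have "\<dots> = koszul (psign q (U @ V)) (scale (shuffle_sum (\<lambda>w. G ((s, v) # w)) (map cochain_part U') (map cochain_part V))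
        (rprod q A (U @ V))) +
        koszul (psign q (U @ V) + s' * sdeg U) (scale (shuffle_sum (\<lambda>w. G ((s', v') # w)) (map cochain_part U) (map cochain_part V'))
        (rprod q A (U @ V)))"
    proof -
      have "rprod q A (c # U @ V') = koszul (p' * rdeg U) (rprod q A (U @ V))"
        using rprod_swap[OF U ok(6) _ A, of s' v' p' b'] ok by (simp add: c UV(2))
      then have "koszul ((s' + p') * (sdeg U + rdeg U)) (koszul (psign q (c # U @ V'))
          (scale g (rprod q A (c # U @ V')))) = koszul (psign q (U @ V) + s' * sdeg U) (scale g (rprod q A (U @ V)))" for g
        unfolding sign by (simp add: koszul_koszul flip: koszul_scale) (rule koszul_cong, simp add: algebra_simps)
      then show ?thesis unfolding 1 2 by simp
    qed
    also have "\<dots> = koszul (psign q (U @ V)) (scale (shuffle_sum G (map cochain_part U) (map cochain_part V)) (rprod q A (U @ V)))"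
    proof -
      have "scale (koszul k g) x = koszul k (scale g x)" for k g and x :: 'a by (simp add: koszul_def)
      moreover have "shuffle_sum G (map cochain_part U) (map cochain_part V) =
          shuffle_sum (\<lambda>w. G ((s, v) # w)) (map cochain_part U') (map cochain_part V) +
          koszul (s' * sdeg U) (shuffle_sum (\<lambda>w. G ((s', v') # w)) (map cochain_part U) (map cochain_part V'))"
        by (simp add: UV a c)
      ultimately show ?thesis by (simp add: scale_left_distrib koszul_add koszul_koszul del: shuffle_sum_simps)
    qed
    finally show ?thesis .
  qed
qed

lemma shuffle_tensor_pure:
  assumes U: "list_all pure_ok U" "U \<noteq> []" and V: "list_all pure_ok V" "V \<noteq> []"
  shows "shuffle_sum m\<^sub>R (map total U) (map total V) = 0"
proof
  fix \<tau>
  have "shuffle_sum m\<^sub>R (map total U) (map total V) \<tau> = shuffle_sum (\<lambda>w. m\<^sub>R w \<tau>) (map total U) (map total V)"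
    by (rule shuffle_sum_hom[where h = "\<lambda>f. f \<tau>", symmetric]) simp
  also have "\<dots> = shuffle_sum (ext 0 None (\<lambda>s. transfer_m n s \<tau>)) (map total U) (map total V)"
  proof (rule shuffle_sum_cong)
    fix w :: "(nat list \<Rightarrow> 'a) word"
    assume "length w = length (map total U) + length (map total V)"
    then have "length w \<noteq> 1" using U V by (cases U; cases V) auto
    then show "m\<^sub>R w \<tau> = ext 0 None (\<lambda>s. transfer_m n s \<tau>) w" by (simp add: tensor_m_def)
  qed
  also have "\<dots> = koszul (psign 0 (U @ V)) (scale (shuffle_sum (\<lambda>s. transfer_m n s \<tau>)
      (map cochain_part U) (map cochain_part V)) (rprod 0 None (U @ V)))"
    by (rule shuffle_ext[OF multilin_transfer U(1) V(1)]) (use U in auto)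
  also have "shuffle_sum (\<lambda>s. transfer_m n s \<tau>) (map cochain_part U) (map cochain_part V) =
      shuffle_sum (transfer_m n) (map cochain_part U) (map cochain_part V) \<tau>"
    by (rule shuffle_sum_hom[where h = "\<lambda>f. f \<tau>"]) simp
  also have "\<dots> = 0"
    using shuffle_transfer_m[OF cochain_words[OF U(1)] cochain_words[OF V(1)]] U V by simp
  finally show "shuffle_sum m\<^sub>R (map total U) (map total V) \<tau> = 0 \<tau>" by simp
qed

lemma
  fixes F :: "(nat list \<Rightarrow> 'a) word \<Rightarrow> 'c::ab_group_add"
  assumes F: "\<And>u v k x y. u \<in> words letters \<Longrightarrow> v \<in> words letters \<Longrightarrow> x \<in> letters k \<Longrightarrow> y \<in> letters k \<Longrightarrow>
      F (u @ (k, x + y) # v) = F (u @ (k, x) # v) + F (u @ (k, y) # v)"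
    and uv: "u \<in> words letters" "v \<in> words letters" "w \<in> words letters" and xy: "x \<in> letters k" "y \<in> letters k"
  shows shuffle_sum_additive_left: "shuffle_sum F (u @ (k, x + y) # v) w =
      shuffle_sum F (u @ (k, x) # v) w + shuffle_sum F (u @ (k, y) # v) w"
    and shuffle_sum_additive_right: "shuffle_sum F w (u @ (k, x + y) # v) =
      shuffle_sum F w (u @ (k, x) # v) + shuffle_sum F w (u @ (k, y) # v)"
proof -
  have "shuffle_sum F (u @ (k, x + y) # v) w =
      shuffle_sum F (u @ (k, x) # v) w + shuffle_sum F (u @ (k, y) # v) w \<and>
    shuffle_sum F w (u @ (k, x + y) # v) =
      shuffle_sum F w (u @ (k, x) # v) + shuffle_sum F w (u @ (k, y) # v)"
    using F uv
  proof (induction "length u + length w" arbitrary: u w F rule: less_induct)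
    case less
    note F = less.prems(1)
    show ?case
    proof (cases w)
      case Nil
      then show ?thesis using F[OF less.prems(2,3) xy] by simp
    next
      case (Cons c w')
      have Fc: "F (c # u @ (k, x + y) # v) = F (c # u @ (k, x) # v) + F (c # u @ (k, y) # v)"
        if "u \<in> words letters" "v \<in> words letters" "x \<in> letters k" "y \<in> letters k" for u v x k y
        using F[of "c # u" v x k y] that less.prems(4) Cons by (cases c) simp
      have w': "w' \<in> words letters" using less.prems(4) Cons by (cases c) simp
      have c: "shuffle_sum (\<lambda>w. F (c # w)) (u @ (k, x + y) # v) w' =
          shuffle_sum (\<lambda>w. F (c # w)) (u @ (k, x) # v) w' + shuffle_sum (\<lambda>w. F (c # w)) (u @ (k, y) # v) w'"
        "shuffle_sum (\<lambda>w. F (c # w)) w' (u @ (k, x + y) # v) =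
          shuffle_sum (\<lambda>w. F (c # w)) w' (u @ (k, x) # v) + shuffle_sum (\<lambda>w. F (c # w)) w' (u @ (k, y) # v)"
        using less.hyps[of u w' "\<lambda>w. F (c # w)", OF _ Fc less.prems(2,3) w'] Cons by simp_all
      show ?thesis
      proof (cases u)
        case Nil
        have F0: "F ((k, x + y) # w) = F ((k, x) # w) + F ((k, y) # w)" if "w \<in> words letters" for w
          using F[of "[]" w] that xy by simp
        have "shuffle_sum (\<lambda>w. F ((k, x + y) # w)) v w =
            shuffle_sum (\<lambda>w. F ((k, x) # w)) v w + shuffle_sum (\<lambda>w. F ((k, y) # w)) v w"
          "shuffle_sum (\<lambda>w. F ((k, x + y) # w)) w v =
            shuffle_sum (\<lambda>w. F ((k, x) # w)) w v + shuffle_sum (\<lambda>w. F ((k, y) # w)) w v"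
          unfolding shuffle_sum_add[symmetric]
          using less.prems(3,4) by (auto intro!: shuffle_sum_cong_words[where V = letters] F0)
        then show ?thesis using c by (simp add: Nil Cons koszul_add)
      next
        case (Cons a u')
        have Fa: "F (a # u @ (k, x + y) # v) = F (a # u @ (k, x) # v) + F (a # u @ (k, y) # v)"
          if "u \<in> words letters" "v \<in> words letters" "x \<in> letters k" "y \<in> letters k" for u v x k y
          using F[of "a # u" v x k y] that less.prems(2) Cons by (cases a) simp
        have u': "u' \<in> words letters" using less.prems(2) Cons by (cases a) simp
        have "shuffle_sum (\<lambda>w. F (a # w)) (u' @ (k, x + y) # v) w =
            shuffle_sum (\<lambda>w. F (a # w)) (u' @ (k, x) # v) w + shuffle_sum (\<lambda>w. F (a # w)) (u' @ (k, y) # v) w"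
          "shuffle_sum (\<lambda>w. F (a # w)) w (u' @ (k, x + y) # v) =
            shuffle_sum (\<lambda>w. F (a # w)) w (u' @ (k, x) # v) + shuffle_sum (\<lambda>w. F (a # w)) w (u' @ (k, y) # v)"
          using less.hyps[of u' w "\<lambda>w. F (a # w)", OF _ Fa u' less.prems(3,4)] Cons by simp_all
        then show ?thesis using c by (simp add: \<open>w = c # w'\<close> Cons koszul_add)
      qed
    qed
  qed
  then show "shuffle_sum F (u @ (k, x + y) # v) w =
      shuffle_sum F (u @ (k, x) # v) w + shuffle_sum F (u @ (k, y) # v) w"
    "shuffle_sum F w (u @ (k, x + y) # v) =
      shuffle_sum F w (u @ (k, x) # v) + shuffle_sum F w (u @ (k, y) # v)" by blast+
qed

theorem shuffle_tensor:
  assumes "u \<in> words letters" "v \<in> words letters" "u \<noteq> []" "v \<noteq> []"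
  shows "shuffle_sum m\<^sub>R u v = 0"
proof -
  have 1: "shuffle_sum m\<^sub>R (map total U) v = 0"
    if U: "list_all pure_ok U" "U \<noteq> []" and v: "v \<in> words letters" "v \<noteq> []" for U v
  proof -
    \<comment> \<open>A shuffle with the empty word need not vanish; the guard excludes it.\<close>
    let ?T = "\<lambda>v. if v \<noteq> [] then shuffle_sum m\<^sub>R (map total U) v else 0"
    have "?T v \<in> {0}"
    proof (rule pure_extension[where T = ?T, OF _ _ _ _ v(1)])
      fix u v x y and k :: int
      assume "u \<in> words letters" "v \<in> words letters" "x \<in> letters k" "y \<in> letters k"
      from shuffle_sum_additive_right[where F = "m\<^sub>R", OF tensor_m_add this(1,2) total_words[OF U(1)] this(3,4)]
      show "?T (u @ (k, x + y) # v) = ?T (u @ (k, x) # v) + ?T (u @ (k, y) # v)" by simp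
    qed (use U in \<open>auto simp: shuffle_tensor_pure\<close>)
    then show ?thesis using v by simp
  qed
  let ?T = "\<lambda>u. if u \<noteq> [] then shuffle_sum m\<^sub>R u v else 0"
  have "?T u \<in> {0}"
  proof (rule pure_extension[where T = ?T, OF _ _ _ _ assms(1)])
    fix u w x y and k :: int
    assume "u \<in> words letters" "w \<in> words letters" "x \<in> letters k" "y \<in> letters k"
    from shuffle_sum_additive_left[where F = "m\<^sub>R", OF tensor_m_add this(1,2) assms(2) this(3,4)]
    show "?T (u @ (k, x + y) # w) = ?T (u @ (k, x) # w) + ?T (u @ (k, y) # w)" by simp
  qed (use 1[OF _ _ assms(2,4)] in auto)
  then show ?thesis using assms by simp
qed

end

context coefficients
begin

section \<open>The differential and the identity with coefficients\<close>

lemma N_tensor_diff_linear: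
  assumes "x \<in> letters k" "y \<in> letters k"
  shows "N_tensor_diff n (diff R) (k + 1) (pointwise scale c x + y) =
    pointwise scale c (N_tensor_diff n (diff R) (k + 1) x) + N_tensor_diff n (diff R) (k + 1) y"
proof
  fix \<tau>
  show "N_tensor_diff n (diff R) (k + 1) (pointwise scale c x + y) \<tau> =
    (pointwise scale c (N_tensor_diff n (diff R) (k + 1) x) + N_tensor_diff n (diff R) (k + 1) y) \<tau>"
    using diff_lin[OF letter_part[OF assms(1)] letter_part[OF assms(2)], of \<tau> c]
    by (simp add: N_tensor_diff_def pointwise_def coboundary_def koszul_add koszul_scale sum.distrib
        scale_sum_right scale_right_distrib)
qed

lemma tensor_m_single_letter:
  assumes "x \<in> letters k"
  shows "m\<^sub>R [(k, x)] = N_tensor_diff n (diff R) (k + 1) x"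
proof -
  let ?T = "\<lambda>w. if length w = 1 then m\<^sub>R w - N_tensor_diff n (diff R) (fst (hd w) + 1) (snd (hd w)) else 0"
  have "?T [(k, x)] \<in> {0}"
  proof (rule pure_extension[where T = ?T])
    fix u v x y and k :: int
    assume uv: "u \<in> words letters" "v \<in> words letters" and xy: "x \<in> letters k" "y \<in> letters k"
    have "pointwise scale 1 z = z" for z :: "nat list \<Rightarrow> 'a" by (auto simp: pointwise_def)
    then have "N_tensor_diff n (diff R) (k + 1) (x + y) =
        N_tensor_diff n (diff R) (k + 1) x + N_tensor_diff n (diff R) (k + 1) y"
      using N_tensor_diff_linear[OF xy, of 1] by metis
    then show "?T (u @ (k, x + y) # v) = ?T (u @ (k, x) # v) + ?T (u @ (k, y) # v)"
      using tensor_m_add[OF uv xy] by (cases u; cases v) (auto simp: algebra_simps)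
  next
    fix W assume W: "list_all pure_ok W"
    show "?T (map total W) \<in> {0}"
    proof (cases "length W = 1")
      case True
      then obtain s v p b where l: "W = [(s, v, p, b)]" by (cases W) auto
      then have "v \<in> cochains n s" "b \<in> part R p" using W by auto
      then have "m\<^sub>R (map total W) = N_tensor_diff n (diff R) (s + p + 1) (pure_tensor scale v b)"
        using tensor_m_single[of v s b p]
          N_tensor_diff_pure[OF cochain_complex_axioms, of v n "s + 1" b "s + p + 1"]
        by (simp add: l shift_def[of "N n"])
      then show ?thesis by (simp add: l)
    qed simp
  qed (use assms in auto)
  then show ?thesis by simp
qed

lemma N_tensor_diff_letter: "x \<in> letters k \<Longrightarrow> N_tensor_diff n (diff R) (k + 1) x \<in> letters (k + 1)"
  using tensor_m_letter[of "[(k, x)]"] by (simp add: tensor_m_single_letter)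

text \<open>The relation on words of one letter, read as a statement about the differential.\<close>

lemma N_tensor_diff_squared:
  assumes "x \<in> letters k"
  shows "N_tensor_diff n (diff R) (k + 2) (N_tensor_diff n (diff R) (k + 1) x) = 0"
proof -
  have "coder m\<^sub>R m\<^sub>R [(k, x)] = 0" using assms by (intro coder_tensor) simp
  then show ?thesis
    using tensor_m_single_letter[OF assms] tensor_m_single_letter[OF N_tensor_diff_letter[OF assms]]
    by (simp add: add.assoc)
qed

context
  fixes e
  assumes e: "is_one R e"
begin

abbreviation "unit_letter \<equiv> (- 1 :: int, unit_cochain n :: nat list \<Rightarrow> 'k, 0 :: int, e)"

lemma one_part: "e \<in> part R 0"
  and mult_one: "a \<in> part R p \<Longrightarrow> dg_alg.mult R 0 p e a = a" "a \<in> part R p \<Longrightarrow> dg_alg.mult R p 0 a e = a"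
  using e by (auto simp: is_one_def)

text \<open>The Leibniz rule for \<open>e\<close> written as its own square.\<close>

lemma diff_one: "diff R 0 e = 0"
proof -
  have d: "diff R 0 e \<in> part R 1" using diff_part[OF one_part] by simp
  have "diff R 0 e = diff R 0 e + diff R 0 e"
    using leibniz[OF one_part one_part] by (simp add: mult_one one_part d)
  then show ?thesis by simp
qed

lemma unit_letter_ok: "pure_ok unit_letter"
  by (simp add: one_part mem_cochains unit_cochain_N)

lemma unit_in_letters: "pure_tensor scale (unit_cochain n) e \<in> letters (- 1)"
  using pure_letter[of "unit_cochain n" "- 1" e 0] unit_letter_ok by simp

lemma tensor_m_unit_1: "m\<^sub>R [(- 1, pure_tensor scale (unit_cochain n) e)] = 0"
  using tensor_m_single[of "unit_cochain n" "- 1" e 0] unit_letter_ok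
  by (simp add: diff_one coboundary_unit) (auto simp: pure_tensor_def fun_eq_iff)

lemma tensor_m_unit:
  assumes "u \<in> words letters" "v \<in> words letters" "length u + length v \<ge> 2"
  shows "m\<^sub>R (u @ (- 1, pure_tensor scale (unit_cochain n) e) # v) = 0"
proof -
  let ?e = "(- 1, pure_tensor scale (unit_cochain n) e) :: int \<times> (nat list \<Rightarrow> 'a)"
  have 1: "m\<^sub>R (map total U @ ?e # v) = 0"
    if U: "list_all pure_ok U" and v: "v \<in> words letters" "length U + length v \<ge> 2" for U v
  proof -
    let ?T = "\<lambda>v. if length U + length v \<ge> 2 then m\<^sub>R (map total U @ ?e # v) else 0"
    have "?T v \<in> {0}"
    proof (rule pure_extension[where T = ?T, OF _ _ _ _ v(1)])
      fix u v x y and k :: int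
      assume uv: "u \<in> words letters" "v \<in> words letters" and xy: "x \<in> letters k" "y \<in> letters k"
      have "map total U @ ?e # u \<in> words letters" using total_words[OF U] uv unit_in_letters by simp
      from tensor_m_add[OF this uv(2) xy]
      show "?T (u @ (k, x + y) # v) = ?T (u @ (k, x) # v) + ?T (u @ (k, y) # v)"
        by (simp only: append_assoc append_Cons length_append length_Cons add_0_right split: if_split) simp
    next
      fix V assume V: "list_all pure_ok V"
      let ?W = "U @ unit_letter # V"
      have "m\<^sub>R (map total ?W) = 0" if "length U + length V \<ge> 2"
      proof -
        have W: "list_all pure_ok ?W" "length ?W \<ge> 2" using U V unit_letter_ok that by auto
        have "transfer_m n (map cochain_part ?W) = 0"
          using transfer_m_unit[of "map cochain_part U" "map cochain_part V" n] that by simp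
        then show ?thesis unfolding tensor_m_pure[OF W] by (auto simp: pure_tensor_def fun_eq_iff koszul_def)
      qed
      then show "?T (map total V) \<in> {0}" by simp
    qed auto
    then show ?thesis using v by simp
  qed
  let ?T = "\<lambda>u. if length u + length v \<ge> 2 then m\<^sub>R (u @ ?e # v) else 0"
  have "?T u \<in> {0}"
  proof (rule pure_extension[where T = ?T, OF _ _ _ _ assms(1)])
    fix u w x y and k :: int
    assume uv: "u \<in> words letters" "w \<in> words letters" and xy: "x \<in> letters k" "y \<in> letters k"
    have "w @ ?e # v \<in> words letters" using assms(2) uv unit_in_letters by simp
    from tensor_m_add[OF uv(1) this xy]
    show "?T (u @ (k, x + y) # w) = ?T (u @ (k, x) # w) + ?T (u @ (k, y) # w)"
      by (simp only: append_assoc append_Cons length_append length_Cons add_0_right split: if_split) simp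
  next
    fix U assume "list_all pure_ok U"
    then show "?T (map total U) \<in> {0}" using 1[of U v] assms(2) by simp
  qed auto
  then show ?thesis using assms(3) by simp
qed

lemma tensor_m_unit_2:
  assumes "x \<in> letters k"
  shows "m\<^sub>R [(- 1, pure_tensor scale (unit_cochain n) e), (k, x)] = x"
    and "koszul (k + 1) (m\<^sub>R [(k, x), (- 1, pure_tensor scale (unit_cochain n) e)]) = x"
proof -
  let ?e = "(- 1, pure_tensor scale (unit_cochain n) e) :: int \<times> (nat list \<Rightarrow> 'a)"
  have e: "[?e] \<in> words letters" using unit_in_letters by simp
  let ?T = "\<lambda>w. if length w = 1 then m\<^sub>R (?e # w) - snd (hd w) else 0"
  let ?S = "\<lambda>w. if length w = 1 then koszul (fst (hd w) + 1) (m\<^sub>R (w @ [?e])) - snd (hd w) else 0"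
  have "?T [(k, x)] \<in> {0}"
  proof (rule pure_extension[where T = ?T])
    fix u v x y and k :: int
    assume uv: "u \<in> words letters" "v \<in> words letters" and xy: "x \<in> letters k" "y \<in> letters k"
    show "?T (u @ (k, x + y) # v) = ?T (u @ (k, x) # v) + ?T (u @ (k, y) # v)"
      using tensor_m_add[OF e words_simps(1) xy] by (cases u; cases v) (auto simp: algebra_simps)
  next
    fix W assume W: "list_all pure_ok W"
    show "?T (map total W) \<in> {0}"
    proof (cases "length W = 1")
      case True
      then obtain s v p b where l: "W = [(s, v, p, b)]" by (cases W) auto
      then have ok: "list_all pure_ok [unit_letter, (s, v, p, b)]" "v \<in> N n (s + 1)" "b \<in> part R p"
        using W unit_letter_ok by (auto simp: mem_cochains)
      have "m\<^sub>R (?e # map total W) = pure_tensor scale v b"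
        using tensor_m_pure[OF ok(1)] transfer_m_unit_left[OF ok(2), of s] ok(3)
        by (simp add: l acc_mult_def mult_one)
      then show ?thesis by (simp add: l)
    qed simp
  qed (use assms in auto)
  then show "m\<^sub>R [?e, (k, x)] = x" by simp
  have "?S [(k, x)] \<in> {0}"
  proof (rule pure_extension[where T = ?S])
    fix u v x y and k :: int
    assume uv: "u \<in> words letters" "v \<in> words letters" and xy: "x \<in> letters k" "y \<in> letters k"
    show "?S (u @ (k, x + y) # v) = ?S (u @ (k, x) # v) + ?S (u @ (k, y) # v)"
      using tensor_m_add[OF words_simps(1) e xy]
      by (cases u; cases v) (auto simp: algebra_simps koszul_add)
  next
    fix W assume W: "list_all pure_ok W"
    show "?S (map total W) \<in> {0}"
    proof (cases "length W = 1")
      case True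
      then obtain s v p b where l: "W = [(s, v, p, b)]" by (cases W) auto
      then have ok: "list_all pure_ok [(s, v, p, b), unit_letter]" "v \<in> N n (s + 1)" "b \<in> part R p"
        using W unit_letter_ok by (auto simp: mem_cochains)
      \<comment> \<open>The coefficient of degree \<open>p\<close> passes the unit cochain, whose
        shifted degree is \<open>- 1\<close>.\<close>
      have "m\<^sub>R (map total W @ [?e]) = koszul (- p) (pure_tensor scale (koszul (s + 1) v) b)"
        using tensor_m_pure[OF ok(1)] transfer_m_unit_right[OF ok(2), of s] ok(3)
        by (simp add: l acc_mult_def mult_one)
      moreover have "koszul (s + p + 1) (koszul (- p) (pure_tensor scale (koszul (s + 1) v) b)) = pure_tensor scale v b"
        by (auto simp: koszul_def pure_tensor_def fun_eq_iff)
      ultimately show ?thesis by (simp add: l)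
    qed simp
  qed (use assms in auto)
  then show "koszul (k + 1) (m\<^sub>R [(k, x), ?e]) = x" by simp
qed

end

end

section \<open>Naturality in the simplex and in the coefficients\<close>

lemma (in coefficients) psign_cong:
  "map (\<lambda>(s, v, p, b). (s, p)) W = map (\<lambda>(s, v, p, b). (s, p)) W' \<Longrightarrow> psign q W = psign q W'"
proof (induction W arbitrary: q W')
  case (Cons l W)
  then obtain l' W'' where W': "W' = l' # W''" by (cases W') auto
  then show ?case using Cons by (cases l; cases l') auto
qed simp

lemma pullback_add: "pullback m \<theta> (x + y) = pullback m \<theta> x + (pullback m \<theta> y :: _ \<Rightarrow> 'a::ab_group_add)"
  by (auto simp: pullback_def fun_eq_iff)

lemma pullback_koszul: "pullback m \<theta> (koszul k x) = koszul k (pullback m \<theta> x)"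
  by (auto simp: pullback_def fun_eq_iff koszul_def)

lemma tensor_m_Nil: "tensor_m scale R n [] = 0"
  by (auto simp: tensor_m_def fun_eq_iff)

text \<open>Pullback touches neither degrees nor coefficients, so on pure words of length at least 2
  this is the naturality of the transfer.\<close>

theorem tensor_m_pullback:
  fixes scale :: "'k::field_char_0 \<Rightarrow> 'a::ab_group_add \<Rightarrow> 'a"
  assumes R: "dg_comm_algebra scale R" and \<theta>: "\<theta> \<in> Delta m n"
    and w: "w \<in> words (shift (N_tensor n (part R)))"
  shows "tensor_m scale R m (map (\<lambda>(k, x). (k, pullback m \<theta> x)) w) = pullback m \<theta> (tensor_m scale R n w)"
proof -
  interpret dg_comm_algebra scale R by fact
  interpret N: coefficients scale R n by unfold_locales
  interpret M: coefficients scale R m by unfold_locales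
  let ?f = "map (\<lambda>(k, x). (k, pullback m \<theta> x)) :: (nat list \<Rightarrow> 'a) word \<Rightarrow> _"
  have letter: "pullback m \<theta> x \<in> M.letters k" if "x \<in> N.letters k" for x k
    using N.letter_part[OF that, of "comp_Delta \<theta> _"] N.letter_0[OF that, of "comp_Delta \<theta> _"]
    unfolding shift_def N_tensor_def pullback_def
    by (auto simp: simplex_dim_def comp_Delta_def split: if_splits) (metis N.part_0)
  have words: "?f w \<in> words M.letters" if "w \<in> words N.letters" for w
    using that by (induction w) (auto intro: letter)
  let ?T = "\<lambda>w. tensor_m scale R m (?f w) - pullback m \<theta> (tensor_m scale R n w)"
  have "?T w \<in> {0}"
  proof (rule N.pure_extension[where T = ?T, OF _ _ _ _ w])
    fix u v x y and k :: int
    assume uv: "u \<in> words N.letters" "v \<in> words N.letters" and xy: "x \<in> N.letters k" "y \<in> N.letters k"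
    show "?T (u @ (k, x + y) # v) = ?T (u @ (k, x) # v) + ?T (u @ (k, y) # v)"
      using M.tensor_m_add[OF words[OF uv(1)] words[OF uv(2)] letter[OF xy(1)] letter[OF xy(2)]]
        N.tensor_m_add[OF uv xy]
      by (simp add: pullback_add algebra_simps)
  next
    fix W assume W: "list_all N.pure_ok W"
    let ?g = "\<lambda>(s, v, p, b). (s, pullback m \<theta> v, p, b)"
    have f: "?f (map N.total W) = map N.total (map ?g W)"
      by (auto simp: pullback_pure[OF module_axioms])
    have gW: "list_all M.pure_ok (map ?g W)"
      using W by (induction W) (auto simp: mem_cochains pullback_N)
    have c: "map N.cochain_part (map ?g W) = map (\<lambda>(k, x). (k, pullback m \<theta> x)) (map N.cochain_part W)"
      by auto
    have r: "N.rprod q A (map ?g W) = N.rprod q A W" for q A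
      by (induction W arbitrary: q A) auto
    have sgn: "N.psign q (map ?g W) = N.psign q W" for q
      by (rule N.psign_cong) auto
    have t: "transfer_m m (map N.cochain_part (map ?g W)) = pullback m \<theta> (transfer_m n (map N.cochain_part W))"
      unfolding c by (rule transfer_m_pullback[OF \<theta> N.cochain_words[OF W]])
    have "tensor_m scale R m (map N.total (map ?g W)) = pullback m \<theta> (tensor_m scale R n (map N.total W))"
    proof (cases "length W \<ge> 2")
      case True
      then have "tensor_m scale R m (map N.total (map ?g W)) =
          koszul (N.psign 0 W) (pure_tensor scale (pullback m \<theta> (transfer_m n (map N.cochain_part W))) (N.rprod 0 None W))"
        using M.tensor_m_pure[OF gW] by (simp only: length_map r sgn t)
      then show ?thesis
        unfolding N.tensor_m_pure[OF W True] pullback_koszul pullback_pure[OF module_axioms] .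
    next
      case False
      show ?thesis
      proof (cases W)
        case Nil
        then show ?thesis by (auto simp: tensor_m_Nil pullback_def fun_eq_iff)
      next
        case (Cons l W')
        then obtain s v p b where l: "W = [(s, v, p, b)]" using False by (cases l; cases W') auto
        then have v: "v \<in> N n (s + 1)" "b \<in> part R p" "pullback m \<theta> v \<in> N m (s + 1)"
          using W by (auto simp: mem_cochains pullback_N)
        then show ?thesis
          using N.tensor_m_single[of v s b p] M.tensor_m_single[of "pullback m \<theta> v" s b p]
          by (simp add: l mem_cochains pullback_add pullback_koszul pullback_pure[OF module_axioms]
              coboundary_pullback[OF \<theta> v(1)])
      qed
    qed
    then show "?T (map N.total W) \<in> {0}" unfolding f by simp
  qed auto
  then show ?thesis by simp
qed

lemma dg_alg_homD:
  assumes "dg_alg_hom scale R S f"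
  shows "linear_on_into scale scale (part R p) (part S p) (f p)"
    and "a \<in> part R p \<Longrightarrow> f p a \<in> part S p"
    and "a \<in> part R p \<Longrightarrow> b \<in> part R p \<Longrightarrow> f p (a + b) = f p a + f p b"
    and "a \<in> part R p \<Longrightarrow> f p (scale c a) = scale c (f p a)"
    and "a \<in> part R p \<Longrightarrow> f (p + 1) (diff R p a) = diff S p (f p a)"
    and "a \<in> part R p \<Longrightarrow> b \<in> part R q \<Longrightarrow> f (p + q) (dg_alg.mult R p q a b) = dg_alg.mult S p q (f p a) (f q b)"
  using assms by (auto simp: dg_alg_hom_def linear_on_into_def)

lemma coeff_map_linear:
  assumes g: "\<And>p. linear_on_into scale scale (C p) (D p) (g p)" and C: "\<And>p. module.subspace scale (C p)"
    and m: "module scale" and xy: "x \<in> N_tensor n C k" "y \<in> N_tensor n C k"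
  shows "coeff_map n g k (pointwise scale c x + y) = pointwise scale c (coeff_map n g k x) + coeff_map n g k y"
proof
  fix \<sigma>
  show "coeff_map n g k (pointwise scale c x + y) \<sigma> =
    (pointwise scale c (coeff_map n g k x) + coeff_map n g k y) \<sigma>"
  proof (cases "\<sigma> \<in> nondegenerate n")
    case True
    then have "x \<sigma> \<in> C (k - simplex_dim \<sigma>)" "y \<sigma> \<in> C (k - simplex_dim \<sigma>)"
      using xy by (auto simp: N_tensor_def split: if_splits)
    then show ?thesis
      using True g[of "k - simplex_dim \<sigma>"] module.subspace_scale[OF m C]
      by (simp add: coeff_map_def pointwise_def linear_on_into_def)
  qed (simp add: coeff_map_def pointwise_def module.scale_zero_right[OF m])
qed

text \<open>A homomorphism touches only the coefficients, and passes through their product and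
  differential.\<close>

theorem tensor_m_hom:
  fixes scale :: "'k::field_char_0 \<Rightarrow> 'a::ab_group_add \<Rightarrow> 'a"
  assumes R: "dg_comm_algebra scale R" and S: "dg_comm_algebra scale S"
    and \<phi>: "dg_alg_hom scale R S \<phi>" and w: "w \<in> words (shift (N_tensor n (part R)))"
  shows "tensor_m scale S n (map (\<lambda>(k, x). (k, coeff_map n \<phi> (k + 1) x)) w) =
    coeff_map n \<phi> (wdeg w + 2) (tensor_m scale R n w)"
proof -
  interpret R: coefficients scale R n by (rule coefficients.intro) (rule R)
  interpret S: coefficients scale S n by (rule coefficients.intro) (rule S)
  note hom = dg_alg_homD[OF \<phi>]
  have pure: "coeff_map n \<phi> k (pure_tensor scale v a) = pure_tensor scale v (\<phi> (k - p) a)"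
    if "v \<in> N n p" "a \<in> part R (k - p)" for v p a k
    by (rule coeff_map_pure[where C = "part R" and D = "part S", OF R.module_axioms that hom(1) R.subspace_part])
  have lin: "coeff_map n \<phi> (k + 1) (pointwise scale c x + y) =
      pointwise scale c (coeff_map n \<phi> (k + 1) x) + coeff_map n \<phi> (k + 1) y"
    if "x \<in> R.letters k" "y \<in> R.letters k" for c x y k
    using that unfolding shift_def
    by (rule coeff_map_linear[where C = "part R" and D = "part S", OF hom(1) R.subspace_part R.module_axioms])
  have p1: "pointwise scale 1 z = z" and pn: "pointwise scale (- 1) z = - z" for z :: "nat list \<Rightarrow> 'a"
    by (auto simp: pointwise_def)
  have add: "coeff_map n \<phi> (k + 1) (x + y) = coeff_map n \<phi> (k + 1) x + coeff_map n \<phi> (k + 1) y"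
    if "x \<in> R.letters k" "y \<in> R.letters k" for x y k
    using lin[OF that, of 1] unfolding p1 .
  have zero: "coeff_map n \<phi> (k + 1) 0 = 0" for k
    using add[OF R.letters_0 R.letters_0, of k] by simp
  have kos: "coeff_map n \<phi> (k + 1) (koszul j x) = koszul j (coeff_map n \<phi> (k + 1) x)"
    if "x \<in> R.letters k" for x k j
    using lin[OF that R.letters_0, of "- 1"] unfolding pn zero by (simp add: koszul_def)
  let ?f = "map (\<lambda>(k, x). (k, coeff_map n \<phi> (k + 1) x)) :: (nat list \<Rightarrow> 'a) word \<Rightarrow> _"
  have letter: "coeff_map n \<phi> (k + 1) x \<in> S.letters k" if "x \<in> R.letters k" for x k
    using hom(2)[OF R.letter_part[OF that]] by (auto simp: shift_def N_tensor_def coeff_map_def)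
  have words: "?f w \<in> words S.letters" if "w \<in> words R.letters" for w
    using that by (induction w) (auto intro: letter)
  \<comment> \<open>\<open>coeff_map\<close> depends on the degree, so the comparison is restricted
    to words of the degree of \<open>w\<close>.\<close>
  let ?T = "\<lambda>u. if wdeg u = wdeg w
    then tensor_m scale S n (?f u) - coeff_map n \<phi> (wdeg w + 1 + 1) (tensor_m scale R n u) else 0"
  have "?T w \<in> {0}"
  proof (rule R.pure_extension[where T = ?T, OF _ _ _ _ w])
    fix u v x y and k :: int
    assume uv: "u \<in> words R.letters" "v \<in> words R.letters" and xy: "x \<in> R.letters k" "y \<in> R.letters k"
    have m: "tensor_m scale R n (u @ (k, z) # v) \<in> R.letters (wdeg (u @ (k, z) # v) + 1)"
      if "z \<in> R.letters k" for z
      by (rule R.tensor_m_letter) (use uv that in auto)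
    show "?T (u @ (k, x + y) # v) = ?T (u @ (k, x) # v) + ?T (u @ (k, y) # v)"
    proof (cases "wdeg u + (k + wdeg v) = wdeg w")
      case True
      have "tensor_m scale R n (u @ (k, z) # v) \<in> R.letters (wdeg w + 1)" if "z \<in> R.letters k" for z
        using m[OF that] True by simp
      note c = add[OF this[OF xy(1)] this[OF xy(2)]]
      have "?f (u @ (k, z) # v) = ?f u @ (k, coeff_map n \<phi> (k + 1) z) # ?f v" for z by simp
      then show ?thesis
        using S.tensor_m_add[OF words[OF uv(1)] words[OF uv(2)] letter[OF xy(1)] letter[OF xy(2)]] True
        by (simp only: R.tensor_m_add[OF uv xy] c add[OF xy]) (simp add: True)
    qed simp
  next
    fix W assume W: "list_all R.pure_ok W"
    let ?g = "\<lambda>(s, v, p, b). (s, v, p, \<phi> p b)"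
    have f: "?f (map R.total W) = map S.total (map ?g W)"
      using W
    proof (induction W)
      case (Cons l W)
      obtain s v p b where l: "l = (s, v, p, b)" by (cases l)
      then show ?case using Cons pure[of v "s + 1" b "s + p + 1"] by (simp add: mem_cochains)
    qed simp
    have gW: "list_all S.pure_ok (map ?g W)"
      using W by (induction W) (auto simp: hom(2))
    have c: "map S.cochain_part (map ?g W) = map R.cochain_part W" by auto
    have r: "S.rprod q (map_option (\<phi> q) A) (map ?g W) = \<phi> (q + R.rdeg W) (R.rprod q A W)"
      if "list_all R.pure_ok W" "R.acc_ok q A" for q A W
      using that
    proof (induction W arbitrary: q A)
      case Nil
      have "\<phi> q 0 = 0" by (rule linear_on_into_zero[OF R.module_axioms R.module_axioms R.subspace_part hom(1)])
      then show ?case by (cases A) auto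
    next
      case (Cons l W)
      obtain s v p b where l: "l = (s, v, p, b)" by (cases l)
      have b: "b \<in> part R p" "list_all R.pure_ok W" using Cons.prems l by auto
      have "acc_mult S q (map_option (\<phi> q) A) p (\<phi> p b) = \<phi> (q + p) (acc_mult R q A p b)"
        using Cons.prems(2) hom(6)[OF _ b(1)] by (cases A) (auto simp: acc_mult_def R.acc_ok_def)
      then show ?case
        using Cons.IH[OF b(2), of "q + p" "Some (acc_mult R q A p b)"] R.acc_mult_part[OF Cons.prems(2) b(1)]
        by (simp add: l add.assoc)
    qed
    have sgn: "S.psign q (map ?g W) = R.psign q W" for q
      by (rule R.psign_cong) auto
    have "tensor_m scale S n (map S.total (map ?g W)) =
        coeff_map n \<phi> (wdeg (map R.total W) + 1 + 1) (tensor_m scale R n (map R.total W))"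
    proof (cases "length W \<ge> 2")
      case True
      then have "W \<noteq> []" by auto
      let ?t = "transfer_m n (map R.cochain_part W)" and ?r = "R.rprod 0 None W"
      have t: "?t \<in> cochains n (wdeg (map R.cochain_part W) + 1)"
        using transfer_m_cochain[OF R.cochain_words[OF W]] \<open>W \<noteq> []\<close> by simp
      have rp: "?r \<in> part R (R.rdeg W)" using R.rprod_part[OF W, of 0 None] \<open>W \<noteq> []\<close> by simp
      have "pure_tensor scale ?t ?r \<in> R.letters (wdeg (map R.total W) + 1)"
        using R.pure_letter[OF t rp] by (simp add: R.wdeg_total ac_simps)
      moreover have "coeff_map n \<phi> (wdeg (map R.total W) + 1 + 1) (pure_tensor scale ?t ?r) =
          pure_tensor scale ?t (\<phi> (R.rdeg W) ?r)"
        using pure[of ?t "2 + wdeg (map R.cochain_part W)" ?r "wdeg (map R.total W) + 1 + 1"] t rp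
        by (simp add: R.wdeg_total mem_cochains)
      moreover have "length (map ?g W) \<ge> 2" using True by simp
      ultimately show ?thesis
        unfolding R.tensor_m_pure[OF W True]
        using S.tensor_m_pure[OF gW] r[OF W, of 0 None] by (simp only: c sgn kos) simp
    next
      case False
      show ?thesis
      proof (cases W)
        case Nil
        then show ?thesis using zero[of 1] by (simp add: tensor_m_Nil)
      next
        case (Cons l W')
        then obtain s v p b where l: "W = [(s, v, p, b)]" using False by (cases l; cases W') auto
        then have v: "v \<in> cochains n s" "v \<in> N n (s + 1)" "b \<in> part R p"
          using W by (auto simp: mem_cochains)
        note db = R.diff_part[OF v(3)]
        have m: "pure_tensor scale (coboundary n v) b \<in> R.letters (s + p + 1)"
          "pure_tensor scale v (diff R p b) \<in> R.letters (s + p + 1)"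
          using R.pure_letter[of "coboundary n v" "s + 1" b p] R.pure_letter[OF v(1) db]
            coboundary_N[OF v(2)] v
          by (simp_all add: mem_cochains ac_simps)
        have "coeff_map n \<phi> (s + p + 1 + 1) (pure_tensor scale (coboundary n v) b) =
            pure_tensor scale (coboundary n v) (\<phi> p b)"
          using pure[of "coboundary n v" "2 + s" b "s + p + 1 + 1"] coboundary_N[OF v(2)] v(3) by simp
        moreover have "coeff_map n \<phi> (s + p + 1 + 1) (pure_tensor scale v (diff R p b)) =
            pure_tensor scale v (diff S p (\<phi> p b))"
          using pure[of v "s + 1" "diff R p b" "s + p + 1 + 1"] v db hom(5)[OF v(3)]
          by (simp add: add.commute)
        ultimately have "coeff_map n \<phi> (s + p + 1 + 1) (tensor_m scale R n [(s + p, pure_tensor scale v b)]) =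
            tensor_m scale S n [(s + p, pure_tensor scale v (\<phi> p b))]"
          unfolding R.tensor_m_single[OF v(1,3)] S.tensor_m_single[OF v(1) hom(2)[OF v(3)]]
          by (simp only: add[OF m(1) R.letters_koszul[OF m(2)]] kos[OF m(2)])
        then show ?thesis by (simp add: l)
      qed
    qed
    then show "?T (map R.total W) \<in> {0}" unfolding f by simp
  qed auto
  then show ?thesis by (simp add: add.commute)
qed

section \<open>The normalization\<close>

definition component :: "nat \<Rightarrow> int \<times> (nat \<Rightarrow> nat list \<Rightarrow> 'a) \<Rightarrow> int \<times> (nat list \<Rightarrow> 'a)" where
  "component n l = (fst l, snd l n)"

definition Tot_m :: "('k::field_char_0 \<Rightarrow> 'a \<Rightarrow> 'a) \<Rightarrow> 'a::ab_group_add cosimplicial_dg_alg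
    \<Rightarrow> (nat \<Rightarrow> nat list \<Rightarrow> 'a) word \<Rightarrow> nat \<Rightarrow> nat list \<Rightarrow> 'a" where
  "Tot_m scale A w n = tensor_m scale (obj A n) n (map (component n) w)"

lemma component_simps [simp]: "component n (k, x) = (k, x n)" "fst (component n l) = fst l"
  by (simp_all add: component_def)

lemma wdeg_map_fst: "(\<And>l. fst (g l) = fst l) \<Longrightarrow> wdeg (map g w) = wdeg w"
  by (induction w) simp_all

text \<open>Since \<open>g\<close> preserves degrees, all Koszul signs agree on both sides.\<close>

lemma coder_map:
  assumes g: "\<And>l. fst (g l) = fst l" "\<And>k u. g (k, m u) = (k, m' (map g u))"
  shows "coder m (\<lambda>u. F (map g u)) w = coder m' F (map g w)"
proof (induction w arbitrary: F)
  case (Cons a w)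
  have "map g ((wdeg (take k (a # w)) + 1, m (take k (a # w))) # drop k (a # w)) =
      (wdeg (take k (map g (a # w))) + 1, m' (take k (map g (a # w)))) # drop k (map g (a # w))" for k
    unfolding take_map drop_map list.map(2)[of g "(_, _)"] g(2) wdeg_map_fst[of g, OF g(1)] ..
  then show ?case
    using Cons.IH[of "\<lambda>u. F (g a # u)"] by (simp only: coder.simps list.map(2) g(1) length_map)
qed simp

lemma shuffle_sum_map:
  assumes g: "\<And>l. fst (g l) = fst l"
  shows "shuffle_sum (\<lambda>w. F (map g w)) u v = shuffle_sum F (map g u) (map g v)"
proof (induction u v arbitrary: F rule: signed_shuffles.induct)
  case (3 a u b v)
  show ?case
    using 3(1)[of "\<lambda>w. F (g a # w)"] 3(2)[of "\<lambda>w. F (g b # w)"] wdeg_map_fst[of g, OF g]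
    by (simp add: g)
qed simp_all

lemma linear_on_intoI:
  assumes s: "module s" and t: "module t" and V: "module.subspace s V"
    and f: "\<And>x. x \<in> V \<Longrightarrow> f x \<in> W"
    and lin: "\<And>c x y. x \<in> V \<Longrightarrow> y \<in> V \<Longrightarrow> f (s c x + y) = t c (f x) + f y"
  shows "linear_on_into s t V W f"
proof -
  have 0: "0 \<in> V" by (rule module.subspace_0[OF s V])
  have add: "f (x + y) = f x + f y" if "x \<in> V" "y \<in> V" for x y
    using lin[OF that, of 1] by (simp add: module.scale_one[OF s] module.scale_one[OF t])
  have "f 0 = 0" using add[OF 0 0] by simp
  then show ?thesis
    using f add lin[OF _ 0] by (simp add: linear_on_into_def)
qed

lemma vector_space_Tot_scale: "vector_space scale \<Longrightarrow> vector_space (Tot_scale scale)"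
  by (simp add: vector_space_def Tot_scale_def pointwise_def fun_eq_iff)

lemma pullback_unit_cochain: "\<theta> \<in> Delta m n \<Longrightarrow> pullback m \<theta> (unit_cochain n) = unit_cochain m"
proof
  fix \<sigma> assume \<theta>: "\<theta> \<in> Delta m n"
  show "pullback m \<theta> (unit_cochain n) \<sigma> = unit_cochain m \<sigma>"
  proof (cases "\<sigma> \<in> nondegenerate m \<and> length \<sigma> = 1")
    case True
    then obtain i where i: "\<sigma> = [i]" "i \<le> m" by (cases \<sigma>) (auto simp: nondegenerate_def Delta_def)
    then have "\<theta> ! i \<in> set \<theta>" using \<theta> by (simp add: Delta_def)
    then have "\<theta> ! i \<le> n" using \<theta> by (auto simp: Delta_def)
    then have "[\<theta> ! i] \<in> nondegenerate n" by (auto simp: nondegenerate_def Delta_def)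
    then show ?thesis using True i by (simp add: pullback_def unit_cochain_def comp_Delta_def)
  qed (auto simp: pullback_def unit_cochain_def comp_Delta_def)
qed

section \<open>The structure on the normalization\<close>

locale cosimplicial_char_0 = cosimplicial_dg_comm_algebra scale A
  for scale :: "'k::field_char_0 \<Rightarrow> 'a::ab_group_add \<Rightarrow> 'a" and A
begin

lemma coefficients_obj: "coefficients scale (obj A n)"
  by (rule coefficients.intro) (rule obj_algebra)

interpretation C: coefficients scale "obj A n" n for n
  by (rule coefficients_obj)

abbreviation "T \<equiv> shift (Tot A)"
abbreviation "m\<^sub>T \<equiv> Tot_m scale A"

lemma vector_space_Tot: "vector_space (Tot_scale scale)"
  by (rule vector_space_Tot_scale) (rule C.vector_space_axioms)

lemma Tot_component: "x \<in> T k \<Longrightarrow> x n \<in> C.letters n k"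
  by (simp add: shift_def Tot_def)

lemma words_component: "w \<in> words T \<Longrightarrow> map (component n) w \<in> words (C.letters n)"
  by (induction w) (auto intro: Tot_component)

lemma Tot_m_component: "m\<^sub>T w n = C.m\<^sub>R n (map (component n) w)"
  by (simp add: Tot_m_def)

text \<open>Pullback passes inside the operation; there the compatibility of the letters turns it
  into the cosimplicial map on coefficients, which passes out again as a homomorphism of
  algebras.\<close>

lemma Tot_m_T:
  assumes w: "w \<in> words T" "w \<noteq> []"
  shows "m\<^sub>T w \<in> T (wdeg w + 1)"
proof -
  have "m\<^sub>T w n \<in> C.letters n (wdeg w + 1)" for n
    using C.tensor_m_letter[OF words_component[OF w(1)], of n] w(2)
    by (simp add: Tot_m_component wdeg_map_fst)
  moreover have "pullback m \<theta> (m\<^sub>T w n) = coeff_map m (act A m n \<theta>) (wdeg w + 2) (m\<^sub>T w m)"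
    if \<theta>: "\<theta> \<in> Delta m n" for m n \<theta>
  proof -
    \<comment> \<open>The defining condition of the end, applied to each letter.\<close>
    have "map (\<lambda>(k, x). (k, pullback m \<theta> x)) (map (component n) w) =
        map (\<lambda>(k, x). (k, coeff_map m (act A m n \<theta>) (k + 1) x)) (map (component m) w)"
      using w(1) \<theta> by (fastforce simp: words_def shift_def Tot_def)
    then show ?thesis
      using tensor_m_pullback[OF obj_algebra \<theta> words_component[OF w(1)]]
        tensor_m_hom[OF obj_algebra obj_algebra act_hom[OF \<theta>] words_component[OF w(1)]]
      by (simp add: Tot_m_component wdeg_map_fst del: map_map)
  qed
  ultimately show ?thesis by (simp add: shift_def Tot_def add.commute)
qed

lemma Tot_subspace: "module.subspace (Tot_scale scale) (T k)"
proof -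
  have m: "module (Tot_scale scale)" "module scale"
    using vector_space_Tot C.vector_space_axioms by (simp_all add: module_iff_vector_space)
  have lin: "Tot_scale scale c x + y \<in> T k" if "x \<in> T k" "y \<in> T k" for c x y
  proof -
    have app: "Tot_scale scale c x n = pointwise scale c (x n)" for n
      by (simp add: Tot_scale_def pointwise_def)
    have "pullback i \<theta> (pointwise scale c (x n) + y n) =
        coeff_map i (act A i n \<theta>) (k + 1) (pointwise scale c (x i) + y i)"
      if \<theta>: "\<theta> \<in> Delta i n" for i n \<theta>
    proof -
      have "pullback i \<theta> (pointwise scale c (x n) + y n) =
          pointwise scale c (pullback i \<theta> (x n)) + pullback i \<theta> (y n)"
        by (auto simp: pullback_def pointwise_def)
      moreover have "coeff_map i (act A i n \<theta>) (k + 1) (pointwise scale c (x i) + y i) =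
          pointwise scale c (coeff_map i (act A i n \<theta>) (k + 1) (x i)) + coeff_map i (act A i n \<theta>) (k + 1) (y i)"
        using Tot_component[OF \<open>x \<in> T k\<close>, of i] Tot_component[OF \<open>y \<in> T k\<close>, of i]
        unfolding shift_def
        by (rule coeff_map_linear[where C = "part (obj A i)" and D = "part (obj A n)",
            OF dg_alg_homD(1)[OF act_hom[OF \<theta>]] C.subspace_part m(2)])
      ultimately show ?thesis using that \<open>x \<in> T k\<close> \<open>y \<in> T k\<close> by (simp add: shift_def Tot_def)
    qed
    moreover have "pointwise scale c (x n) + y n \<in> C.letters n k" for n
      by (intro C.letters_add C.letters_scale Tot_component that)
    ultimately show ?thesis unfolding shift_def Tot_def by (simp add: app)
  qed
  have 0: "0 \<in> T k"
  proof -
    have "coeff_map i (act A i n \<theta>) (k + 1) 0 = 0" if \<theta>: "\<theta> \<in> Delta i n" for i n \<theta>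
      using linear_on_into_zero[OF m(2) m(2) C.subspace_part dg_alg_homD(1)[OF act_hom[OF \<theta>]]]
      by (auto simp: coeff_map_def)
    moreover have "pullback i \<theta> 0 = (0 :: nat list \<Rightarrow> 'a)" for i \<theta> by (auto simp: pullback_def)
    ultimately show ?thesis using C.letters_0 by (simp add: shift_def Tot_def)
  qed
  have one: "Tot_scale scale 1 x = x" for x by (rule module.scale_one[OF m(1)])
  show ?thesis
    unfolding module.subspace_def[OF m(1)]
    using 0 lin[of _ _ 1] lin[OF _ 0] by (simp add: one)
qed

lemma Tot_m_linear:
  assumes "u \<in> words T" "v \<in> words T"
  shows "linear_on_into (Tot_scale scale) (Tot_scale scale) (T k) (T (wdeg u + k + wdeg v + 1))
    (\<lambda>x. m\<^sub>T (u @ (k, x) # v))"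
proof (rule linear_on_intoI)
  fix x assume "x \<in> T k"
  then show "m\<^sub>T (u @ (k, x) # v) \<in> T (wdeg u + k + wdeg v + 1)"
    using Tot_m_T[of "u @ (k, x) # v"] assms by (simp add: add.assoc)
next
  fix c x y assume xy: "x \<in> T k" "y \<in> T k"
  show "m\<^sub>T (u @ (k, Tot_scale scale c x + y) # v) =
      Tot_scale scale c (m\<^sub>T (u @ (k, x) # v)) + m\<^sub>T (u @ (k, y) # v)"
  proof
    fix n
    have "(Tot_scale scale c x + y) n = pointwise scale c (x n) + y n" for x y
      by (simp add: Tot_scale_def pointwise_def)
    then show "m\<^sub>T (u @ (k, Tot_scale scale c x + y) # v) n =
      (Tot_scale scale c (m\<^sub>T (u @ (k, x) # v)) + m\<^sub>T (u @ (k, y) # v)) n"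
      using C.tensor_m_linear[OF words_component[OF assms(1)] words_component[OF assms(2)]
          Tot_component[OF xy(1)] Tot_component[OF xy(2)]]
      by (simp only: Tot_m_component map_append list.map component_simps)
  qed
qed (use vector_space_Tot Tot_subspace in \<open>simp_all add: module_iff_vector_space\<close>)

lemma Tot_m_single: "x \<in> T k \<Longrightarrow> m\<^sub>T [(k, x)] = shift (Tot_diff A) k x"
  using C.tensor_m_single_letter[OF Tot_component]
  by (auto simp: Tot_m_component shift_def Tot_diff_def)

theorem C_infinity_Tot: "C_infinity_algebra (Tot_scale scale) T (shift (Tot_diff A)) m\<^sub>T"
proof (rule C_infinity_algebra.intro)
  have d: "shift (Tot_diff A) k x \<in> T (k + 1)" if "x \<in> T k" for k x
    using Tot_m_T[of "[(k, x)]"] that by (simp add: Tot_m_single)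
  show "A_infinity_algebra (Tot_scale scale) T (shift (Tot_diff A)) m\<^sub>T"
  proof (rule A_infinity_algebra.intro)
    show "cochain_complex (Tot_scale scale) T (shift (Tot_diff A))"
    proof (rule cochain_complex.intro[OF vector_space_Tot], unfold_locales)
      fix k
      show "module.subspace (Tot_scale scale) (T k)" by (rule Tot_subspace)
      show "linear_on_into (Tot_scale scale) (Tot_scale scale) (T k) (T (k + 1)) (shift (Tot_diff A) k)"
      proof -
        have "module (Tot_scale scale)" using vector_space_Tot by (simp add: module_iff_vector_space)
        note sub = module.subspace_add[OF this Tot_subspace] module.subspace_scale[OF this Tot_subspace]
        then show ?thesis
          using Tot_m_linear[of "[]" "[]" k] by (simp add: linear_on_into_def Tot_m_single sub)
      qed
      fix x assume "x \<in> T k"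
      then show "shift (Tot_diff A) (k + 1) (shift (Tot_diff A) k x) = 0"
        using C.N_tensor_diff_squared[OF Tot_component, of x k]
        by (intro ext) (simp add: shift_def Tot_diff_def add.commute)
    qed
    show "A_infinity_algebra_axioms (Tot_scale scale) T (shift (Tot_diff A)) m\<^sub>T"
    proof
      fix w :: "(nat \<Rightarrow> nat list \<Rightarrow> 'a) word" and n
      assume w: "w \<in> words T" "length w = n"
      have "coder m\<^sub>T m\<^sub>T w i = 0" for i
      proof -
        have "coder m\<^sub>T m\<^sub>T w i = coder m\<^sub>T (\<lambda>u. C.m\<^sub>R i (map (component i) u)) w"
          using coder_hom[where h = "\<lambda>x. x i" and m = "m\<^sub>T" and F = "m\<^sub>T" and w = w]
          by (simp add: Tot_m_component)
        also have "\<dots> = coder (C.m\<^sub>R i) (C.m\<^sub>R i) (map (component i) w)"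
          by (rule coder_map) (simp_all add: Tot_m_component)
        finally show ?thesis using C.coder_tensor[OF words_component[OF w(1)]] by simp
      qed
      then have "coder m\<^sub>T m\<^sub>T w = 0" by (simp add: fun_eq_iff)
      then show "(\<Sum>k = 1..n. \<Sum>j = 0..n - k. koszul (wdeg (take j w))
          (m\<^sub>T (take j w @ [(wdeg (take k (drop j w)) + 1, m\<^sub>T (take k (drop j w)))] @ drop (j + k) w))) = 0"
        using coder_eq[of w "m\<^sub>T" "m\<^sub>T"] w(2) by simp
    qed (auto intro: Tot_m_linear Tot_m_single)
  qed
  show "C_infinity_algebra_axioms T m\<^sub>T"
  proof
    fix u v assume uv: "u \<in> words T" "v \<in> words T" "u \<noteq> []" "v \<noteq> []"
    have "shuffle_sum m\<^sub>T u v i = 0" for i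
    proof -
      have "shuffle_sum m\<^sub>T u v i = shuffle_sum (\<lambda>w. C.m\<^sub>R i (map (component i) w)) u v"
        using shuffle_sum_hom[where h = "\<lambda>x. x i" and F = "m\<^sub>T" and u = u and v = v]
        by (simp add: Tot_m_component)
      also have "\<dots> = shuffle_sum (C.m\<^sub>R i) (map (component i) u) (map (component i) v)"
        by (rule shuffle_sum_map) simp
      finally show ?thesis
        using C.shuffle_tensor[OF words_component[OF uv(1)] words_component[OF uv(2)], of i] uv by simp
    qed
    then show "(\<Sum>(e, w)\<leftarrow>signed_shuffles u v. koszul e (m\<^sub>T w)) = 0"
      unfolding shuffle_sum_def[symmetric] by (simp add: fun_eq_iff)
  qed
qed

text \<open>The components of the identity are the unit cochains tensored with the units
  \<open>e n\<close>. Both are preserved by the simplicial maps, so the family lies in the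
  end.\<close>

theorem unital_Tot:
  assumes "unital_cosimplicial A"
  shows "unital_A_infinity T m\<^sub>T"
proof -
  obtain e where e: "\<And>n. is_one (obj A n) (e n)"
    and act: "\<And>m n \<theta>. \<theta> \<in> Delta m n \<Longrightarrow> act A m n \<theta> 0 (e m) = e n"
    using assms unfolding unital_cosimplicial_def by blast
  define E where "E n = pure_tensor scale (unit_cochain n) (e n)" for n
  have "pullback m \<theta> (E n) = coeff_map m (act A m n \<theta>) 0 (E m)" if \<theta>: "\<theta> \<in> Delta m n" for m n \<theta>
  proof -
    have "coeff_map m (act A m n \<theta>) 0 (E m) = pure_tensor scale (unit_cochain m) (act A m n \<theta> (0 - 0) (e m))"
      unfolding E_def
      by (rule coeff_map_pure[where C = "part (obj A m)" and D = "part (obj A n)", OF C.module_axioms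
            unit_cochain_N _ dg_alg_homD(1)[OF act_hom[OF \<theta>]] C.subspace_part])
        (simp add: C.one_part[OF e])
    then show ?thesis
      by (simp add: E_def pullback_pure[OF C.module_axioms] pullback_unit_cochain[OF \<theta>] act[OF \<theta>])
  qed
  moreover have "E n \<in> C.letters n (- 1)" for n
    unfolding E_def by (rule C.unit_in_letters[OF e])
  ultimately have E: "E \<in> T (- 1)" by (simp add: shift_def Tot_def)
  have "is_identity T m\<^sub>T E"
    unfolding is_identity_def
  proof (intro conjI allI ballI impI E)
    show "m\<^sub>T [(- 1, E)] = 0"
      using C.tensor_m_unit_1[OF e] by (simp add: fun_eq_iff Tot_m_component E_def)
  next
    fix k a assume "a \<in> T k"
    note u = C.tensor_m_unit_2[OF e Tot_component[OF this]]
    show "m\<^sub>T [(- 1, E), (k, a)] = a"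
      by (rule ext) (simp add: Tot_m_component E_def u(1))
    show "koszul (k + 1) (m\<^sub>T [(k, a), (- 1, E)]) = a"
      by (rule ext) (simp add: Tot_m_component E_def u(2) koszul_apply)
  next
    fix u v assume "u \<in> words T" "v \<in> words T" "length u + 1 + length v > 2"
    then show "m\<^sub>T (u @ (- 1, E) # v) = 0"
      using C.tensor_m_unit[OF e words_component words_component, of u v]
      by (simp add: fun_eq_iff Tot_m_component E_def)
  qed
  then show ?thesis by (auto simp: unital_A_infinity_def)
qed

end

theorem Tot_m_natural:
  fixes scale :: "'k::field_char_0 \<Rightarrow> 'a::ab_group_add \<Rightarrow> 'a"
  assumes "cosimplicial_dg_comm_algebra scale A" "cosimplicial_dg_comm_algebra scale B"
    and f: "cosimplicial_hom scale A B f"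
  shows "preserves_operations (shift (Tot A)) (Tot_m scale A) (Tot_m scale B) (shift (Tot_map f))"
  unfolding preserves_operations_def
proof (intro ballI impI, rule ext)
  interpret A: cosimplicial_char_0 scale A by (rule cosimplicial_char_0.intro) fact
  interpret B: cosimplicial_char_0 scale B by (rule cosimplicial_char_0.intro) fact
  fix w n assume w: "w \<in> words (shift (Tot A))" "w \<noteq> []"
  have hom: "dg_alg_hom scale (obj A n) (obj B n) (f n)" using f by (simp add: cosimplicial_hom_def)
  have map: "map (component n) (map (\<lambda>(k, x). (k, shift (Tot_map f) k x)) w) =
      map (\<lambda>(k, x). (k, coeff_map n (f n) (k + 1) x)) (map (component n) w)"
    by (auto simp: shift_def Tot_map_def)
  show "shift (Tot_map f) (wdeg w + 1) (Tot_m scale A w) n =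
      Tot_m scale B (map (\<lambda>(k, x). (k, shift (Tot_map f) k x)) w) n"
    unfolding Tot_m_def map
    using tensor_m_hom[OF A.obj_algebra B.obj_algebra hom A.words_component[OF w(1)]]
    by (simp add: Tot_m_def shift_def Tot_map_def wdeg_map_fst add.commute del: map_map)
qed

text \<open>Canonicity is expressed by choosing the operations uniformly for all cosimplicial
  algebras at once and requiring every cosimplicial homomorphism to preserve them.\<close>

theorem theorem17:
  fixes scale :: "'k::field_char_0 \<Rightarrow> 'a::ab_group_add \<Rightarrow> 'a"
  assumes "vector_space scale"
  shows "\<exists>m :: 'a cosimplicial_dg_alg \<Rightarrow> (nat \<Rightarrow> nat list \<Rightarrow> 'a) word \<Rightarrow> (nat \<Rightarrow> nat list \<Rightarrow> 'a).
    (\<forall>A. cosimplicial_dg_comm_algebra scale A \<longrightarrow>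
      C_infinity_algebra (Tot_scale scale) (shift (Tot A)) (shift (Tot_diff A)) (m A) \<and>
      (unital_cosimplicial A \<longrightarrow> unital_A_infinity (shift (Tot A)) (m A))) \<and>
    (\<forall>A B f. cosimplicial_dg_comm_algebra scale A \<and> cosimplicial_dg_comm_algebra scale B \<and>
        cosimplicial_hom scale A B f \<longrightarrow>
      preserves_operations (shift (Tot A)) (m A) (m B) (shift (Tot_map f)))"
  using cosimplicial_char_0.C_infinity_Tot[OF cosimplicial_char_0.intro]
    cosimplicial_char_0.unital_Tot[OF cosimplicial_char_0.intro] Tot_m_natural
  by (intro exI[of _ "Tot_m scale"]) blast

end
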